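(* Assume that the random field $b$ satisfies A1–A6. Then for each $\lambda\in\mathbb{R}$ the limit $$\mu(\lambda,z)=f'(0)+\lim_{t\to\infty}\frac1t\log E\left[e^{-\lambda X^{z,t}(t)}\right]$$ exists $Q$-almost surely and is a finite constant (not depending on $\hat\omega$) that is independent of $z\in\mathbb{R}^n$; denote it $\mu(\lambda)$. Moreover, $\mu$ is a convex, positive and even function of $\lambda\in\mathbb{R}$, and $\mu(\lambda)/|\lambda|\to+\infty$ as $|\lambda|\to\infty$.
   Context: Let $n\ge 2$, $L>0$, $D=[0,L]^{n-1}$. Let $f\in C^1([0,1])$ be a KPP nonlinearity: $f(0)=f(1)=0$, $f(u)>0$ for $u\in(0,1)$, and $f'(0)=\sup_{u\in(0,1)}f(u)/u$. The field: $b=b(y,t,\hat\omega)$, $y\in\mathbb{R}^{n-1}$, $t\ge0$, is a real Gaussian random field on a probability space $(\hat\Omega,\hat{\mathcal F},Q)$ (expectation $E_Q$), periodic in $y$ with period cell $D$, with covariance $\Gamma(y_1,y_2,t_1,t_2)=E_Q[b(y_1,t_1)b(y_2,t_2)]$. Assumptions: A1: for each $\hat\omega$ there is a continuous map $J(\cdot,\hat\omega):[0,\infty)\to C^{0,1}_P(D)$ with $b(\cdot,t,\hat\omega)=J(t,\hat\omega)$, where $C^{0,1}_P(D)$ is the space of Lipschitz continuous functions periodic with period cell $D$. A2: for each $s\ge0$ there is a $Q$-measure preserving $\tau_s:\hat\Omega\to\hat\Omega$ with $b(y,\cdot+s,\hat\omega)=b(y,\cdot,\tau_s\hat\omega)$;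 hence $\Gamma(y_1,y_2,s,t)$ depends only on $y_1,y_2,|t-s|$. A3: for $s>0$, $\tau_s$ is ergodic: any $A\in\hat{\mathcal F}$ invariant under $\tau_s$ has $Q(A)\in\{0,1\}$. A4: $b$ is almost surely continuous in $(y,t)$, $E_Q[b(y,t)]=0$ and $E_Q[b(y,t)^2]\le\sigma^2$ for all $y\in D$, $t\ge0$, for some finite $\sigma$. A5: $\hat\Gamma(r)=\sup_{y_1,y_2}\Gamma(y_1,y_2,0,r)$ is integrable on $[0,\infty)$, with $\int_0^\infty\hat\Gamma(r)\,dr=p_1<\infty$, $p_1>0$. A6: there is a finite $p_2>0$ with $|\Gamma(y_1,y_2,s,t)-\Gamma(y_1,y_3,s,t)|\le p_2|y_3-y_2|\hat\Gamma(|s-t|)$. The process: for fixed $\hat\omega$, $z=(x,y)\in\mathbb{R}\times\mathbb{R}^{n-1}$ and $t\ge0$, $Z^{z,t}(s)=(X^{z,t}(s),Y^{z,t}(s))$, $0\le s\le t$, is $$Y^{z,t}(s)=y+W_2(s),\qquad X^{z,t}(s)=x+\int_0^s b(Y^{z,t}(r),t-r,\hat\omega)\,dr+W_1(s),$$ where $W=(W_1,W_2)\in\mathbb{R}\times\mathbb{R}^{n-1}$ is a standard $n$-dimensional Wiener process with $W(0)=0$, independent of $b$; $P$ and $E$ denote probability and expectation with respect to $W$ (with $\hat\omega$ fixed). *)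

theory Defs
  imports "HOL-Probability.Probability"
begin

text \<open>
  Throughout, the spatial variable \<open>y\<close> ranges over \<open>real ^ 'm\<close>, so that \<open>n = CARD('m) + 1 \<ge> 2\<close>,
  and \<open>z = (x, y)\<close> ranges over \<open>real \<times> (real ^ 'm)\<close>.
\<close>

text \<open>\<open>f'\<close> is the derivative of \<open>f\<close> on \<open>[0,1]\<close>, one-sided at the end points.\<close>

definition kpp_nonlinearity :: "(real \<Rightarrow> real) \<Rightarrow> (real \<Rightarrow> real) \<Rightarrow> bool" where
  "kpp_nonlinearity f f' \<longleftrightarrow>
     (\<forall>u\<in>{0..1}. (f has_real_derivative f' u) (at u within {0..1})) \<and>
     continuous_on {0..1} f' \<and>
     f 0 = 0 \<and> f 1 = 0 \<and> (\<forall>u\<in>{0<..<1}. f u > 0) \<and>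
     f' 0 = (SUP u\<in>{0<..<1}. f u / u)"

definition period_cell :: "real \<Rightarrow> (real ^ 'm) set" where
  "period_cell L = cbox 0 (\<chi> i. L)"

definition cell_periodic :: "real \<Rightarrow> (real ^ 'm \<Rightarrow> real) \<Rightarrow> bool" where
  "cell_periodic L g \<longleftrightarrow> (\<forall>y i. g (y + axis i L) = g y)"

definition periodic_lipschitz :: "real \<Rightarrow> (real ^ 'm \<Rightarrow> real) set" where
  "periodic_lipschitz L = {g. cell_periodic L g \<and> (\<exists>C. C-lipschitz_on UNIV g)}"

text \<open>Both suprema are over bounded sets when \<open>g\<close> is in \<^term>\<open>periodic_lipschitz L\<close> and \<open>L > 0\<close>.\<close>

definition lipschitz_norm :: "(real ^ 'm \<Rightarrow> real) \<Rightarrow> real" where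
  "lipschitz_norm g =
     (SUP y. \<bar>g y\<bar>) + (SUP (y, y')\<in>{(y, y'). y \<noteq> y'}. \<bar>g y - g y'\<bar> / dist y y')"

definition continuous_into_lipschitz :: "real \<Rightarrow> (real \<Rightarrow> real ^ 'm \<Rightarrow> real) \<Rightarrow> bool" where
  "continuous_into_lipschitz L J \<longleftrightarrow>
     (\<forall>t\<ge>0. J t \<in> periodic_lipschitz L) \<and>
     (\<forall>t\<ge>0. ((\<lambda>s. lipschitz_norm (\<lambda>y. J s y - J t y)) \<longlongrightarrow> 0) (at t within {0..}))"

text \<open>Gaussian variables may be degenerate, i.e. almost surely constant.\<close>

definition gaussian_rv :: "'w measure \<Rightarrow> ('w \<Rightarrow> real) \<Rightarrow> bool" where
  "gaussian_rv M X \<longleftrightarrow>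
     X \<in> borel_measurable M \<and>
     ((\<exists>m. AE \<omega> in M. X \<omega> = m) \<or>
      (\<exists>m s. s > 0 \<and> distributed M lborel X (\<lambda>x. ennreal (normal_density m s x))))"

definition gaussian_field :: "'w measure \<Rightarrow> 'i set \<Rightarrow> ('i \<Rightarrow> 'w \<Rightarrow> real) \<Rightarrow> bool" where
  "gaussian_field M I X \<longleftrightarrow>
     (\<forall>S c. finite S \<and> S \<subseteq> I \<longrightarrow> gaussian_rv M (\<lambda>\<omega>. \<Sum>i\<in>S. c i * X i \<omega>))"

definition field_cov ::
  "'w measure \<Rightarrow> (real ^ 'm \<Rightarrow> real \<Rightarrow> 'w \<Rightarrow> real) \<Rightarrow> real ^ 'm \<Rightarrow> real ^ 'm \<Rightarrow> real \<Rightarrow> real \<Rightarrow> real" where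
  "field_cov Q b y1 y2 t1 t2 = (\<integral>\<omega>. b y1 t1 \<omega> * b y2 t2 \<omega> \<partial>Q)"

definition sup_cov :: "'w measure \<Rightarrow> (real ^ 'm \<Rightarrow> real \<Rightarrow> 'w \<Rightarrow> real) \<Rightarrow> real \<Rightarrow> real" where
  "sup_cov Q b r = (SUP (y1, y2)\<in>UNIV. field_cov Q b y1 y2 0 r)"

definition measure_preserving_map :: "'w measure \<Rightarrow> ('w \<Rightarrow> 'w) \<Rightarrow> bool" where
  "measure_preserving_map M T \<longleftrightarrow> T \<in> M \<rightarrow>\<^sub>M M \<and> distr M M T = M"

definition ergodic_map :: "'w measure \<Rightarrow> ('w \<Rightarrow> 'w) \<Rightarrow> bool" where
  "ergodic_map M T \<longleftrightarrow>
     (\<forall>A\<in>sets M. T -` A \<inter> space M = A \<longrightarrow> measure M A \<in> {0, 1})"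

text \<open>The field \<open>b y t \<omega>\<close> is only constrained for \<open>t \<ge> 0\<close> and \<open>\<omega> \<in> space Q\<close>.\<close>

locale random_shear_field = prob_space Q
  for Q :: "'w measure" +
  fixes L :: real
    and b :: "real ^ 'm \<Rightarrow> real \<Rightarrow> 'w \<Rightarrow> real"
    and \<tau> :: "real \<Rightarrow> 'w \<Rightarrow> 'w"
  assumes L_pos: "L > 0"
    and gaussian: "gaussian_field Q (UNIV \<times> {0..}) (\<lambda>(y, t). b y t)"
    and periodic: "\<And>t \<omega>. t \<ge> 0 \<Longrightarrow> \<omega> \<in> space Q \<Longrightarrow> cell_periodic L (\<lambda>y. b y t \<omega>)"
    and A1: "\<And>\<omega>. \<omega> \<in> space Q \<Longrightarrow>
        \<exists>J. continuous_into_lipschitz L J \<and> (\<forall>t\<ge>0. (\<lambda>y. b y t \<omega>) = J t)"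
    and A2_preserving: "\<And>s. s \<ge> 0 \<Longrightarrow> measure_preserving_map Q (\<tau> s)"
    and A2_shift: "\<And>s t y \<omega>. s \<ge> 0 \<Longrightarrow> t \<ge> 0 \<Longrightarrow> \<omega> \<in> space Q \<Longrightarrow> b y (t + s) \<omega> = b y t (\<tau> s \<omega>)"
    and A3: "\<And>s. s > 0 \<Longrightarrow> ergodic_map Q (\<tau> s)"
    and A4_continuous: "AE \<omega> in Q. continuous_on (UNIV \<times> {0..}) (\<lambda>(y, t). b y t \<omega>)"
    and A4_mean: "\<And>y t. y \<in> period_cell L \<Longrightarrow> t \<ge> 0 \<Longrightarrow> (\<integral>\<omega>. b y t \<omega> \<partial>Q) = 0"
    and A4_variance: "\<exists>\<sigma>. \<forall>y\<in>period_cell L. \<forall>t\<ge>0. (\<integral>\<omega>. (b y t \<omega>)\<^sup>2 \<partial>Q) \<le> \<sigma>\<^sup>2"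
    and A5_integrable: "set_integrable lborel {0..} (sup_cov Q b)"
    and A5_pos: "(LBINT r:{0..}. sup_cov Q b r) > 0"
    and A6: "\<exists>p2>0. \<forall>y1 y2 y3. \<forall>s\<ge>0. \<forall>t\<ge>0.
        \<bar>field_cov Q b y1 y2 s t - field_cov Q b y1 y3 s t\<bar>
          \<le> p2 * norm (y3 - y2) * sup_cov Q b \<bar>s - t\<bar>"

locale standard_wiener_process = prob_space P
  for P :: "'v measure" +
  fixes W :: "real \<Rightarrow> 'v \<Rightarrow> 'e::euclidean_space"
  assumes measurable: "\<And>t. t \<ge> 0 \<Longrightarrow> W t \<in> borel_measurable P"
    and start: "\<And>v. v \<in> space P \<Longrightarrow> W 0 v = 0"
    and continuous_paths: "\<And>v. v \<in> space P \<Longrightarrow> continuous_on {0..} (\<lambda>t. W t v)"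
    and indep_increments: "\<And>(t :: nat \<Rightarrow> real) k. 0 \<le> t 0 \<Longrightarrow> mono t \<Longrightarrow>
        indep_vars (\<lambda>_. borel) (\<lambda>i v. W (t (Suc i)) v - W (t i) v) {..<k}"
    and normal_increments: "\<And>s t. 0 \<le> s \<Longrightarrow> s < t \<Longrightarrow>
        distributed P lborel (\<lambda>v. W t v - W s v)
          (\<lambda>x. ennreal (\<Prod>i\<in>Basis. normal_density 0 (sqrt (t - s)) (x \<bullet> i)))"

text \<open>
  The Wiener process \<open>W = (W\<^sub>1, W\<^sub>2)\<close> lives on a probability space \<open>P\<close> separate from that of the
  field. With \<open>\<omega>\<close> fixed, \<open>E\<close> is integration with respect to \<open>P\<close>; this is the product-space model of
  the independence of \<open>W\<close> and \<open>b\<close>.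
\<close>

definition Y_process ::
  "(real \<Rightarrow> 'v \<Rightarrow> real \<times> (real ^ 'm)) \<Rightarrow> real \<times> (real ^ 'm) \<Rightarrow> real \<Rightarrow> 'v \<Rightarrow> real ^ 'm" where
  "Y_process W z s v = snd z + snd (W s v)"

definition X_process ::
  "(real ^ 'm \<Rightarrow> real \<Rightarrow> 'w \<Rightarrow> real) \<Rightarrow> (real \<Rightarrow> 'v \<Rightarrow> real \<times> (real ^ 'm)) \<Rightarrow> 'w \<Rightarrow>
     real \<times> (real ^ 'm) \<Rightarrow> real \<Rightarrow> real \<Rightarrow> 'v \<Rightarrow> real" where
  "X_process b W \<omega> z t s v =
     fst z + integral {0..s} (\<lambda>r. b (Y_process W z r v) (t - r) \<omega>) + fst (W s v)"

end

theory Submission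
  imports Defs
begin

text \<open>
  The independent component \<open>W\<^sub>1\<close> only contributes the Gaussian weight \<open>exp (- l * W\<^sub>1 t)\<close>, and the
  expectation in question is the Feynman-Kac functional of the environment \<open>b\<close> (called \<open>fk\<close> below),
  evaluated at \<open>y\<close>, times \<open>exp (- l * x)\<close>. Three facts about it carry the proof.

  \<^item> Markov property (\<open>fk_markov\<close>): running the path over the time interval \<open>[0, s + t]\<close> and restarting it
    at time \<open>s\<close> shows that the logarithm of the supremum over \<open>y\<close> is subadditive and the logarithm
    of the infimum superadditive along the time shifts of the environment
    (\<open>ln_fk_sub_and_superadditive\<close>).

  \<^item> Harnack inequality (\<open>harnack\<close>): after one unit of time the heat flow on the torus has forgotten
    its starting point, up to a constant factor. Hence for \<open>t \<ge> 1\<close> the supremum at time \<open>t\<close> is at most the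
    infimum at time \<open>t + 1\<close>, times \<open>C * exp (3 * \<bar>l\<bar> * K)\<close> where \<open>K\<close> is the maximum of \<open>\<bar>b\<bar>\<close> over a time window
    of length two.

  \<^item> Integrability of that maximum (\<open>max_field_integrable\<close>): by Fernique's rotation argument
    (\<open>fernique\<close>), the supremum of a countable centred Gaussian family that is bounded for every \<open>\<omega>\<close> has a
    finite mean.

  Let \<open>p k\<close> and \<open>q k\<close> be the expectations over the field of the logarithms of the supremum and of the
  infimum at time \<open>k\<close>. Cut the time axis into intervals of length \<open>k\<close> and apply the pointwise ergodic theorem to
  the ergodic map \<open>\<tau> k\<close>: almost surely all limit points of the logarithm divided by \<open>t\<close> lie between
  \<open>q k / k\<close> and \<open>p k / k\<close>. The Harnack inequality gives \<open>p k \<le> q (k + 1) + c\<close>, so that both bounds have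
  the same limit, the Lyapunov exponent. The value is the same for all starting points, because the
  supremum and the infimum range over all of them.

  The properties of the limit come from expectations at fixed times. Convexity is Hoelder's
  inequality for \<open>exp\<close>. Jensen's inequality and \<open>E b = 0\<close> give the lower bound \<open>l\<^sup>2 / 2\<close>, the exponent of the
  pure Gaussian weight, and hence superlinear growth and, as \<open>f' 0 > 0\<close> (\<open>kpp_derivative_pos\<close>), positivity. Evenness holds because
  \<open>(b, W\<^sub>1)\<close> and \<open>(- b, - W\<^sub>1)\<close> have the same law. The lower bound and the evenness, like the measurability in \<open>\<omega>\<close>,
  are proved by rounding space and time to a grid, which turns the functional into a finite sum of
  exponentials of finitely many Gaussian variables.
\<close>

section \<open>The pointwise ergodic theorem for an ergodic map\<close>

context prob_space begin

text \<open>The largest partial sum of \<open>g\<close> along the orbit of \<open>x\<close>, among those with at most \<open>n\<close> terms and the empty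
  one; the recursion peels off the first orbit point, which is the form used by Garsia.\<close>

fun max_sum :: "('a \<Rightarrow> 'a) \<Rightarrow> ('a \<Rightarrow> real) \<Rightarrow> nat \<Rightarrow> 'a \<Rightarrow> real" where
  "max_sum T g 0 x = 0"
| "max_sum T g (Suc n) x = max 0 (g x + max_sum T g n (T x))"

lemma max_sum_nonneg: "0 \<le> max_sum T g n x"
  by (cases n) auto

lemma sum_orbit_Suc:
  "(\<Sum>j<Suc n. g ((T ^^ j) x)) = g x + (\<Sum>j<n. g ((T ^^ j) (T x)))" for g :: "'a \<Rightarrow> real"
proof -
  have "(\<Sum>j<Suc n. g ((T ^^ j) x)) = g x + (\<Sum>j<n. g ((T ^^ Suc j) x))"
    by (subst sum.lessThan_Suc_shift) simp
  also have "(\<lambda>j. (T ^^ Suc j) x) = (\<lambda>j. (T ^^ j) (T x))"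
    by (simp only: funpow_Suc_right o_def)
  finally show ?thesis by (metis (mono_tags, lifting))
qed

lemma max_sum_mono: "max_sum T g n x \<le> max_sum T g (Suc n) x"
proof (induction n arbitrary: x)
  case (Suc n)
  from Suc[of "T x"] show ?case by auto
qed simp

lemma sum_le_max_sum: "(\<Sum>j<n. g ((T ^^ j) x)) \<le> max_sum T g n x"
proof (induction n arbitrary: x)
  case (Suc n)
  show ?case unfolding sum_orbit_Suc using Suc.IH[of "T x"] by simp
qed simp

lemma measure_preserving_integral:
  assumes "measure_preserving_map M T" "integrable M (g :: _ \<Rightarrow> real)"
  shows "integrable M (\<lambda>x. g (T x))" "(\<integral>x. g (T x) \<partial>M) = (\<integral>x. g x \<partial>M)"
proof -
  have T: "T \<in> M \<rightarrow>\<^sub>M M" "distr M M T = M" using assms by (auto simp: measure_preserving_map_def)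
  have "integrable (distr M M T) g" using T assms by simp
  then show "integrable M (\<lambda>x. g (T x))" using T(1) by (rule integrable_distr[rotated])
  have "(\<integral>x. g x \<partial>distr M M T) = (\<integral>x. g (T x) \<partial>M)"
    using T assms by (intro integral_distr) auto
  then show "(\<integral>x. g (T x) \<partial>M) = (\<integral>x. g x \<partial>M)" using T by simp
qed

lemma max_sum_integrable:
  assumes "measure_preserving_map M T" "integrable M g"
  shows "integrable M (max_sum T g n)"
proof (induction n)
  case 0 then show ?case by simp
next
  case (Suc n)
  have "integrable M (\<lambda>x. g x + max_sum T g n (T x))"
    using measure_preserving_integral(1)[OF assms(1) Suc] assms(2) by auto
  then show ?case by (simp add: integrable_max)
qed

text \<open>The set where the orbit sums are unbounded is invariant, so by ergodicity it has probability 0 or 1.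
  In the second case the integrands \<open>max_sum T g (Suc n) - max_sum T g n \<circ> T\<close>, whose integrals are
  nonnegative because \<open>T\<close> preserves the measure, would converge to \<open>g\<close>, whose integral is negative.\<close>

lemma orbit_sums_bounded_above:
  assumes mp: "measure_preserving_map M T" and erg: "ergodic_map M T"
    and g: "integrable M g" and neg: "(\<integral>x. (g x :: real) \<partial>M) < 0"
  shows "AE x in M. \<exists>c. \<forall>n. (\<Sum>j<n. g ((T ^^ j) x)) \<le> c"
proof -
  let ?m = "max_sum T g"
  have T[measurable]: "T \<in> M \<rightarrow>\<^sub>M M" using mp by (auto simp: measure_preserving_map_def)
  have mm[measurable]: "?m n \<in> borel_measurable M" for n
    using max_sum_integrable[OF mp g] by blast
  have gm[measurable]: "g \<in> borel_measurable M" using g by auto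
  define A where "A = {x \<in> space M. \<forall>k::nat. \<exists>n. ?m n x > real k}"
  have A[measurable]: "A \<in> sets M" unfolding A_def by measurable
  have unb: "(\<forall>k::nat. \<exists>n. f n > real k) \<longleftrightarrow> \<not> (\<exists>c. \<forall>n. f n \<le> c)" for f :: "nat \<Rightarrow> real"
    by (metis linorder_not_less reals_Archimedean2 order_less_imp_le order_le_less_trans)
  have step: "(\<exists>c. \<forall>n. ?m n (T x) \<le> c) \<longleftrightarrow> (\<exists>c. \<forall>n. ?m n x \<le> c)" for x
  proof
    assume "\<exists>c. \<forall>n. ?m n (T x) \<le> c"
    then obtain c where c: "\<And>n. ?m n (T x) \<le> c" by auto
    have "?m n x \<le> max 0 (g x + c)" for n
      using c by (cases n) (auto intro: max.coboundedI2)
    then show "\<exists>c. \<forall>n. ?m n x \<le> c" by blast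
  next
    assume "\<exists>c. \<forall>n. ?m n x \<le> c"
    then obtain c where c: "\<And>n. ?m n x \<le> c" by auto
    have "?m n (T x) \<le> c - g x" for n
      using c[of "Suc n"] by simp
    then show "\<exists>c. \<forall>n. ?m n (T x) \<le> c" by blast
  qed
  have Aeq: "T -` A \<inter> space M = A"
    using measurable_space[OF T] step unfolding A_def unb by fastforce
  then have "prob A \<in> {0,1}" using erg A by (auto simp: ergodic_map_def)
  moreover have "prob A \<noteq> 1"
  proof
    assume "prob A = 1"
    then have AA: "AE x in M. x \<in> A" using prob_eq_1[OF A] by simp
    let ?h = "\<lambda>n x. max (g x) (- ?m n (T x))"
    \<comment> \<open>On \<open>A\<close>, the function \<open>max (g x) (- max_sum T g n (T x))\<close> is eventually equal to \<open>g x\<close>.\<close>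
    have "(\<lambda>n. \<integral>x. ?h n x \<partial>M) \<longlonglongrightarrow> (\<integral>x. g x \<partial>M)"
    proof (rule integral_dominated_convergence[where w="\<lambda>x. \<bar>g x\<bar>"])
      show "AE x in M. (\<lambda>n. ?h n x) \<longlonglongrightarrow> g x"
        using AA
      proof eventually_elim
        case (elim x)
        then have "T x \<in> A" using Aeq by auto
        then obtain n where n: "?m n (T x) > real (nat \<lceil>- g x\<rceil>)"
          unfolding A_def by blast
        have "?h k x = g x" if "k \<ge> n" for k
        proof -
          have "?m n (T x) \<le> ?m k (T x)"
            using lift_Suc_mono_le[of "\<lambda>n. ?m n (T x)", OF max_sum_mono that] .
          with n show ?thesis by linarith
        qed
        then show ?case by (intro tendsto_eventually) (auto simp: eventually_at_top_linorder)
      qed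
      show "AE x in M. norm (?h n x) \<le> \<bar>g x\<bar>" for n
        using max_sum_nonneg[of T g n] by (intro AE_I2) (auto simp: abs_if max_def; smt (verit))
    qed (use g in auto)
    moreover have "0 \<le> (\<integral>x. ?h n x \<partial>M)" for n
    proof -
      have h: "?h n x = ?m (Suc n) x - ?m n (T x)" for x by (simp add: max_def)
      have "(\<integral>x. ?h n x \<partial>M) = (\<integral>x. ?m (Suc n) x \<partial>M) - (\<integral>x. ?m n (T x) \<partial>M)"
        unfolding h using max_sum_integrable[OF mp g]
        by (intro Bochner_Integration.integral_diff measure_preserving_integral[OF mp])
      also have "\<dots> = (\<integral>x. ?m (Suc n) x \<partial>M) - (\<integral>x. ?m n x \<partial>M)"
        using measure_preserving_integral(2)[OF mp max_sum_integrable[OF mp g]] by simp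
      also have "\<dots> \<ge> 0"
        using integral_mono[OF max_sum_integrable[OF mp g] max_sum_integrable[OF mp g] max_sum_mono]
        by (simp del: max_sum.simps)
      finally show ?thesis .
    qed
    ultimately have "0 \<le> (\<integral>x. g x \<partial>M)" by (intro LIMSEQ_le_const) auto
    with neg show False by simp
  qed
  ultimately have "AE x in M. x \<notin> A" using prob_eq_0[OF A] by simp
  then show ?thesis
    using AE_space
  proof eventually_elim
    case (elim x)
    then obtain c where "\<And>n. ?m n x \<le> c" by (auto simp: A_def unb)
    then show ?case using sum_le_max_sum order_trans by metis
  qed
qed

text \<open>The centred function \<open>g - (E g + e / 2)\<close> has negative mean, so its orbit sums are bounded above.\<close>

lemma orbit_average_limsup:
  assumes mp: "measure_preserving_map M T" and erg: "ergodic_map M T"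
    and g: "integrable M g" and e: "e > (0::real)"
  shows "AE x in M. \<forall>\<^sub>F n in sequentially. (\<Sum>j<n. g ((T ^^ j) x)) / n < (\<integral>x. g x \<partial>M) + e"
proof -
  let ?h = "\<lambda>x. g x - ((\<integral>x. g x \<partial>M) + e / 2)"
  have "integrable M ?h" "(\<integral>x. ?h x \<partial>M) < 0" using g e by (auto simp: prob_space)
  from orbit_sums_bounded_above[OF mp erg this] show ?thesis
  proof eventually_elim
    case (elim x)
    then obtain c where c: "\<And>n. (\<Sum>j<n. ?h ((T ^^ j) x)) \<le> c" by blast
    have "(\<lambda>n. c / real n) \<longlonglongrightarrow> 0" by (rule lim_const_over_n)
    then have "\<forall>\<^sub>F n in sequentially. c / real n < e / 2"
      using e by (intro order_tendstoD) auto
    with eventually_gt_at_top[of 0] show ?case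
    proof eventually_elim
      case (elim n)
      have "(\<Sum>j<n. g ((T ^^ j) x)) \<le> c + n * ((\<integral>x. g x \<partial>M) + e / 2)"
        using c[of n] by (simp add: sum_subtractf)
      then have "(\<Sum>j<n. g ((T ^^ j) x)) / n \<le> (c + n * ((\<integral>x. g x \<partial>M) + e / 2)) / n"
        by (rule divide_right_mono) simp
      also have "\<dots> = c / n + ((\<integral>x. g x \<partial>M) + e / 2)" using elim by (simp add: add_divide_distrib)
      finally show ?case using elim(2) by linarith
    qed
  qed
qed

theorem birkhoff_ergodic:
  assumes mp: "measure_preserving_map M T" and erg: "ergodic_map M T"
    and g: "integrable M (g :: _ \<Rightarrow> real)"
  shows "AE x in M. (\<lambda>n. (\<Sum>j<n. g ((T ^^ j) x)) / n) \<longlonglongrightarrow> (\<integral>x. g x \<partial>M)"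
proof -
  have "AE x in M. \<forall>k. \<forall>\<^sub>F n in sequentially.
      (\<Sum>j<n. g ((T ^^ j) x)) / n < (\<integral>x. g x \<partial>M) + 1 / Suc k"
    by (intro AE_all_countable[THEN iffD2] allI orbit_average_limsup[OF mp erg g]) simp
  moreover have "AE x in M. \<forall>k. \<forall>\<^sub>F n in sequentially.
      (\<Sum>j<n. - g ((T ^^ j) x)) / n < (\<integral>x. - g x \<partial>M) + 1 / Suc k"
    by (intro AE_all_countable[THEN iffD2] allI orbit_average_limsup[OF mp erg]) (use g in auto)
  ultimately show ?thesis
  proof eventually_elim
    case (elim x)
    show ?case
    proof (rule LIMSEQ_I)
      fix r :: real assume "r > 0"
      then obtain k where k: "1 / Suc k < r" using nat_approx_posE by metis
      have "\<forall>\<^sub>F n in sequentially. norm ((\<Sum>j<n. g ((T ^^ j) x)) / n - (\<integral>x. g x \<partial>M)) < r"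
        using elim(1)[rule_format, of k] elim(2)[rule_format, of k]
        by eventually_elim (use k in \<open>simp add: sum_negf abs_less_iff\<close>)
      then show "\<exists>no. \<forall>n\<ge>no. norm ((\<Sum>j<n. g ((T ^^ j) x)) / n - (\<integral>x. g x \<partial>M)) < r"
        by (simp add: eventually_at_top_linorder)
    qed
  qed
qed

text \<open>The last term of an orbit sum is the difference of two consecutive sums with asymptotically equal averages.\<close>

corollary orbit_value_sublinear:
  assumes "measure_preserving_map M T" "ergodic_map M T" "integrable M (g :: _ \<Rightarrow> real)"
  shows "AE x in M. (\<lambda>n. g ((T ^^ n) x) / n) \<longlonglongrightarrow> 0"
  using birkhoff_ergodic[OF assms]
proof eventually_elim
  case (elim x)
  let ?S = "\<lambda>n. \<Sum>j<n. g ((T ^^ j) x)"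
  have "(\<lambda>n. ?S (Suc n) / Suc n * (Suc n / n) - ?S n / n)
      \<longlonglongrightarrow> (\<integral>x. g x \<partial>M) * 1 - (\<integral>x. g x \<partial>M)"
    by (intro tendsto_intros elim LIMSEQ_Suc[OF elim] LIMSEQ_Suc_n_over_n)
  moreover have "?S (Suc n) / Suc n * (Suc n / n) - ?S n / n = g ((T ^^ n) x) / n" for n
    by (cases "n = 0") (simp_all add: divide_simps)
  ultimately show ?case by simp
qed

end

section \<open>Finite-dimensional laws from characteristic functions\<close>

text \<open>The one-dimensional uniqueness theorem for characteristic functions, transferred to laws weighted by
  a bounded density. A phase \<open>\<theta>\<close> in the cosine replaces complex exponentials, since the
  sine is the cosine with phase \<open>- pi / 2\<close>.\<close>

lemma weighted_law_eqI:
  fixes X :: "'a \<Rightarrow> real" and Y :: "'b \<Rightarrow> real"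
  assumes "prob_space M" "prob_space N"
    and [measurable]: "X \<in> borel_measurable M" "Y \<in> borel_measurable N"
      "h \<in> borel_measurable M" "k \<in> borel_measurable N"
    and h: "\<And>x. 0 \<le> h x" "\<And>x. h x \<le> B" and k: "\<And>y. 0 \<le> k y" "\<And>y. k y \<le> B"
    and eq: "\<And>s \<theta>. (\<integral>x. h x * cos (\<theta> + s * X x) \<partial>M) = (\<integral>y. k y * cos (\<theta> + s * Y y) \<partial>N)"
    and A: "A \<in> sets borel"
  shows "(\<integral>x. h x * indicator A (X x) \<partial>M) = (\<integral>y. k y * indicator A (Y y) \<partial>N)"
proof -
  interpret M: prob_space M by fact
  interpret N: prob_space N by fact
  define c where "c = (\<integral>x. h x \<partial>M)"
  have c': "c = (\<integral>y. k y \<partial>N)" using eq[of 0 0] by (simp add: c_def)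
  have inth: "integrable M h" by (rule M.integrable_const_bound[of _ B]) (use h in auto)
  have intk: "integrable N k" by (rule N.integrable_const_bound[of _ B]) (use k in auto)
  have "c \<ge> 0" unfolding c_def using h by simp
  show ?thesis
  proof (cases "c = 0")
    case True
    have "AE x in M. h x = 0" "AE y in N. k y = 0"
      using True inth intk h k integral_nonneg_eq_0_iff_AE[OF inth] integral_nonneg_eq_0_iff_AE[OF intk]
      unfolding c_def c'[unfolded c_def] by auto
    then have "(\<integral>x. h x * indicator A (X x) \<partial>M) = 0" "(\<integral>y. k y * indicator A (Y y) \<partial>N) = 0"
      by (auto intro!: integral_eq_zero_AE)
    then show ?thesis by simp
  next
    case False
    with \<open>c \<ge> 0\<close> have "c > 0" by simp
    \<comment> \<open>The normalised weighted laws.\<close>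
    define M' where "M' = distr (density M (\<lambda>x. ennreal (h x / c))) borel X"
    define N' where "N' = distr (density N (\<lambda>x. ennreal (k x / c))) borel Y"
    have prob: "prob_space (density M (\<lambda>x. ennreal (h x / c)))" "prob_space (density N (\<lambda>x. ennreal (k x / c)))"
      using inth intk h k \<open>c > 0\<close> c'
      by (auto intro!: prob_spaceI simp: emeasure_density nn_integral_eq_integral c_def[symmetric] cong: nn_integral_cong_simp)
    have rd: "real_distribution M'" "real_distribution N'"
      unfolding M'_def N'_def
      by (intro prob_space.real_distribution_distr prob; simp)+
    interpret M': real_distribution M' by fact
    interpret N': real_distribution N' by fact
    have MF: "(\<integral>x. F x \<partial>M') = (\<integral>x. h x * F (X x) \<partial>M) / c" if [measurable]: "F \<in> borel_measurable borel"
      for F :: "real \<Rightarrow> real"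
      unfolding M'_def using h \<open>c > 0\<close>
      by (simp add: integral_distr integral_density)
    have NF: "(\<integral>x. F x \<partial>N') = (\<integral>x. k x * F (Y x) \<partial>N) / c" if [measurable]: "F \<in> borel_measurable borel"
      for F :: "real \<Rightarrow> real"
      unfolding N'_def using k \<open>c > 0\<close>
      by (simp add: integral_distr integral_density)
    have cosMN: "(\<integral>x. cos (\<theta> + s * x) \<partial>M') = (\<integral>x. cos (\<theta> + s * x) \<partial>N')" for \<theta> s
      using eq[of \<theta> s] by (simp add: MF NF)
    have "char M' t = char N' t" for t
    proof (rule complex_eqI)
      have "Re (char M' t) = (\<integral>x. cos (0 + t * x) \<partial>M')" "Re (char N' t) = (\<integral>x. cos (0 + t * x) \<partial>N')"
        unfolding char_def
        by (simp_all add: integral_Re[symmetric] M'.integrable_iexp N'.integrable_iexp Re_exp)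
      then show "Re (char M' t) = Re (char N' t)" unfolding cosMN by simp
      have "Im (char M' t) = (\<integral>x. cos (- (pi / 2) + t * x) \<partial>M')" "Im (char N' t) = (\<integral>x. cos (- (pi / 2) + t * x) \<partial>N')"
        unfolding char_def
        by (simp_all add: integral_Im[symmetric] M'.integrable_iexp N'.integrable_iexp Im_exp cos_add cos_diff)
      then show "Im (char M' t) = Im (char N' t)" unfolding cosMN by simp
    qed
    then have "M' = N'" by (intro Levy_uniqueness rd ext)
    moreover have "(\<integral>x. indicator A x \<partial>M') = (\<integral>x. h x * indicator A (X x) \<partial>M) / c"
      "(\<integral>x. indicator A x \<partial>N') = (\<integral>x. k x * indicator A (Y x) \<partial>N) / c"
      using A by (intro MF NF; simp)+
    ultimately show ?thesis using \<open>c > 0\<close> by simp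
  qed
qed

text \<open>Uniqueness in several dimensions follows from dimension one by replacing the coordinates, one at
  a time, by indicators of Borel sets. If indicators have been reached for the coordinates in \<open>J\<close>, their
  product \<open>H\<close> times \<open>1 + cos (\<theta> + U)\<close>, with \<open>U\<close> a linear combination, is a nonnegative weight; its products with
  cosines of one further coordinate expand into integrals that are already known to agree. The
  weighted laws of that coordinate are therefore equal, and subtracting the case of the weight \<open>H\<close> leaves that of \<open>H * cos (\<theta> + U)\<close>.\<close>

lemma joint_law_eqI:
  fixes X :: "'i \<Rightarrow> 'a \<Rightarrow> real" and Y :: "'i \<Rightarrow> 'b \<Rightarrow> real"
  assumes M: "prob_space M" and N: "prob_space N" and I: "finite I"
    and X[measurable]: "\<And>i. i \<in> I \<Longrightarrow> X i \<in> borel_measurable M"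
    and Y[measurable]: "\<And>i. i \<in> I \<Longrightarrow> Y i \<in> borel_measurable N"
    and eq: "\<And>c \<theta>. (\<integral>x. cos (\<theta> + (\<Sum>i\<in>I. c i * X i x)) \<partial>M) = (\<integral>y. cos (\<theta> + (\<Sum>i\<in>I. c i * Y i y)) \<partial>N)"
  shows "distr M (\<Pi>\<^sub>M i\<in>I. borel) (\<lambda>x. \<lambda>i\<in>I. X i x) = distr N (\<Pi>\<^sub>M i\<in>I. borel) (\<lambda>y. \<lambda>i\<in>I. Y i y)"
proof -
  interpret M: prob_space M by fact
  interpret N: prob_space N by fact
  let ?HX = "\<lambda>J A x. \<Prod>j\<in>J. indicator (A j) (X j x) :: real"
  let ?HY = "\<lambda>J A x. \<Prod>j\<in>J. indicator (A j) (Y j x) :: real"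
  have H01: "0 \<le> (\<Prod>j\<in>J. indicator (A j) (f j) :: real)" "(\<Prod>j\<in>J. indicator (A j) (f j) :: real) \<le> 1" for J A
    and f :: "'i \<Rightarrow> real"
    by (auto intro!: prod_nonneg prod_le_1)
  have key: "(\<integral>x. ?HX J A x * cos (\<theta> + (\<Sum>i\<in>I. c i * X i x)) \<partial>M) = (\<integral>y. ?HY J A y * cos (\<theta> + (\<Sum>i\<in>I. c i * Y i y)) \<partial>N)"
    if "finite J" "J \<subseteq> I" "\<And>i. A i \<in> sets borel" for J A c \<theta>
    using that
  proof (induction J arbitrary: c \<theta> rule: finite_induct)
    case empty
    then show ?case using eq by simp
  next
    case (insert j J)
    then have j: "j \<in> I" and J: "J \<subseteq> I" and [measurable]: "\<And>i. A i \<in> sets borel" by auto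
    note IH = insert.IH[OF J insert.prems(2)]
    have [measurable]: "X i \<in> borel_measurable M" "Y i \<in> borel_measurable N" if "i \<in> J" for i
      using that J by auto
    have [measurable]: "X j \<in> borel_measurable M" "Y j \<in> borel_measurable N" using j by auto
    have upd: "(\<Sum>i\<in>I. (a * c i + (if i = j then s else 0)) * Z i) = a * (\<Sum>i\<in>I. c i * Z i) + s * Z j"
      for a s and Z :: "'i \<Rightarrow> real"
      using I j by (simp add: ring_distribs sum.distrib sum_distrib_left mult.assoc if_distrib[of "\<lambda>x. x * _"] cong: if_cong)
    have e1: "(\<integral>x. ?HX J A x * cos (\<phi> + s * X j x) \<partial>M) = (\<integral>y. ?HY J A y * cos (\<phi> + s * Y j y) \<partial>N)" for \<phi> s
      using IH[of \<phi> "\<lambda>i. 0 * c i + (if i = j then s else 0)"] unfolding upd by simp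
    have e2: "(\<integral>x. ?HX J A x * cos (\<phi> + (a * (\<Sum>i\<in>I. c i * X i x) + s * X j x)) \<partial>M) =
       (\<integral>y. ?HY J A y * cos (\<phi> + (a * (\<Sum>i\<in>I. c i * Y i y) + s * Y j y)) \<partial>N)" for \<phi> a s
      using IH[of \<phi> "\<lambda>i. a * c i + (if i = j then s else 0)"] unfolding upd by simp
    have cosprod: "h * (1 + cos (\<theta> + u)) * cos (\<phi> + v) =
        h * cos (\<phi> + v) + (h * cos ((\<phi> + \<theta>) + (1 * u + v)) / 2 + h * cos ((\<phi> - \<theta>) + (- 1 * u + v)) / 2)" for h u v \<phi> :: real
    proof -
      have "(\<phi> + \<theta>) + (1 * u + v) = (\<phi> + v) + (\<theta> + u)" "(\<phi> - \<theta>) + (- 1 * u + v) = (\<phi> + v) - (\<theta> + u)"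
        by simp_all
      then show ?thesis by (simp only: cos_add[of "\<phi> + v"] cos_diff[of "\<phi> + v"]) (simp add: field_simps)
    qed
    have iM[simp]: "integrable M (\<lambda>x. ?HX J A x * cos (f x))" if [measurable]: "f \<in> borel_measurable M" for f
      by (rule M.integrable_const_bound[of _ 1]) (use H01 in \<open>auto simp: abs_mult intro!: mult_le_one\<close>)
    have iN[simp]: "integrable N (\<lambda>x. ?HY J A x * cos (f x))" if [measurable]: "f \<in> borel_measurable N" for f
      by (rule N.integrable_const_bound[of _ 1]) (use H01 in \<open>auto simp: abs_mult intro!: mult_le_one\<close>)
    have cosb: "0 \<le> 1 + cos t" "1 + cos t \<le> 2" for t :: real using cos_ge_minus_one[of t] cos_le_one[of t] by linarith+
    have w: "(\<integral>x. ?HX J A x * (1 + cos (\<theta> + (\<Sum>i\<in>I. c i * X i x))) * cos (\<phi> + s * X j x) \<partial>M) =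
       (\<integral>y. ?HY J A y * (1 + cos (\<theta> + (\<Sum>i\<in>I. c i * Y i y))) * cos (\<phi> + s * Y j y) \<partial>N)" for \<phi> s
    proof -
      have "(\<integral>x. ?HX J A x * (1 + cos (\<theta> + (\<Sum>i\<in>I. c i * X i x))) * cos (\<phi> + s * X j x) \<partial>M) =
          (\<integral>x. ?HX J A x * cos (\<phi> + s * X j x) \<partial>M) +
          ((\<integral>x. ?HX J A x * cos ((\<phi> + \<theta>) + (1 * (\<Sum>i\<in>I. c i * X i x) + s * X j x)) \<partial>M) / 2 +
           (\<integral>x. ?HX J A x * cos ((\<phi> - \<theta>) + (- 1 * (\<Sum>i\<in>I. c i * X i x) + s * X j x)) \<partial>M) / 2)"
        unfolding cosprod by simp
      also have "\<dots> = (\<integral>y. ?HY J A y * cos (\<phi> + s * Y j y) \<partial>N) +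
          ((\<integral>y. ?HY J A y * cos ((\<phi> + \<theta>) + (1 * (\<Sum>i\<in>I. c i * Y i y) + s * Y j y)) \<partial>N) / 2 +
           (\<integral>y. ?HY J A y * cos ((\<phi> - \<theta>) + (- 1 * (\<Sum>i\<in>I. c i * Y i y) + s * Y j y)) \<partial>N) / 2)"
        unfolding e1 e2 ..
      also have "\<dots> = (\<integral>y. ?HY J A y * (1 + cos (\<theta> + (\<Sum>i\<in>I. c i * Y i y))) * cos (\<phi> + s * Y j y) \<partial>N)"
        unfolding cosprod by simp
      finally show ?thesis .
    qed
    have Hb: "0 \<le> h * (1 + cos t)" "h * (1 + cos t) \<le> 2" if "0 \<le> h" "h \<le> 1" for h t :: real
      using mult_mono[OF that(2) cosb(2), of t] cosb(1)[of t] that by auto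
    have w1: "(\<integral>x. ?HX J A x * (1 + cos (\<theta> + (\<Sum>i\<in>I. c i * X i x))) * indicator (A j) (X j x) \<partial>M) =
       (\<integral>y. ?HY J A y * (1 + cos (\<theta> + (\<Sum>i\<in>I. c i * Y i y))) * indicator (A j) (Y j y) \<partial>N)"
      by (rule weighted_law_eqI[OF M N, where B=2])
         (use Hb H01 w in \<open>simp_all\<close>)
    have w2: "(\<integral>x. ?HX J A x * indicator (A j) (X j x) \<partial>M) = (\<integral>y. ?HY J A y * indicator (A j) (Y j y) \<partial>N)"
      by (rule weighted_law_eqI[OF M N, where B=1]) (use H01 e1 in simp_all)
    have i1: "integrable M (\<lambda>x. ?HX J A x * indicator (A j) (X j x))"
      "integrable M (\<lambda>x. ?HX J A x * indicator (A j) (X j x) * cos (\<theta> + (\<Sum>i\<in>I. c i * X i x)))"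
      by (rule M.integrable_const_bound[of _ 1]; use H01 in \<open>auto simp: abs_mult intro!: mult_le_one\<close>)+
    have i2: "integrable N (\<lambda>x. ?HY J A x * indicator (A j) (Y j x))"
      "integrable N (\<lambda>x. ?HY J A x * indicator (A j) (Y j x) * cos (\<theta> + (\<Sum>i\<in>I. c i * Y i x)))"
      by (rule N.integrable_const_bound[of _ 1]; use H01 in \<open>auto simp: abs_mult intro!: mult_le_one\<close>)+
    show ?case
      using w1 w2 i1 i2 insert.hyps by (simp add: algebra_simps)
  qed
  show ?thesis
  proof (rule measure_eqI_PiM_finite[OF I, where M="\<lambda>_. borel" and A="\<lambda>_. \<Pi>\<^sub>E i\<in>I. UNIV"])
    fix A assume A: "\<And>i. i \<in> I \<Longrightarrow> A i \<in> sets (borel :: real measure)"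
    define A' where "A' i = (if i \<in> I then A i else {})" for i
    have A'[measurable]: "\<And>i. A' i \<in> sets borel" using A by (auto simp: A'_def)
    have PA: "Pi\<^sub>E I A = Pi\<^sub>E I A'" by (intro PiE_cong) (auto simp: A'_def)
    have [measurable]: "Pi\<^sub>E I A' \<in> sets (\<Pi>\<^sub>M i\<in>I. borel)" using I by (intro sets_PiM_I_finite) auto
    have ind: "indicator (Pi\<^sub>E I A') (\<lambda>i\<in>I. f i) = (\<Prod>i\<in>I. indicator (A' i) (f i) :: real)" for f
      using I by (cases "\<forall>i\<in>I. f i \<in> A' i") (auto simp: indicator_def PiE_def Pi_def extensional_def)
    interpret DM: prob_space "distr M (\<Pi>\<^sub>M i\<in>I. borel) (\<lambda>x. \<lambda>i\<in>I. X i x)"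
      by (intro M.prob_space_distr) simp
    interpret DN: prob_space "distr N (\<Pi>\<^sub>M i\<in>I. borel) (\<lambda>x. \<lambda>i\<in>I. Y i x)"
      by (intro N.prob_space_distr) simp
    have "measure (distr M (\<Pi>\<^sub>M i\<in>I. borel) (\<lambda>x. \<lambda>i\<in>I. X i x)) (Pi\<^sub>E I A') = (\<integral>x. ?HX I A' x \<partial>M)"
    proof -
      have "measure (distr M (\<Pi>\<^sub>M i\<in>I. borel) (\<lambda>x. \<lambda>i\<in>I. X i x)) (Pi\<^sub>E I A') =
         (\<integral>z. indicator (Pi\<^sub>E I A') z \<partial>distr M (\<Pi>\<^sub>M i\<in>I. borel) (\<lambda>x. \<lambda>i\<in>I. X i x))"
        by simp
      also have "\<dots> = (\<integral>x. ?HX I A' x \<partial>M)" by (subst integral_distr) (simp_all add: ind)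
      finally show ?thesis .
    qed
    moreover have "measure (distr N (\<Pi>\<^sub>M i\<in>I. borel) (\<lambda>x. \<lambda>i\<in>I. Y i x)) (Pi\<^sub>E I A') = (\<integral>x. ?HY I A' x \<partial>N)"
    proof -
      have "measure (distr N (\<Pi>\<^sub>M i\<in>I. borel) (\<lambda>x. \<lambda>i\<in>I. Y i x)) (Pi\<^sub>E I A') =
         (\<integral>z. indicator (Pi\<^sub>E I A') z \<partial>distr N (\<Pi>\<^sub>M i\<in>I. borel) (\<lambda>x. \<lambda>i\<in>I. Y i x))"
        by simp
      also have "\<dots> = (\<integral>x. ?HY I A' x \<partial>N)" by (subst integral_distr) (simp_all add: ind)
      finally show ?thesis .
    qed
    moreover have "(\<integral>x. ?HX I A' x \<partial>M) = (\<integral>x. ?HY I A' x \<partial>N)"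
    proof -
      have "(\<integral>x. ?HX I A' x * cos (0 + (\<Sum>i\<in>I. 0 * X i x)) \<partial>M) = (\<integral>y. ?HY I A' y * cos (0 + (\<Sum>i\<in>I. 0 * Y i y)) \<partial>N)"
        by (rule key) (use I A' in auto)
      then show ?thesis by simp
    qed
    ultimately show "distr M (\<Pi>\<^sub>M i\<in>I. borel) (\<lambda>x. \<lambda>i\<in>I. X i x) (Pi\<^sub>E I A) = distr N (\<Pi>\<^sub>M i\<in>I. borel) (\<lambda>y. \<lambda>i\<in>I. Y i y) (Pi\<^sub>E I A)"
      unfolding PA DM.emeasure_eq_measure DN.emeasure_eq_measure by simp
  next
    show "range (\<lambda>_::nat. \<Pi>\<^sub>E i\<in>I. UNIV) \<subseteq> prod_algebra I (\<lambda>_. borel :: real measure)"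
      using I by (auto intro!: prod_algebraI_finite)
    show "(\<Union>i::nat. \<Pi>\<^sub>E i\<in>I. UNIV) = space (\<Pi>\<^sub>M i\<in>I. (borel :: real measure))" by (simp add: space_PiM)
    interpret DM: prob_space "distr M (\<Pi>\<^sub>M i\<in>I. borel) (\<lambda>x. \<lambda>i\<in>I. X i x)"
      by (intro M.prob_space_distr) simp
    show "distr M (\<Pi>\<^sub>M i\<in>I. borel) (\<lambda>x. \<lambda>i\<in>I. X i x) (\<Pi>\<^sub>E i\<in>I. UNIV) \<noteq> \<infinity>" by simp
  qed simp_all
qed

section \<open>Centred Gaussian families: symmetry and rotation\<close>

context prob_space begin

lemma gaussian_rv_square_integrable:
  assumes "gaussian_rv M X"
  shows "integrable M X" "integrable M (\<lambda>x. (X x)\<^sup>2)"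
proof -
  have X[measurable]: "X \<in> borel_measurable M" using assms by (auto simp: gaussian_rv_def)
  from assms consider (const) m where "AE x in M. X x = m"
    | (normal) m s where "s > 0" "distributed M lborel X (\<lambda>x. ennreal (normal_density m s x))"
    by (auto simp: gaussian_rv_def)
  then have "integrable M X \<and> integrable M (\<lambda>x. (X x)\<^sup>2)"
  proof cases
    case const
    have "integrable M (\<lambda>_. m)" "integrable M (\<lambda>_. m\<^sup>2)" by auto
    moreover have "AE x in M. m = X x" "AE x in M. m\<^sup>2 = (X x)\<^sup>2" using const by auto
    ultimately show ?thesis
      using integrable_cong_AE_imp[of M "\<lambda>_. m" X] integrable_cong_AE_imp[of M "\<lambda>_. m\<^sup>2" "\<lambda>x. (X x)\<^sup>2"]
      by simp
  next
    case normal
    have i: "integrable lborel (\<lambda>x. normal_density m s x * (x - m) ^ 2)"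
      "integrable lborel (\<lambda>x. normal_density m s x * x)" "integrable lborel (\<lambda>x. normal_density m s x)"
      using integrable_normal_moment[OF normal(1)] integrable_normal_moment_nz_1[OF normal(1)] normal(1) by auto
    have "normal_density m s x * x\<^sup>2 = normal_density m s x * (x - m) ^ 2
        + (2 * m * (normal_density m s x * x) - m\<^sup>2 * normal_density m s x)" for x
      by (simp add: power2_eq_square algebra_simps)
    then have "integrable lborel (\<lambda>x. normal_density m s x * x\<^sup>2)"
      using i by (simp only:) (intro Bochner_Integration.integrable_add Bochner_Integration.integrable_diff integrable_mult_right)
    then show ?thesis
      using i distributed_integrable[OF normal(2), of "\<lambda>x. x\<^sup>2"] distributed_integrable[OF normal(2), of "\<lambda>x. x"]
      by simp
  qed
  then show "integrable M X" "integrable M (\<lambda>x. (X x)\<^sup>2)" by auto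
qed

text \<open>A degenerate centred variable vanishes almost surely and satisfies the same formula with variance 0.\<close>

lemma gaussian_rv_expectation_cos:
  assumes "gaussian_rv M X" and mean: "(\<integral>x. X x \<partial>M) = 0"
  shows "(\<integral>x. cos (\<theta> + X x) \<partial>M) = cos \<theta> * exp (- (\<integral>x. (X x)\<^sup>2 \<partial>M) / 2)"
proof -
  have X[measurable]: "X \<in> borel_measurable M" using assms by (auto simp: gaussian_rv_def)
  from assms consider (const) m where "AE x in M. X x = m"
    | (normal) m s where "s > 0" "distributed M lborel X (\<lambda>x. ennreal (normal_density m s x))"
    by (auto simp: gaussian_rv_def)
  then show ?thesis
  proof cases
    case const
    have "(\<integral>x. X x \<partial>M) = (\<integral>x. m \<partial>M)" using const by (intro integral_cong_AE) auto
    then have "m = 0" using mean by (simp add: prob_space)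
    then have "(\<integral>x. cos (\<theta> + X x) \<partial>M) = (\<integral>x. cos \<theta> \<partial>M)" "(\<integral>x. (X x)\<^sup>2 \<partial>M) = (\<integral>x. 0 \<partial>M)"
      using const by (intro integral_cong_AE; auto)+
    then show ?thesis by (simp add: prob_space)
  next
    case normal
    have [simp]: "m = 0" using normal_distributed_expectation[OF normal] mean by simp
    have v: "(\<integral>x. (X x)\<^sup>2 \<partial>M) = s\<^sup>2" using normal_distributed_variance[OF normal] mean by simp
    have D: "distributed M lborel (\<lambda>x. X x / s) std_normal_density"
      using normal_standard_normal_convert[OF normal(1), of X 0] normal(2) by simp
    have dd: "distr M borel (\<lambda>x. X x / s) = std_normal_distribution"
      using D by (auto simp: distributed_def cong: distr_cong)
    have c: "char (distr M borel (\<lambda>x. X x / s)) s = complex_of_real (exp (- (s^2) / 2))"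
      unfolding dd char_std_normal_distribution ..
    have "(\<integral>x. iexp (X x) \<partial>M) = complex_of_real (exp (- (s^2) / 2))"
      using c normal(1) unfolding char_def by (subst (asm) integral_distr) auto
    moreover have ii: "integrable M (\<lambda>x. iexp (X x))" by (rule integrable_iexp) auto
    ultimately have "(\<integral>x. cos (X x) \<partial>M) = exp (- (s^2) / 2)" "(\<integral>x. sin (X x) \<partial>M) = 0"
      using integral_Re[OF ii] integral_Im[OF ii] by (simp_all add: Re_exp Im_exp)
    moreover have "integrable M (\<lambda>x. cos (X x))" "integrable M (\<lambda>x. sin (X x))"
      by (rule integrable_const_bound[of _ 1]; simp)+
    ultimately show ?thesis unfolding v by (simp add: cos_add)
  qed
qed

end

definition centered_gaussian_field :: "'w measure \<Rightarrow> 'i set \<Rightarrow> ('i \<Rightarrow> 'w \<Rightarrow> real) \<Rightarrow> bool" where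
  "centered_gaussian_field M I X \<longleftrightarrow> gaussian_field M I X \<and> (\<forall>i\<in>I. (\<integral>\<omega>. X i \<omega> \<partial>M) = 0)"

context prob_space begin

lemma gaussian_field_component:
  assumes "gaussian_field M I X" "i \<in> I"
  shows "gaussian_rv M (X i)"
  using assms(1)[unfolded gaussian_field_def, rule_format, of "{i}" "\<lambda>_. 1"] assms(2) by simp

lemma centered_gaussian_field_measurable:
  "centered_gaussian_field M I X \<Longrightarrow> i \<in> I \<Longrightarrow> X i \<in> borel_measurable M"
  using gaussian_field_component[of I X i] by (simp add: centered_gaussian_field_def gaussian_rv_def)

lemma centered_gaussian_expectation_cos:
  assumes "centered_gaussian_field M I X" "finite S" "S \<subseteq> I"
  shows "(\<integral>x. cos (\<theta> + (\<Sum>i\<in>S. c i * X i x)) \<partial>M)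
    = cos \<theta> * exp (- (\<integral>x. (\<Sum>i\<in>S. c i * X i x)\<^sup>2 \<partial>M) / 2)"
    and "integrable M (\<lambda>x. (\<Sum>i\<in>S. c i * X i x)\<^sup>2)"
proof -
  have G: "gaussian_rv M (\<lambda>x. \<Sum>i\<in>S. c i * X i x)"
    using assms by (auto simp: centered_gaussian_field_def gaussian_field_def)
  have "integrable M (X i)" "(\<integral>x. X i x \<partial>M) = 0" if "i \<in> S" for i
    using assms gaussian_rv_square_integrable(1)[OF gaussian_field_component[of I X i]] that
    by (auto simp: centered_gaussian_field_def)
  then have "(\<integral>x. (\<Sum>i\<in>S. c i * X i x) \<partial>M) = 0"
    by (subst Bochner_Integration.integral_sum) auto
  with G show "(\<integral>x. cos (\<theta> + (\<Sum>i\<in>S. c i * X i x)) \<partial>M)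
    = cos \<theta> * exp (- (\<integral>x. (\<Sum>i\<in>S. c i * X i x)\<^sup>2 \<partial>M) / 2)"
    by (rule gaussian_rv_expectation_cos)
  show "integrable M (\<lambda>x. (\<Sum>i\<in>S. c i * X i x)\<^sup>2)" by (rule gaussian_rv_square_integrable(2)[OF G])
qed

text \<open>The integrals of \<open>cos (\<theta> + U)\<close> depend on the linear combination \<open>U\<close> only through \<open>E U\<^sup>2\<close>.\<close>

lemma centered_gaussian_law_symmetric:
  assumes X: "centered_gaussian_field M I X" and S: "finite S" "S \<subseteq> I"
  shows "distr M (\<Pi>\<^sub>M i\<in>S. borel) (\<lambda>x. \<lambda>i\<in>S. - X i x) = distr M (\<Pi>\<^sub>M i\<in>S. borel) (\<lambda>x. \<lambda>i\<in>S. X i x)"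
proof (rule joint_law_eqI[OF prob_space_axioms prob_space_axioms S(1)])
  fix c \<theta>
  have "(\<integral>x. cos (\<theta> + (\<Sum>i\<in>S. c i * - X i x)) \<partial>M) = (\<integral>x. cos (\<theta> + (\<Sum>i\<in>S. (- c i) * X i x)) \<partial>M)"
    by simp
  also have "\<dots> = (\<integral>x. cos (\<theta> + (\<Sum>i\<in>S. c i * X i x)) \<partial>M)"
    unfolding centered_gaussian_expectation_cos(1)[OF X S] by (simp add: sum_negf)
  finally show "(\<integral>x. cos (\<theta> + (\<Sum>i\<in>S. c i * - X i x)) \<partial>M) = (\<integral>x. cos (\<theta> + (\<Sum>i\<in>S. c i * X i x)) \<partial>M)" .
qed (use S centered_gaussian_field_measurable[OF X] in auto)

text \<open>Two independent copies \<open>X\<close>, \<open>Y\<close> may be rotated by 45 degrees without changing their joint law: by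
  the parallelogram identity the rotation preserves the variances of all linear combinations. The boolean
  index separates the two copies.\<close>

lemma centered_gaussian_rotation:
  fixes X :: "'i \<Rightarrow> 'a \<Rightarrow> real"
  assumes X: "centered_gaussian_field M I X" and S: "finite S" "S \<subseteq> I"
  shows "distr (M \<Otimes>\<^sub>M M) (\<Pi>\<^sub>M i\<in>UNIV \<times> S. borel)
      (\<lambda>\<omega>. \<lambda>(a, i)\<in>UNIV \<times> S. if a then X i (snd \<omega>) else X i (fst \<omega>))
    = distr (M \<Otimes>\<^sub>M M) (\<Pi>\<^sub>M i\<in>UNIV \<times> S. borel)
      (\<lambda>\<omega>. \<lambda>(a, i)\<in>UNIV \<times> S. if a then (X i (fst \<omega>) + X i (snd \<omega>)) / sqrt 2
                                       else (X i (fst \<omega>) - X i (snd \<omega>)) / sqrt 2)"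
proof -
  interpret MM: pair_prob_space M M ..
  have [measurable]: "X i \<in> borel_measurable M" if "i \<in> S" for i
    using centered_gaussian_field_measurable[OF X] S that by auto
  have UN: "(\<Sum>p\<in>UNIV \<times> S. f p) = (\<Sum>i\<in>S. f (False, i)) + (\<Sum>i\<in>S. f (True, i))" for f :: "bool \<times> 'i \<Rightarrow> real"
  proof -
    have "UNIV \<times> S = Pair False ` S \<union> Pair True ` S" by (auto simp: image_iff)
    then show ?thesis using S
      by (simp only:) (subst sum.union_disjoint, auto simp: sum.reindex inj_on_def)
  qed
  have prod: "(\<integral>\<omega>. cos (\<theta> + ((\<Sum>i\<in>S. c i * X i (fst \<omega>)) + (\<Sum>i\<in>S. d i * X i (snd \<omega>)))) \<partial>(M \<Otimes>\<^sub>M M)) =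
     cos \<theta> * exp (- ((\<integral>x. (\<Sum>i\<in>S. c i * X i x)\<^sup>2 \<partial>M) + (\<integral>x. (\<Sum>i\<in>S. d i * X i x)\<^sup>2 \<partial>M)) / 2)" for c d \<theta>
  proof -
    let ?f = "\<lambda>x y. cos ((\<theta> + (\<Sum>i\<in>S. c i * X i x)) + (\<Sum>i\<in>S. d i * X i y))"
    have "integrable (M \<Otimes>\<^sub>M M) (case_prod ?f)"
      by (rule MM.integrable_const_bound[of _ 1]) auto
    from MM.integral_fst'[OF this] have "(\<integral>\<omega>. case_prod ?f \<omega> \<partial>(M \<Otimes>\<^sub>M M)) = (\<integral>x. (\<integral>y. ?f x y \<partial>M) \<partial>M)"
      by (simp only: prod.case)
    also have "\<dots> = cos \<theta> * exp (- (\<integral>x. (\<Sum>i\<in>S. c i * X i x)\<^sup>2 \<partial>M) / 2) * exp (- (\<integral>x. (\<Sum>i\<in>S. d i * X i x)\<^sup>2 \<partial>M) / 2)"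
      by (simp add: centered_gaussian_expectation_cos[OF X S])
    also have "\<dots> = cos \<theta> * exp (- ((\<integral>x. (\<Sum>i\<in>S. c i * X i x)\<^sup>2 \<partial>M) + (\<integral>x. (\<Sum>i\<in>S. d i * X i x)\<^sup>2 \<partial>M)) / 2)"
      by (simp only: mult.assoc exp_add[symmetric] add_divide_distrib minus_add_distrib)
    finally show ?thesis by (simp only: case_prod_beta' add.assoc)
  qed
  show ?thesis
  proof (rule joint_law_eqI[OF MM.prob_space_axioms MM.prob_space_axioms])
    fix \<theta> and c :: "bool \<times> 'i \<Rightarrow> real"
    let ?c = "\<lambda>i. c (False, i)" and ?d = "\<lambda>i. c (True, i)"
    let ?c' = "\<lambda>i. (?d i + ?c i) / sqrt 2" and ?d' = "\<lambda>i. (?d i - ?c i) / sqrt 2"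
    have par: "(\<Sum>i\<in>S. ?c' i * X i x)\<^sup>2 + (\<Sum>i\<in>S. ?d' i * X i x)\<^sup>2 = (\<Sum>i\<in>S. ?c i * X i x)\<^sup>2 + (\<Sum>i\<in>S. ?d i * X i x)\<^sup>2" for x
    proof -
      have 1: "(\<Sum>i\<in>S. ?c' i * X i x) = ((\<Sum>i\<in>S. ?d i * X i x) + (\<Sum>i\<in>S. ?c i * X i x)) / sqrt 2"
       "(\<Sum>i\<in>S. ?d' i * X i x) = ((\<Sum>i\<in>S. ?d i * X i x) - (\<Sum>i\<in>S. ?c i * X i x)) / sqrt 2"
        by (simp_all add: sum.distrib[symmetric] sum_subtractf[symmetric] sum_divide_distrib distrib_right left_diff_distrib)
      have "((d + c) / sqrt 2)\<^sup>2 + ((d - c) / sqrt 2)\<^sup>2 = c\<^sup>2 + d\<^sup>2" for c d :: real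
        by (simp add: power_divide power2_sum power2_diff field_simps)
      then show ?thesis unfolding 1 .
    qed
    have E: "(\<integral>x. (\<Sum>i\<in>S. ?c' i * X i x)\<^sup>2 \<partial>M) + (\<integral>x. (\<Sum>i\<in>S. ?d' i * X i x)\<^sup>2 \<partial>M)
        = (\<integral>x. (\<Sum>i\<in>S. ?c i * X i x)\<^sup>2 \<partial>M) + (\<integral>x. (\<Sum>i\<in>S. ?d i * X i x)\<^sup>2 \<partial>M)"
      using centered_gaussian_expectation_cos(2)[OF X S]
      by (subst (1 2) Bochner_Integration.integral_add[symmetric]) (simp_all only: par)
    have 1: "(\<Sum>p\<in>UNIV \<times> S. c p * (case p of (a, i) \<Rightarrow> if a then X i y else X i x))
        = (\<Sum>i\<in>S. ?c i * X i x) + (\<Sum>i\<in>S. ?d i * X i y)" for x y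
      unfolding UN by simp
    have 2: "(\<Sum>p\<in>UNIV \<times> S. c p * (case p of (a, i) \<Rightarrow> if a then (X i x + X i y) / sqrt 2 else (X i x - X i y) / sqrt 2))
        = (\<Sum>i\<in>S. ?c' i * X i x) + (\<Sum>i\<in>S. ?d' i * X i y)" for x y
      unfolding UN sum.distrib[symmetric] by (intro sum.cong refl) (simp add: field_simps)
    show "(\<integral>\<omega>. cos (\<theta> + (\<Sum>p\<in>UNIV \<times> S. c p * (case p of (a, i) \<Rightarrow> if a then X i (snd \<omega>) else X i (fst \<omega>)))) \<partial>(M \<Otimes>\<^sub>M M))
      = (\<integral>\<omega>. cos (\<theta> + (\<Sum>p\<in>UNIV \<times> S. c p * (case p of (a, i) \<Rightarrow> if a then (X i (fst \<omega>) + X i (snd \<omega>)) / sqrt 2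
          else (X i (fst \<omega>) - X i (snd \<omega>)) / sqrt 2))) \<partial>(M \<Otimes>\<^sub>M M))"
      unfolding 1 2 prod E ..
  next
    fix p :: "bool \<times> 'i" assume "p \<in> UNIV \<times> S"
    then obtain a i where p: "p = (a, i)" "i \<in> S" by auto
    then have [measurable]: "X i \<in> borel_measurable M" by simp
    show "(\<lambda>\<omega>. case p of (a, i) \<Rightarrow> if a then X i (snd \<omega>) else X i (fst \<omega>)) \<in> borel_measurable (M \<Otimes>\<^sub>M M)"
      "(\<lambda>\<omega>. case p of (a, i) \<Rightarrow> if a then (X i (fst \<omega>) + X i (snd \<omega>)) / sqrt 2
          else (X i (fst \<omega>) - X i (snd \<omega>)) / sqrt 2) \<in> borel_measurable (M \<Otimes>\<^sub>M M)"
      unfolding p prod.case by (cases a; simp)+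
  qed (use S in simp)
qed

end

section \<open>Integrability of the supremum of a Gaussian family\<close>

context prob_space begin

text \<open>For independent copies, \<open>\<bar>X - Y\<bar> \<le> s * sqrt 2\<close> and \<open>\<bar>X + Y\<bar> > t * sqrt 2\<close> (in the maximum norm) force both \<open>\<bar>X\<bar>\<close> and
  \<open>\<bar>Y\<bar>\<close> to exceed \<open>(t - s) / sqrt 2\<close>; by rotation invariance the first event has the product
  probability on the left-hand side.\<close>

lemma fernique_finite:
  fixes X :: "'i \<Rightarrow> 'a \<Rightarrow> real"
  assumes X: "centered_gaussian_field M I X" and S: "finite S" "S \<subseteq> I"
  shows "prob {x\<in>space M. \<forall>i\<in>S. \<bar>X i x\<bar> \<le> s} * prob {x\<in>space M. \<exists>i\<in>S. \<bar>X i x\<bar> > t}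
    \<le> (prob {x\<in>space M. \<exists>i\<in>S. \<bar>X i x\<bar> > (t - s) / sqrt 2})\<^sup>2"
proof -
  interpret MM: pair_prob_space M M ..
  have [measurable]: "X i \<in> borel_measurable M" if "i \<in> S" for i
    using centered_gaussian_field_measurable[OF X] S that by auto
  have [measurable]: "finite S" by fact
  let ?P = "\<Pi>\<^sub>M i\<in>UNIV \<times> S. (borel :: real measure)"
  define B where "B = {z\<in>space ?P. (\<forall>i\<in>S. \<bar>z (False, i)\<bar> \<le> s) \<and> (\<exists>i\<in>S. \<bar>z (True, i)\<bar> > t)}"
  have [measurable]: "(\<lambda>z. z (a, i)) \<in> borel_measurable ?P" if "i \<in> S" for a i
    using that by (intro measurable_component_singleton) auto
  have B[measurable]: "B \<in> sets ?P" unfolding B_def using S(1) by measurable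
  let ?Z = "\<lambda>\<omega>. \<lambda>(a, i)\<in>UNIV \<times> S. if a then X i (snd \<omega>) else X i (fst \<omega>)"
  let ?Z' = "\<lambda>\<omega>. \<lambda>(a, i)\<in>UNIV \<times> S. if a then (X i (fst \<omega>) + X i (snd \<omega>)) / sqrt 2
                                       else (X i (fst \<omega>) - X i (snd \<omega>)) / sqrt 2"
  have Z: "?Z \<in> M \<Otimes>\<^sub>M M \<rightarrow>\<^sub>M ?P" "?Z' \<in> M \<Otimes>\<^sub>M M \<rightarrow>\<^sub>M ?P"
  proof (safe intro!: measurable_restrict)
    fix a i assume "i \<in> S"
    then have [measurable]: "X i \<in> borel_measurable M" by simp
    show "(\<lambda>\<omega>. if a then X i (snd \<omega>) else X i (fst \<omega>)) \<in> borel_measurable (M \<Otimes>\<^sub>M M)"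
      "(\<lambda>\<omega>. if a then (X i (fst \<omega>) + X i (snd \<omega>)) / sqrt 2
          else (X i (fst \<omega>) - X i (snd \<omega>)) / sqrt 2) \<in> borel_measurable (M \<Otimes>\<^sub>M M)"
      by (cases a; simp)+
  qed
  have eq: "measure (M \<Otimes>\<^sub>M M) (?Z -` B \<inter> space (M \<Otimes>\<^sub>M M)) = measure (M \<Otimes>\<^sub>M M) (?Z' -` B \<inter> space (M \<Otimes>\<^sub>M M))"
    using arg_cong[OF centered_gaussian_rotation[OF X S], of "\<lambda>D. measure D B"] Z B
    by (simp only: measure_distr)
  let ?le = "{x\<in>space M. \<forall>i\<in>S. \<bar>X i x\<bar> \<le> s}" and ?gt = "\<lambda>t. {x\<in>space M. \<exists>i\<in>S. \<bar>X i x\<bar> > t}"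
  have [measurable]: "?le \<in> sets M" "?gt u \<in> sets M" for u using S(1) by measurable
  have times: "measure (M \<Otimes>\<^sub>M M) (U \<times> V) = prob U * prob V" if "U \<in> sets M" "V \<in> sets M" for U V
    using that by (simp add: measure_def emeasure_pair_measure_Times enn2real_mult)
  have Zin: "?Z \<omega> \<in> B \<longleftrightarrow> (\<forall>i\<in>S. \<bar>X i (fst \<omega>)\<bar> \<le> s) \<and> (\<exists>i\<in>S. \<bar>X i (snd \<omega>)\<bar> > t)" for \<omega>
    by (auto simp: B_def space_PiM)
  have "prob ?le * prob (?gt t) = measure (M \<Otimes>\<^sub>M M) (?le \<times> ?gt t)"
    by (simp add: times)
  also have "?le \<times> ?gt t = ?Z -` B \<inter> space (M \<Otimes>\<^sub>M M)"
    using Zin by (auto simp: space_pair_measure)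
  also note eq
  also have "measure (M \<Otimes>\<^sub>M M) (?Z' -` B \<inter> space (M \<Otimes>\<^sub>M M)) \<le> measure (M \<Otimes>\<^sub>M M) (?gt ((t - s) / sqrt 2) \<times> ?gt ((t - s) / sqrt 2))"
  proof (rule MM.finite_measure_mono)
    show "?Z' -` B \<inter> space (M \<Otimes>\<^sub>M M) \<subseteq> ?gt ((t - s) / sqrt 2) \<times> ?gt ((t - s) / sqrt 2)"
    proof
      fix \<omega> assume w: "\<omega> \<in> ?Z' -` B \<inter> space (M \<Otimes>\<^sub>M M)"
      obtain x y where xy: "\<omega> = (x, y)" by (cases \<omega>)
      from w have x: "x \<in> space M" "y \<in> space M" by (auto simp: xy space_pair_measure)
      from w obtain i where i: "i \<in> S" "\<bar>(X i x + X i y) / sqrt 2\<bar> > t"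
        and "\<And>i. i \<in> S \<Longrightarrow> \<bar>(X i x - X i y) / sqrt 2\<bar> \<le> s"
        by (auto simp: xy B_def)
      then have "\<bar>(X i x - X i y) / sqrt 2\<bar> \<le> s" by auto
      with i(2) have *: "\<bar>X i x + X i y\<bar> > t * sqrt 2" "\<bar>X i x - X i y\<bar> \<le> s * sqrt 2"
        by (simp_all add: field_simps)
      have "(t - s) / sqrt 2 = (t * sqrt 2 - s * sqrt 2) / 2"
        using real_sqrt_mult_self[of 2] by (simp add: field_simps)
      moreover have "\<bar>a + b\<bar> - \<bar>a - b\<bar> \<le> 2 * \<bar>a\<bar>" "\<bar>a + b\<bar> - \<bar>a - b\<bar> \<le> 2 * \<bar>b\<bar>" for a b :: real
        by arith+
      from this[of "X i x" "X i y"] * have "2 * \<bar>X i x\<bar> > t * sqrt 2 - s * sqrt 2" "2 * \<bar>X i y\<bar> > t * sqrt 2 - s * sqrt 2"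
        by linarith+
      moreover have "w < u" if "w = r / 2" "r < 2 * u" for u w r :: real using that by simp
      ultimately have "\<bar>X i x\<bar> > (t - s) / sqrt 2" "\<bar>X i y\<bar> > (t - s) / sqrt 2" by blast+
      with i x show "\<omega> \<in> ?gt ((t - s) / sqrt 2) \<times> ?gt ((t - s) / sqrt 2)" by (auto simp: xy)
    qed
  qed auto
  also have "\<dots> = (prob (?gt ((t - s) / sqrt 2)))\<^sup>2" by (simp add: times power2_eq_square)
  finally show ?thesis .
qed

text \<open>Choose \<open>s\<close> with \<open>P (K \<le> s) \<ge> 3 / 4\<close>. Along the levels \<open>u j = 2 * s * 2 ^ j\<close> the inequality for finite
  families gives \<open>3 / 4 * G (j + 1) \<le> (G j)\<^sup>2\<close> for the tail probabilities \<open>G j\<close>, hence \<open>G j \<le> (1 / 3) ^ j / 4\<close>,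
  which beats the doubling of the levels.\<close>

theorem fernique:
  fixes X :: "'i \<Rightarrow> 'a \<Rightarrow> real"
  assumes X: "centered_gaussian_field M I X" and D: "countable D" "D \<noteq> {}" "D \<subseteq> I"
    and bdd: "\<And>x. x \<in> space M \<Longrightarrow> bdd_above ((\<lambda>i. \<bar>X i x\<bar>) ` D)"
  shows "integrable M (\<lambda>x. SUP i\<in>D. \<bar>X i x\<bar>)"
proof -
  define K where "K x = (SUP i\<in>D. \<bar>X i x\<bar>)" for x
  have mX[measurable]: "X i \<in> borel_measurable M" if "i \<in> D" for i
    using centered_gaussian_field_measurable[OF X] D that by auto
  have K[measurable]: "K \<in> borel_measurable M"
    unfolding K_def by (intro borel_measurable_cSUP D) (auto intro: bdd)
  have K_less: "K x > t \<longleftrightarrow> (\<exists>i\<in>D. \<bar>X i x\<bar> > t)" if "x \<in> space M" for x t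
    unfolding K_def by (rule less_cSUP_iff[OF D(2) bdd[OF that]])
  define S where "S n = from_nat_into D ` {..n}" for n :: nat
  have S: "finite (S n)" "S n \<subseteq> D" for n unfolding S_def using from_nat_into[OF D(2)] by auto
  have DS: "D = (\<Union>n. S n)" unfolding S_def image_UN[symmetric]
    using range_from_nat_into[OF D(2,1)] by (simp add: UN_atMost_UNIV)
  have incS: "incseq S" unfolding S_def by (intro monoI image_mono) auto
  have key: "prob {x\<in>space M. K x \<le> s} * prob {x\<in>space M. K x > t} \<le> (prob {x\<in>space M. K x > (t - s) / sqrt 2})\<^sup>2" for s t
  proof -
    let ?E = "\<lambda>n. {x\<in>space M. \<exists>i\<in>S n. \<bar>X i x\<bar> > t}"
    have mE: "{x\<in>space M. \<exists>i\<in>S n. \<bar>X i x\<bar> > u} \<in> sets M" for n u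
      using S[of n] mX by (intro sets.sets_Collect_finite_Ex) auto
    have mL: "{x\<in>space M. \<forall>i\<in>S n. \<bar>X i x\<bar> \<le> u} \<in> sets M" for n u
      using S[of n] mX by (intro sets.sets_Collect_finite_All) auto
    have U: "(\<Union>n. ?E n) = {x\<in>space M. K x > t}" using DS K_less by auto
    have "(\<lambda>n. prob (?E n)) \<longlonglongrightarrow> prob (\<Union>n. ?E n)"
      using mE incS by (intro finite_Lim_measure_incseq) (auto simp: incseq_def, blast)
    then have "(\<lambda>n. prob {x\<in>space M. K x \<le> s} * prob (?E n)) \<longlonglongrightarrow> prob {x\<in>space M. K x \<le> s} * prob {x\<in>space M. K x > t}"
      unfolding U by (intro tendsto_intros)
    then show ?thesis
    proof (rule LIMSEQ_le_const2, intro exI allI impI)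
      fix n
      have "prob {x\<in>space M. K x \<le> s} \<le> prob {x\<in>space M. \<forall>i\<in>S n. \<bar>X i x\<bar> \<le> s}"
      proof (rule finite_measure_mono[OF _ mL])
        show "{x\<in>space M. K x \<le> s} \<subseteq> {x\<in>space M. \<forall>i\<in>S n. \<bar>X i x\<bar> \<le> s}"
          using K_less S[of n] by (auto simp: not_less[symmetric])
      qed
      then have "prob {x\<in>space M. K x \<le> s} * prob (?E n) \<le> prob {x\<in>space M. \<forall>i\<in>S n. \<bar>X i x\<bar> \<le> s} * prob (?E n)"
        by (intro mult_right_mono) auto
      also have "\<dots> \<le> (prob {x\<in>space M. \<exists>i\<in>S n. \<bar>X i x\<bar> > (t - s) / sqrt 2})\<^sup>2"
        using S[of n] D by (intro fernique_finite[OF X]) auto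
      also have "\<dots> \<le> (prob {x\<in>space M. K x > (t - s) / sqrt 2})\<^sup>2"
      proof (intro power_mono finite_measure_mono)
        show "{x\<in>space M. \<exists>i\<in>S n. \<bar>X i x\<bar> > (t - s) / sqrt 2} \<subseteq> {x\<in>space M. K x > (t - s) / sqrt 2}"
          using K_less S[of n] by auto
      qed auto
      finally show "prob {x\<in>space M. K x \<le> s} * prob (?E n) \<le> (prob {x\<in>space M. K x > (t - s) / sqrt 2})\<^sup>2" .
    qed
  qed
  have K0: "0 \<le> K x" if "x \<in> space M" for x
    using D(2) K_less[OF that, of "-1"] by (smt (verit) ex_in_conv K_less that)
  obtain s where s: "s > 0" "prob {x\<in>space M. K x \<le> s} \<ge> 3 / 4"
  proof -
    have "(\<lambda>n. prob {x\<in>space M. K x \<le> real n}) \<longlonglongrightarrow> prob (\<Union>n. {x\<in>space M. K x \<le> real n})"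
      by (intro finite_Lim_measure_incseq) (auto simp: incseq_def)
    also have "(\<Union>n. {x\<in>space M. K x \<le> real n}) = space M" using real_arch_simple by auto
    finally have "(\<lambda>n. prob {x\<in>space M. K x \<le> real n}) \<longlonglongrightarrow> 1" by (simp add: prob_space)
    then have "\<forall>\<^sub>F n in sequentially. prob {x\<in>space M. K x \<le> real n} > 3 / 4"
      by (rule order_tendstoD) simp
    with eventually_gt_at_top[of 0] have "\<forall>\<^sub>F n in sequentially. n > 0 \<and> prob {x\<in>space M. K x \<le> real n} > 3 / 4"
      by eventually_elim auto
    then obtain n :: nat where "n > 0" "prob {x\<in>space M. K x \<le> real n} > 3 / 4"
      by (auto simp: eventually_at_top_linorder)
    then show ?thesis using that[of "real n"] by auto
  qed
  \<comment> \<open>Starting at \<open>2 * s\<close> makes \<open>(u (j + 1) - s) / sqrt 2 \<ge> u j\<close>.\<close>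
  define u where "u j = 2 * s * 2 ^ j" for j :: nat
  define G where "G j = prob {x\<in>space M. K x > u j}" for j
  have G: "G j \<le> 1 / 4 * (1 / 3) ^ j" for j
  proof (induction j)
    case 0
    have "G 0 \<le> prob {x\<in>space M. K x > s}" unfolding G_def u_def using s by (intro finite_measure_mono) auto
    also have "\<dots> = 1 - prob {x\<in>space M. K x \<le> s}"
      using prob_neg[of "\<lambda>x. K x \<le> s"] by (simp add: not_le)
    finally show ?case using s by simp
  next
    case (Suc j)
    have "3 / 4 * G (Suc j) \<le> prob {x\<in>space M. K x \<le> s} * G (Suc j)"
      using s by (intro mult_right_mono) (auto simp: G_def)
    also have "\<dots> \<le> (prob {x\<in>space M. K x > (u (Suc j) - s) / sqrt 2})\<^sup>2" unfolding G_def by (rule key)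
    also have "\<dots> \<le> (G j)\<^sup>2"
    proof -
      have "sqrt 2 \<le> 3 / 2" by (rule real_le_lsqrt) (auto simp: power2_eq_square)
      then have "u j * sqrt 2 \<le> u j * (3 / 2)" using s by (intro mult_left_mono) (auto simp: u_def)
      also have "\<dots> \<le> u (Suc j) - s"
      proof -
        have "s * 1 \<le> s * 2 ^ j" using s by (intro mult_left_mono) auto
        then show ?thesis by (simp add: u_def)
      qed
      finally have "u j \<le> (u (Suc j) - s) / sqrt 2" by (simp add: field_simps)
      then show ?thesis unfolding G_def by (intro power_mono finite_measure_mono) auto
    qed
    also have "\<dots> \<le> G j * (1 / 4)"
    proof -
      have "(1 / 3 :: real) ^ j \<le> 1" by (simp add: power_le_one)
      then have "G j \<le> 1 / 4" using Suc by simp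
      then show ?thesis unfolding power2_eq_square by (intro mult_left_mono) (auto simp: G_def)
    qed
    finally show ?case using Suc by simp
  qed
  have pt: "ennreal (K x) \<le> ennreal (2 * s) + (\<Sum>j. ennreal (u j) * indicator {x\<in>space M. K x > u j} x)"
    if x: "x \<in> space M" for x
  proof -
    have "\<exists>j. K x \<le> u j"
    proof -
      obtain n :: nat where "K x / (2 * s) < 2 ^ n" using real_arch_pow[of 2 "K x / (2 * s)"] by auto
      then have "K x \<le> u n" using s by (simp add: u_def field_simps)
      then show ?thesis ..
    qed
    define J where "J = (LEAST j. K x \<le> u j)"
    have J: "K x \<le> u J" unfolding J_def by (rule LeastI_ex) fact
    have below: "K x > u j" if "j < J" for j using not_less_Least[of j "\<lambda>j. K x \<le> u j"] that by (simp add: J_def)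
    have geo: "u m = 2 * s + (\<Sum>j<m. u j)" for m by (induction m) (auto simp: u_def)
    have "ennreal (K x) \<le> ennreal (2 * s + (\<Sum>j<J. u j))" using J geo[of J] by (intro ennreal_leI) simp
    also have "\<dots> = ennreal (2 * s) + (\<Sum>j<J. ennreal (u j))"
      using s by (subst ennreal_plus) (auto simp: u_def sum_ennreal intro!: sum_nonneg)
    also have "(\<Sum>j<J. ennreal (u j)) = (\<Sum>j<J. ennreal (u j) * indicator {x\<in>space M. K x > u j} x)"
      using below x by (intro sum.cong) auto
    also have "\<dots> \<le> (\<Sum>j. ennreal (u j) * indicator {x\<in>space M. K x > u j} x)"
      by (intro sum_le_suminf) auto
    finally show ?thesis by (simp add: add_left_mono)
  qed
  have "(\<integral>\<^sup>+x. ennreal (K x) \<partial>M) \<le> (\<integral>\<^sup>+x. ennreal (2 * s) + (\<Sum>j. ennreal (u j) * indicator {x\<in>space M. K x > u j} x) \<partial>M)"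
    by (intro nn_integral_mono pt)
  also have "\<dots> = ennreal (2 * s) + (\<Sum>j. ennreal (u j) * ennreal (G j))"
    by (subst nn_integral_add)
       (auto simp: nn_integral_suminf nn_integral_cmult_indicator prob_space G_def emeasure_eq_measure)
  also have "(\<Sum>j. ennreal (u j) * ennreal (G j)) \<le> (\<Sum>j. ennreal (s / 2 * (2 / 3) ^ j))"
  proof (intro suminf_le)
    fix j
    have "u j * G j \<le> u j * (1 / 4 * (1 / 3) ^ j)" using G s by (intro mult_left_mono) (auto simp: u_def)
    also have "\<dots> = s / 2 * (2 / 3) ^ j" by (simp add: u_def power_divide)
    finally show "ennreal (u j) * ennreal (G j) \<le> ennreal (s / 2 * (2 / 3) ^ j)"
      using s by (subst ennreal_mult[symmetric]) (auto simp: u_def G_def intro!: ennreal_leI)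
  qed auto
  finally have "(\<integral>\<^sup>+x. ennreal (K x) \<partial>M) \<le> ennreal (2 * s) + (\<Sum>j. ennreal (s / 2 * (2 / 3) ^ j))"
    by (simp add: add_left_mono)
  moreover have "(\<Sum>j. ennreal (s / 2 * (2 / 3) ^ j)) \<noteq> \<top>"
    using s by (intro ennreal_suminf_neq_top summable_mult summable_geometric) auto
  ultimately have "(\<integral>\<^sup>+x. ennreal (K x) \<partial>M) < \<infinity>"
    by (metis ennreal_add_eq_top ennreal_neq_top infinity_ennreal_def order_le_less_trans top.not_eq_extremum)
  then have "integrable M K" using K0 by (intro integrableI_nonneg) auto
  then show ?thesis by (simp add: K_def[abs_def])
qed

end

section \<open>Periodic environments and Riemann sums\<close>

definition lattice_vec :: "real \<Rightarrow> ('m \<Rightarrow> int) \<Rightarrow> real ^ 'm" where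
  "lattice_vec L k = (\<chi> i. L * of_int (k i))"

lemma cell_periodic_axis:
  assumes "cell_periodic L g"
  shows "g (y + axis i (L * of_int k)) = g y"
proof -
  have nat: "g (y + axis i (L * of_nat n)) = g y" for n y
  proof (induction n arbitrary: y)
    case 0
    have "y + axis i (L * of_nat 0) = y" by (simp add: axis_def vec_eq_iff)
    then show ?case by (simp only:)
  next
    case (Suc n)
    have "y + axis i (L * of_nat (Suc n)) = (y + axis i (L * of_nat n)) + axis i L"
      by (simp add: axis_def vec_eq_iff algebra_simps)
    then show ?case using assms Suc by (simp only: cell_periodic_def)
  qed
  show ?thesis
  proof (cases "k \<ge> 0")
    case True
    then show ?thesis using nat[of y "nat k"] by simp
  next
    case False
    have "g ((y + axis i (L * of_int k)) + axis i (L * of_nat (nat (-k)))) = g (y + axis i (L * of_int k))"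
      by (rule nat)
    moreover have "(y + axis i (L * of_int k)) + axis i (L * of_nat (nat (-k))) = y"
      using False by (simp add: axis_def vec_eq_iff)
    ultimately show ?thesis by simp
  qed
qed

lemma cell_periodic_lattice:
  assumes "cell_periodic L g"
  shows "g (y + lattice_vec L k) = g y"
proof -
  have "g (y + (\<chi> i. if i \<in> S then L * of_int (k i) else 0)) = g y" if "finite S" for S
    using that
  proof (induction S)
    case empty
    have "y + (\<chi> i. if i \<in> {} then L * of_int (k i) else 0) = y" by (simp add: vec_eq_iff)
    then show ?case by (simp only:)
  next
    case (insert j S)
    have "y + (\<chi> i. if i \<in> insert j S then L * of_int (k i) else 0)
        = (y + (\<chi> i. if i \<in> S then L * of_int (k i) else 0)) + axis j (L * of_int (k j))"
      using insert.hyps by (auto simp: axis_def vec_eq_iff)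
    then show ?case using cell_periodic_axis[OF assms] insert.IH by (simp only:)
  qed
  from this[of UNIV] show ?thesis by (simp add: lattice_vec_def)
qed

lemma lattice_reduction:
  assumes "L > 0"
  obtains k where "\<And>i. 0 \<le> (y + lattice_vec L k) $ i" "\<And>i. (y + lattice_vec L k) $ i \<le> L"
proof
  fix i
  let ?k = "\<lambda>i. - \<lfloor>y $ i / L\<rfloor>"
  have "L * of_int \<lfloor>y $ i / L\<rfloor> \<le> L * (y $ i / L)" "L * (y $ i / L) \<le> L * (of_int \<lfloor>y $ i / L\<rfloor> + 1)"
    using assms by (intro mult_left_mono; linarith)+
  then show "0 \<le> (y + lattice_vec L ?k) $ i" "(y + lattice_vec L ?k) $ i \<le> L"
    using assms by (simp_all add: lattice_vec_def distrib_left)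
qed

text \<open>A fixed realisation of the random field; only nonnegative times matter.\<close>

definition environment :: "real \<Rightarrow> (real ^ 'm \<Rightarrow> real \<Rightarrow> real) \<Rightarrow> bool" where
  "environment L \<beta> \<longleftrightarrow> continuous_on (UNIV \<times> {0..}) (\<lambda>(y, t). \<beta> y t) \<and> (\<forall>t\<ge>0. cell_periodic L (\<lambda>y. \<beta> y t))"

lemma environment_shift:
  assumes "environment L \<beta>" "t \<ge> 0"
  shows "environment L (\<lambda>y s. \<beta> y (s + t))"
proof -
  have "continuous_on (UNIV \<times> {0..}) ((\<lambda>(y, t). \<beta> y t) \<circ> (\<lambda>(y, s). (y, s + t)))"
    using assms by (intro continuous_on_compose)
      (auto simp: environment_def split_beta intro!: continuous_intros elim!: continuous_on_subset)
  then show ?thesis using assms by (simp add: environment_def o_def case_prod_beta')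
qed

lemma environment_uminus:
  "environment L \<beta> \<Longrightarrow> environment L (\<lambda>y s. - \<beta> y s)"
  by (auto simp: environment_def cell_periodic_def split_beta intro!: continuous_intros)

lemma environment_continuous_space:
  assumes "environment L \<beta>" "t \<ge> 0"
  shows "continuous_on UNIV (\<lambda>y. \<beta> y t)" "(\<lambda>y. \<beta> y t) \<in> borel_measurable borel"
proof -
  have "continuous_on UNIV ((\<lambda>(y, t). \<beta> y t) \<circ> (\<lambda>y. (y, t)))"
    using assms by (intro continuous_on_compose)
      (auto simp: environment_def intro!: continuous_intros elim!: continuous_on_subset)
  then show "continuous_on UNIV (\<lambda>y. \<beta> y t)" by (simp add: o_def)
  then show "(\<lambda>y. \<beta> y t) \<in> borel_measurable borel" by (rule borel_measurable_continuous_onI)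
qed

lemma environment_continuous_along:
  assumes "environment L \<beta>" "continuous_on S p" "continuous_on S q" "\<And>r. r \<in> S \<Longrightarrow> q r \<ge> 0"
  shows "continuous_on S (\<lambda>r. \<beta> (p r) (q r))"
proof -
  have "continuous_on S ((\<lambda>(y, t). \<beta> y t) \<circ> (\<lambda>r. (p r, q r)))"
    using assms by (intro continuous_on_compose)
      (auto simp: environment_def intro!: continuous_intros elim!: continuous_on_subset)
  then show ?thesis by (simp add: o_def)
qed

text \<open>By periodicity the bound follows from compactness of one period cell times a time interval.\<close>

lemma environment_bounded:
  assumes "L > 0" "environment L \<beta>"
  obtains B where "B \<ge> 0" "\<And>y s. 0 \<le> s \<Longrightarrow> s \<le> T \<Longrightarrow> \<bar>\<beta> y s\<bar> \<le> B"
proof -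
  let ?K = "cbox 0 (\<chi> i. L) \<times> {0..T} :: ((real ^ 'a) \<times> real) set"
  have "compact ((\<lambda>(y, t). \<beta> y t) ` ?K)"
    using assms(2) by (intro compact_continuous_image compact_Times compact_cbox compact_Icc)
      (auto simp: environment_def elim!: continuous_on_subset)
  then obtain B where "\<forall>x\<in>(\<lambda>(y, t). \<beta> y t) ` ?K. norm x \<le> B"
    using compact_imp_bounded bounded_iff by metis
  then have B: "\<And>z. z \<in> ?K \<Longrightarrow> \<bar>case z of (y, t) \<Rightarrow> \<beta> y t\<bar> \<le> B" by auto
  show ?thesis
  proof
    show "max B 0 \<ge> 0" by simp
    fix y :: "real ^ 'a" and s assume s: "0 \<le> s" "s \<le> T"
    obtain k where k: "\<And>i. 0 \<le> (y + lattice_vec L k) $ i" "\<And>i. (y + lattice_vec L k) $ i \<le> L"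
      using lattice_reduction[OF assms(1)] by metis
    have "\<beta> (y + lattice_vec L k) s = \<beta> y s"
      using assms(2) s by (intro cell_periodic_lattice[where g="\<lambda>y. \<beta> y s"]) (auto simp: environment_def)
    moreover have "\<bar>\<beta> (y + lattice_vec L k) s\<bar> \<le> B"
      using B[of "(y + lattice_vec L k, s)"] s k by (simp add: mem_box_cart)
    ultimately show "\<bar>\<beta> y s\<bar> \<le> max B 0" by simp
  qed
qed

text \<open>Two nearby points need not be moved into the cell by the same lattice vector, so the compact set
  is the cell enlarged by 1 in all directions.\<close>

lemma environment_uniformly_continuous:
  assumes "L > 0" "environment L \<beta>" "e > 0"
  obtains d where "d > 0" "\<And>y y' s. 0 \<le> s \<Longrightarrow> s \<le> T \<Longrightarrow> dist y y' < d \<Longrightarrow> \<bar>\<beta> y s - \<beta> y' s\<bar> < e"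
proof -
  let ?K = "cbox (\<chi> i. - 1) (\<chi> i. L + 1) \<times> {0..T} :: ((real ^ 'a) \<times> real) set"
  have "uniformly_continuous_on ?K (\<lambda>(y, t). \<beta> y t)"
    using assms(2) by (intro compact_uniformly_continuous compact_Times compact_cbox compact_Icc)
      (auto simp: environment_def elim!: continuous_on_subset)
  then obtain d where d: "d > 0"
    "\<And>z z'. z \<in> ?K \<Longrightarrow> z' \<in> ?K \<Longrightarrow> dist z' z < d \<Longrightarrow> dist (case z' of (y, t) \<Rightarrow> \<beta> y t) (case z of (y, t) \<Rightarrow> \<beta> y t) < e"
    using assms(3) unfolding uniformly_continuous_on_def by metis
  show ?thesis
  proof
    show "min d 1 > 0" using d by simp
    fix y y' :: "real ^ 'a" and s assume s: "0 \<le> s" "s \<le> T" and yy: "dist y y' < min d 1"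
    obtain k where k: "\<And>i. 0 \<le> (y + lattice_vec L k) $ i" "\<And>i. (y + lattice_vec L k) $ i \<le> L"
      using lattice_reduction[OF assms(1)] by metis
    have per: "\<beta> (x + lattice_vec L k) s = \<beta> x s" for x
      using assms(2) s by (intro cell_periodic_lattice[where g="\<lambda>y. \<beta> y s"]) (auto simp: environment_def)
    have k': "- 1 \<le> (y' + lattice_vec L k) $ i" "(y' + lattice_vec L k) $ i \<le> L + 1" for i
    proof -
      have "\<bar>(y' - y) $ i\<bar> \<le> norm (y' - y)" by (rule component_le_norm_cart)
      also have "\<dots> < 1" using yy by (simp add: dist_norm norm_minus_commute)
      finally show "- 1 \<le> (y' + lattice_vec L k) $ i" "(y' + lattice_vec L k) $ i \<le> L + 1"
        using k[of i] by (auto simp: algebra_simps)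
    qed
    have 1: "- 1 \<le> (y + lattice_vec L k) $ i" "(y + lattice_vec L k) $ i \<le> L + 1" for i
      using k[of i] by linarith+
    have "dist (y + lattice_vec L k, s) (y' + lattice_vec L k, s) < d"
      using yy by (simp add: dist_Pair_Pair)
    with d(2)[of "(y' + lattice_vec L k, s)" "(y + lattice_vec L k, s)"] 1 k' s
    show "\<bar>\<beta> y s - \<beta> y' s\<bar> < e" by (simp add: mem_box_cart per dist_real_def)
  qed
qed

lemma integral_eq_sum_subintervals:
  fixes f :: "real \<Rightarrow> real"
  assumes "continuous_on {a..a + real n * h} f" "h \<ge> 0"
  shows "integral {a..a + real n * h} f = (\<Sum>j<n. integral {a + real j * h..a + real (Suc j) * h} f)"
  using assms(1)
proof (induction n)
  case (Suc n)
  have le: "a \<le> a + real n * h" "a + real n * h \<le> a + real (Suc n) * h"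
    using assms(2) by (auto simp: algebra_simps)
  have "integral {a..a + real n * h} f + integral {a + real n * h..a + real (Suc n) * h} f
      = integral {a..a + real (Suc n) * h} f"
    using le Suc.prems by (intro Henstock_Kurzweil_Integration.integral_combine integrable_continuous_interval)
  moreover have "continuous_on {a..a + real n * h} f"
    using Suc.prems le by (auto elim!: continuous_on_subset)
  ultimately show ?case using Suc.IH by simp
qed simp

lemma riemann_sum_tendsto:
  fixes f :: "real \<Rightarrow> real"
  assumes f: "continuous_on {a..a + c} f" and c: "c \<ge> 0"
  shows "(\<lambda>N. c / real N * (\<Sum>j<N. f (a + real j * (c / real N)))) \<longlonglongrightarrow> integral {a..a + c} f"
proof (rule LIMSEQ_I)
  fix r :: real assume r: "r > 0"
  \<comment> \<open>The summand 1 covers intervals of length 0.\<close>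
  define e where "e = r / (c + 1)"
  have e: "e > 0" "e * c < r"
  proof -
    show "e > 0" using r c by (simp add: e_def)
    have "e * c < e * (c + 1)" using \<open>e > 0\<close> by (intro mult_strict_left_mono) auto
    also have "\<dots> = r" using c by (simp add: e_def)
    finally show "e * c < r" .
  qed
  have "uniformly_continuous_on {a..a + c} f"
    using f by (intro compact_uniformly_continuous) auto
  then obtain d where d: "d > 0" "\<And>x y. x \<in> {a..a + c} \<Longrightarrow> y \<in> {a..a + c} \<Longrightarrow> dist y x < d \<Longrightarrow> dist (f y) (f x) < e"
    using e(1) unfolding uniformly_continuous_on_def by metis
  obtain n0 :: nat where n0: "c / d < real n0" using reals_Archimedean2 by blast
  have "norm (c / real N * (\<Sum>j<N. f (a + real j * (c / real N))) - integral {a..a + c} f) < r" if "N \<ge> Suc n0" for N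
  proof -
    define h where "h = c / real N"
    have N: "real N > 0" using that by simp
    have h0: "h \<ge> 0" using c by (simp add: h_def)
    have Nh: "real N * h = c" using N by (simp add: h_def)
    have "c / d < real N" using n0 that by linarith
    then have hd: "h < d" using d(1) N by (simp add: h_def field_simps)
    have sub: "a + real (Suc j) * h \<le> a + c" "a \<le> a + real j * h" "a + real j * h \<le> a + real (Suc j) * h" if "j < N" for j
    proof -
      have "real (Suc j) * h \<le> real N * h" using that h0 by (intro mult_right_mono) auto
      then show "a + real (Suc j) * h \<le> a + c" using Nh by simp
      show "a \<le> a + real j * h" "a + real j * h \<le> a + real (Suc j) * h" using h0 by (auto simp: algebra_simps)
    qed
    have "integral {a..a + c} f = (\<Sum>j<N. integral {a + real j * h..a + real (Suc j) * h} f)"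
      using integral_eq_sum_subintervals[of a N h f] f h0 Nh by simp
    then have "h * (\<Sum>j<N. f (a + real j * h)) - integral {a..a + c} f
        = (\<Sum>j<N. h * f (a + real j * h) - integral {a + real j * h..a + real (Suc j) * h} f)"
      by (simp add: sum_distrib_left sum_subtractf)
    also have "norm \<dots> \<le> (\<Sum>j<N. e * h)"
    proof (rule sum_norm_le)
      fix j assume "j \<in> {..<N}"
      then have j: "j < N" by simp
      let ?I = "{a + real j * h..a + real (Suc j) * h}"
      have cont: "continuous_on ?I f" using f sub[OF j] by (auto elim!: continuous_on_subset)
      have "integral ?I (\<lambda>x. f (a + real j * h) - f x) = h * f (a + real j * h) - integral ?I f"
        using cont h0 by (subst Henstock_Kurzweil_Integration.integral_diff)
          (auto intro!: integrable_continuous_interval simp: algebra_simps)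
      moreover have "norm (integral ?I (\<lambda>x. f (a + real j * h) - f x)) \<le> e * ((a + real (Suc j) * h) - (a + real j * h))"
      proof (rule integral_bound)
        show "continuous_on ?I (\<lambda>x. f (a + real j * h) - f x)" using cont by (intro continuous_intros)
        fix x assume x: "x \<in> ?I"
        have "dist (a + real j * h) x < d" using x hd by (simp add: dist_real_def algebra_simps)
        then have "dist (f (a + real j * h)) (f x) < e"
          using x sub[OF j] by (intro d(2)) auto
        then show "norm (f (a + real j * h) - f x) \<le> e" by (simp add: dist_real_def)
      qed (use sub[OF j] in auto)
      ultimately show "norm (h * f (a + real j * h) - integral ?I f) \<le> e * h" by (simp add: algebra_simps)
    qed
    also have "\<dots> = e * c" using Nh by (simp add: algebra_simps)
    finally show ?thesis using e(2) by (simp add: h_def)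
  qed
  then show "\<exists>no. \<forall>N\<ge>no. norm (c / real N * (\<Sum>j<N. f (a + real j * (c / real N))) - integral {a..a + c} f) < r" by blast
qed

text \<open>Used to make suprema over uncountable sets measurable.\<close>

lemma SUP_dense:
  fixes f :: "'a::topological_space \<Rightarrow> real"
  assumes "closed S" "continuous_on S f" "D \<subseteq> S" "S \<subseteq> closure D" "D \<noteq> {}" "bdd_above (f ` S)"
  shows "(SUP x\<in>S. f x) = (SUP x\<in>D. f x)"
proof (rule antisym)
  have S: "closure D = S" using assms closure_minimal by blast
  have bD: "bdd_above (f ` D)" using assms(6,3) by (meson bdd_above_mono image_mono)
  show "(SUP x\<in>S. f x) \<le> (SUP x\<in>D. f x)"
  proof (rule cSUP_least)
    fix x assume "x \<in> S"
    then show "f x \<le> (SUP x\<in>D. f x)"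
      using S assms(2) bD by (intro continuous_le_on_closure[of D f x]) (auto intro: cSUP_upper)
  qed (use assms in auto)
  show "(SUP x\<in>D. f x) \<le> (SUP x\<in>S. f x)"
    using assms by (intro cSUP_subset_mono) auto
qed

section \<open>Increments of a Wiener process\<close>

lemma borel_measurable_fst_snd[measurable]:
  "fst \<in> borel_measurable (borel :: ('a::topological_space \<times> 'b::topological_space) measure)"
  "snd \<in> borel_measurable (borel :: ('a::topological_space \<times> 'b::topological_space) measure)"
  by (intro borel_measurable_continuous_onI continuous_intros)+

definition gauss_density :: "real \<Rightarrow> 'e::euclidean_space \<Rightarrow> real" where
  "gauss_density h x = (\<Prod>i\<in>Basis. normal_density 0 (sqrt h) (x \<bullet> i))"

lemma gauss_density_measurable[measurable]: "gauss_density h \<in> borel_measurable borel"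
  unfolding gauss_density_def by measurable

lemma gauss_density_nonneg: "0 \<le> gauss_density h x"
  unfolding gauss_density_def by (intro prod_nonneg) simp

context standard_wiener_process begin

lemma increment_law:
  assumes "0 \<le> s" "s < t"
  shows "distr P borel (\<lambda>v. W t v - W s v) = density lborel (\<lambda>x. ennreal (gauss_density (t - s) x))"
proof -
  have "distr P borel (\<lambda>v. W t v - W s v) = distr P lborel (\<lambda>v. W t v - W s v)"
    by (intro distr_cong) auto
  also have "\<dots> = density lborel (\<lambda>x. ennreal (gauss_density (t - s) x))"
    using distributed_distr_eq_density[OF normal_increments[OF assms]] by (simp add: gauss_density_def)
  finally show ?thesis .
qed

lemma W_law:
  assumes "0 < t"
  shows "distr P borel (W t) = density lborel (\<lambda>x. ennreal (gauss_density t x))"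
proof -
  have "distr P borel (W t) = distr P borel (\<lambda>v. W t v - W 0 v)"
    by (intro distr_cong) (auto simp: start)
  then show ?thesis using increment_law[of 0 t] assms by simp
qed

definition step_increments :: "real \<Rightarrow> real \<Rightarrow> nat \<Rightarrow> 'v \<Rightarrow> nat \<Rightarrow> 'e" where
  "step_increments s h N v = (\<lambda>i\<in>{..<N}. W (s + real (Suc i) * h) v - W (s + real i * h) v)"

lemma step_increments_measurable:
  assumes "0 \<le> s" "0 \<le> h"
  shows "step_increments s h N \<in> P \<rightarrow>\<^sub>M (\<Pi>\<^sub>M i\<in>{..<N}. borel)"
  unfolding step_increments_def using assms by (intro measurable_restrict borel_measurable_diff measurable) auto

lemma step_increments_law:
  assumes "0 \<le> s" "0 < h" "0 < N"
  shows "distr P (\<Pi>\<^sub>M i\<in>{..<N}. borel) (step_increments s h N)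
    = (\<Pi>\<^sub>M i\<in>{..<N}. density lborel (\<lambda>x. ennreal (gauss_density h x)))"
proof -
  let ?t = "\<lambda>i::nat. s + real i * h"
  have "mono ?t" using assms by (intro monoI) (simp add: mult_right_mono)
  then have "indep_vars (\<lambda>_. borel) (\<lambda>i v. W (?t (Suc i)) v - W (?t i) v) {..<N}"
    using assms by (intro indep_increments) auto
  then have "distr P (\<Pi>\<^sub>M i\<in>{..<N}. borel) (step_increments s h N)
      = (\<Pi>\<^sub>M i\<in>{..<N}. distr P borel (\<lambda>v. W (?t (Suc i)) v - W (?t i) v))"
    unfolding step_increments_def using assms
    by (subst (asm) indep_vars_iff_distr_eq_PiM')
       (auto intro!: borel_measurable_diff measurable)
  also have "\<dots> = (\<Pi>\<^sub>M i\<in>{..<N}. density lborel (\<lambda>x. ennreal (gauss_density h x)))"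
  proof (intro PiM_cong refl)
    fix i assume "i \<in> {..<N}"
    have "?t (Suc i) - ?t i = h" by (simp add: algebra_simps)
    then show "distr P borel (\<lambda>v. W (?t (Suc i)) v - W (?t i) v) = density lborel (\<lambda>x. ennreal (gauss_density h x))"
      using increment_law[of "?t i" "?t (Suc i)"] assms by (simp add: algebra_simps)
  qed
  finally show ?thesis .
qed

lemma step_increments_telescope:
  assumes "j \<le> N"
  shows "(\<Sum>i<j. step_increments s h N v i) = W (s + real j * h) v - W s v"
proof -
  have "(\<Sum>i<j. step_increments s h N v i) = (\<Sum>i<j. W (s + real (Suc i) * h) v - W (s + real i * h) v)"
    using assms by (intro sum.cong) (auto simp: step_increments_def)
  also have "\<dots> = W (s + real j * h) v - W (s + real 0 * h) v" by (rule sum_lessThan_telescope)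
  finally show ?thesis by simp
qed

text \<open>The two groups of increments are parts of one sequence of increments over a time grid
  whose step changes from \<open>a\<close> to \<open>b\<close> after \<open>N\<close> steps.\<close>

lemma step_increments_indep:
  assumes "0 < a" "0 < b"
  shows "indep_var (\<Pi>\<^sub>M i\<in>{..<N}. borel) (step_increments 0 a N) (\<Pi>\<^sub>M i\<in>{..<N}. borel) (step_increments (real N * a) b N)"
proof -
  \<comment> \<open>The grid of both groups of increments.\<close>
  define t where "t i = (if i \<le> N then real i * a else real N * a + real (i - N) * b)" for i :: nat
  define X where "X i v = W (t (Suc i)) v - W (t i) v" for i v
  have "mono t"
  proof (rule mono_iff_le_Suc[THEN iffD2], intro allI)
    fix i show "t i \<le> t (Suc i)"
    proof (cases "i \<le> N")
      case True
      then have "i < N \<or> i = N" by auto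
      then show ?thesis using assms by (auto simp: t_def mult_right_mono)
    next
      case False
      then show ?thesis using assms by (auto simp: t_def mult_right_mono)
    qed
  qed
  then have "indep_vars (\<lambda>_. borel) X {..<N + N}"
    unfolding X_def by (intro indep_increments \<open>mono t\<close>) (simp add: t_def)
  then have "indep_var (\<Pi>\<^sub>M i\<in>{..<N}. borel) (\<lambda>v. restrict (\<lambda>i. X i v) {..<N})
      (\<Pi>\<^sub>M i\<in>{N..<N + N}. borel) (\<lambda>v. restrict (\<lambda>i. X i v) {N..<N + N})"
    by (rule indep_var_restrict) auto
  then have "indep_var (\<Pi>\<^sub>M i\<in>{..<N}. borel) (id \<circ> (\<lambda>v. restrict (\<lambda>i. X i v) {..<N}))
      (\<Pi>\<^sub>M i\<in>{..<N}. borel) ((\<lambda>z. \<lambda>i\<in>{..<N}. z (N + i)) \<circ> (\<lambda>v. restrict (\<lambda>i. X i v) {N..<N + N}))"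
    by (rule indep_var_compose)
       (auto intro!: measurable_restrict measurable_component_singleton)
  moreover have "id \<circ> (\<lambda>v. restrict (\<lambda>i. X i v) {..<N}) = step_increments 0 a N"
    by (auto simp: step_increments_def X_def t_def fun_eq_iff)
  moreover have "(\<lambda>z. \<lambda>i\<in>{..<N}. z (N + i)) \<circ> (\<lambda>v. restrict (\<lambda>i. X i v) {N..<N + N}) = step_increments (real N * a) b N"
    by (auto simp: step_increments_def X_def t_def fun_eq_iff)
  ultimately show ?thesis by simp
qed

text \<open>The Markov property on the level of increments: the increments after time \<open>N * a\<close> are independent of
  the past and may be replaced by those of an independent copy starting at time 0.\<close>

lemma past_future:
  assumes ab: "0 < a" "0 < b" "0 < N"
    and k[measurable]: "k \<in> borel_measurable ((\<Pi>\<^sub>M i\<in>{..<N}. borel) \<Otimes>\<^sub>M (\<Pi>\<^sub>M i\<in>{..<N}. borel))"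
  shows "(\<integral>\<^sup>+v. k (step_increments 0 a N v, step_increments (real N * a) b N v) \<partial>P)
    = (\<integral>\<^sup>+v. (\<integral>\<^sup>+v'. k (step_increments 0 a N v, step_increments 0 b N v') \<partial>P) \<partial>P)"
proof -
  let ?B = "\<Pi>\<^sub>M i\<in>{..<N}. (borel :: 'e measure)"
  have U[measurable]: "step_increments 0 a N \<in> P \<rightarrow>\<^sub>M ?B" and V[measurable]: "step_increments (real N * a) b N \<in> P \<rightarrow>\<^sub>M ?B"
    and V0[measurable]: "step_increments 0 b N \<in> P \<rightarrow>\<^sub>M ?B"
    using ab by (intro step_increments_measurable; simp)+
  interpret V0: prob_space "distr P ?B (step_increments 0 b N)" by (rule prob_space_distr) simp
  have joint: "distr P (?B \<Otimes>\<^sub>M ?B) (\<lambda>v. (step_increments 0 a N v, step_increments (real N * a) b N v))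
      = distr P ?B (step_increments 0 a N) \<Otimes>\<^sub>M distr P ?B (step_increments 0 b N)"
    using step_increments_indep[OF ab(1,2), of N] ab
    by (simp add: indep_var_distribution_eq step_increments_law)
  have "(\<integral>\<^sup>+v. k (step_increments 0 a N v, step_increments (real N * a) b N v) \<partial>P)
      = (\<integral>\<^sup>+z. k z \<partial>distr P (?B \<Otimes>\<^sub>M ?B) (\<lambda>v. (step_increments 0 a N v, step_increments (real N * a) b N v)))"
    by (subst nn_integral_distr) auto
  also have "\<dots> = (\<integral>\<^sup>+u. (\<integral>\<^sup>+w. k (u, w) \<partial>distr P ?B (step_increments 0 b N)) \<partial>distr P ?B (step_increments 0 a N))"
    unfolding joint by (subst V0.nn_integral_fst[symmetric]) simp_all
  also have "\<dots> = (\<integral>\<^sup>+u. (\<integral>\<^sup>+v'. k (u, step_increments 0 b N v') \<partial>P) \<partial>distr P ?B (step_increments 0 a N))"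
    by (intro nn_integral_cong) (subst nn_integral_distr; simp)
  also have "\<dots> = (\<integral>\<^sup>+v. (\<integral>\<^sup>+v'. k (step_increments 0 a N v, step_increments 0 b N v') \<partial>P) \<partial>P)"
    by (subst nn_integral_distr) auto
  finally show ?thesis .
qed

end

locale shear_wiener = standard_wiener_process P W
  for P :: "'v measure" and W :: "real \<Rightarrow> 'v \<Rightarrow> real \<times> (real ^ 'm)"
begin

text \<open>The density of \<open>W t\<close> is a product over the coordinates, and multiplying the first factor by \<open>exp (- l * u)\<close>
  shifts its mean to \<open>- l * t\<close> after completion of the square.\<close>

lemma nn_integral_exp_first:
  assumes "0 \<le> t"
  shows "(\<integral>\<^sup>+v. ennreal (exp (- l * fst (W t v))) \<partial>P) = ennreal (exp (l\<^sup>2 * t / 2))"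
proof (cases "t = 0")
  case True
  have "(\<integral>\<^sup>+v. ennreal (exp (- l * fst (W t v))) \<partial>P) = (\<integral>\<^sup>+v. 1 \<partial>P)"
    using start True by (intro nn_integral_cong) simp
  then show ?thesis using True by (simp add: emeasure_space_1)
next
  case False
  with assms have t: "t > 0" by simp
  have [measurable]: "W t \<in> borel_measurable P" using measurable assms by simp
  let ?e = "(1, 0) :: real \<times> (real ^ 'm)"
  have eB: "?e \<in> Basis" by (simp add: Basis_prod_def)
  define f where "f b u = normal_density 0 (sqrt t) u * (if b = ?e then exp (- l * u) else 1)" for b u
  have tilt: "exp (- l * u) * normal_density 0 (sqrt t) u = exp (l\<^sup>2 * t / 2) * normal_density (- l * t) (sqrt t) u" for u
  proof -
    have "- l * u + - (u - 0)\<^sup>2 / (2 * (sqrt t)\<^sup>2) = l\<^sup>2 * t / 2 + - (u - (- l * t))\<^sup>2 / (2 * (sqrt t)\<^sup>2)"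
      using t by (simp add: field_simps power2_eq_square)
    then have "exp (- l * u) * exp (- (u - 0)\<^sup>2 / (2 * (sqrt t)\<^sup>2)) = exp (l\<^sup>2 * t / 2) * exp (- (u - (- l * t))\<^sup>2 / (2 * (sqrt t)\<^sup>2))"
      by (simp only: exp_add[symmetric])
    then show ?thesis unfolding normal_density_def by (metis mult.left_commute)
  qed
  have If: "(\<integral>\<^sup>+u. f b u \<partial>lborel) = (if b = ?e then ennreal (exp (l\<^sup>2 * t / 2)) else 1)" for b
  proof (cases "b = ?e")
    case True
    then have "f b = (\<lambda>u. exp (l\<^sup>2 * t / 2) * normal_density (- l * t) (sqrt t) u)"
      using tilt by (simp add: f_def mult.commute fun_eq_iff)
    then show ?thesis using True t
      by (simp add: ennreal_mult' nn_integral_cmult nn_integral_eq_integral)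
  next
    case False
    then show ?thesis using t by (simp add: f_def nn_integral_eq_integral)
  qed
  have "(\<integral>\<^sup>+v. ennreal (exp (- l * fst (W t v))) \<partial>P) = (\<integral>\<^sup>+x. ennreal (exp (- l * fst x)) \<partial>distr P borel (W t))"
    by (subst nn_integral_distr) auto
  also have "\<dots> = (\<integral>\<^sup>+x. ennreal (gauss_density t x) * ennreal (exp (- l * fst (x :: real \<times> (real ^ 'm)))) \<partial>lborel)"
    unfolding W_law[OF t] by (subst nn_integral_density) auto
  also have "\<dots> = (\<integral>\<^sup>+x. (\<Prod>b\<in>Basis. f b (x \<bullet> b)) \<partial>lborel)"
  proof (intro nn_integral_cong)
    fix x :: "real \<times> (real ^ 'm)"
    have "(\<Prod>b\<in>Basis. f b (x \<bullet> b)) = gauss_density t x * (\<Prod>b\<in>Basis. if b = ?e then exp (- l * (x \<bullet> b)) else 1)"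
      by (simp add: f_def gauss_density_def prod.distrib)
    also have "(\<Prod>b\<in>Basis. if b = ?e then exp (- l * (x \<bullet> b)) else 1) = exp (- l * fst x)"
      using eB by (subst prod.delta) (auto simp: inner_prod_def)
    finally show "ennreal (gauss_density t x) * ennreal (exp (- l * fst x)) = ennreal (\<Prod>b\<in>Basis. f b (x \<bullet> b))"
      by (simp add: ennreal_mult' gauss_density_nonneg ennreal_mult)
  qed
  also have "\<dots> = (\<Prod>b\<in>Basis. (\<integral>\<^sup>+u. f b u \<partial>lborel))"
    by (subst nn_integral_lborel_prod[symmetric]) (auto simp: f_def prod_ennreal)
  also have "\<dots> = ennreal (exp (l\<^sup>2 * t / 2))"
    unfolding If using eB by (subst prod.delta) auto
  finally show ?thesis .
qed

lemma exp_first: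
  assumes "0 \<le> t"
  shows "integrable P (\<lambda>v. exp (- l * fst (W t v)))" "(\<integral>v. exp (- l * fst (W t v)) \<partial>P) = exp (l\<^sup>2 * t / 2)"
proof -
  have [measurable]: "W t \<in> borel_measurable P" using measurable assms by simp
  show "integrable P (\<lambda>v. exp (- l * fst (W t v)))"
    using nn_integral_exp_first[OF assms, of l] by (intro integrableI_nonneg) auto
  show "(\<integral>v. exp (- l * fst (W t v)) \<partial>P) = exp (l\<^sup>2 * t / 2)"
    using nn_integral_exp_first[OF assms, of l] by (subst integral_eq_nn_integral) auto
qed

text \<open>Used for evenness: reversing \<open>l\<close> must be compensated in the weight \<open>exp (- l * W\<^sub>1)\<close> without touching the
  transverse motion \<open>W\<^sub>2\<close>.\<close>

lemma reflected_wiener: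
  "shear_wiener P (\<lambda>t v. (- fst (W t v), snd (W t v)))"
proof -
  let ?R = "\<lambda>x :: real \<times> (real ^ 'm). (- fst x, snd x)"
  have R[measurable]: "?R \<in> borel_measurable borel"
    by (intro borel_measurable_continuous_onI continuous_intros)
  have lb: "distr lborel borel ?R = (lborel :: (real \<times> (real ^ 'm)) measure)"
  proof -
    have "(lborel :: (real \<times> (real ^ 'm)) measure) = distr lborel borel uminus \<Otimes>\<^sub>M distr lborel borel (\<lambda>y. y)"
      unfolding lborel_distr_uminus by (subst distr_id2) (auto simp: lborel_prod)
    also have "\<dots> = distr (lborel \<Otimes>\<^sub>M lborel) (borel \<Otimes>\<^sub>M borel) (\<lambda>(x, y). (- x, y))"
      by (intro pair_measure_distr) (auto simp: distr_id2 intro: lborel.sigma_finite_measure_axioms)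
    also have "\<dots> = distr lborel borel ?R"
      by (simp add: lborel_prod borel_prod case_prod_beta')
    finally show ?thesis by simp
  qed
  have gR: "gauss_density h (?R x) = gauss_density h x" for h x
  proof -
    have "normal_density 0 (sqrt h) (?R x \<bullet> i) = normal_density 0 (sqrt h) (x \<bullet> i)" if "i \<in> Basis" for i
      using that by (auto simp: Basis_prod_def inner_prod_def normal_density_def)
    then show ?thesis unfolding gauss_density_def by (intro prod.cong) auto
  qed
  have mW: "\<And>t. t \<ge> 0 \<Longrightarrow> W t \<in> borel_measurable P" by (rule measurable)
  show ?thesis
  proof
    fix t :: real assume "0 \<le> t"
    then show "(\<lambda>v. ?R (W t v)) \<in> borel_measurable P"
      using mW[of t] R measurable_compose by blast
  next
    fix v assume v: "v \<in> space P"
    then show "?R (W 0 v) = 0" by (simp add: start zero_prod_def)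
    show "continuous_on {0..} (\<lambda>t. ?R (W t v))"
      using continuous_paths[OF v] by (intro continuous_intros)
  next
    fix t :: "nat \<Rightarrow> real" and k assume "0 \<le> t 0" "mono t"
    from indep_vars_compose2[OF indep_increments[OF this, of k], of "\<lambda>_. ?R" "\<lambda>_. borel"] R
    show "indep_vars (\<lambda>_. borel) (\<lambda>i v. ?R (W (t (Suc i)) v) - ?R (W (t i) v)) {..<k}"
      by (simp add: fst_diff snd_diff)
  next
    fix s t :: real assume st: "0 \<le> s" "s < t"
    have D[measurable]: "(\<lambda>v. W t v - W s v) \<in> borel_measurable P" using mW st by auto
    let ?g = "\<lambda>x. ennreal (gauss_density (t - s) x)"
    have "distr P borel (\<lambda>v. ?R (W t v - W s v)) = distr (distr P borel (\<lambda>v. W t v - W s v)) borel ?R"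
      by (subst distr_distr) (auto simp: o_def)
    also have "\<dots> = distr (density lborel (\<lambda>x. ?g (?R x))) borel ?R"
      unfolding increment_law[OF st] gR ..
    also have "\<dots> = density (distr lborel borel ?R) ?g"
      by (subst density_distr) auto
    also have "\<dots> = density lborel ?g" unfolding lb ..
    finally have "distr P lborel (\<lambda>v. ?R (W t v - W s v)) = density lborel ?g"
      by (simp cong: distr_cong)
    moreover have "(\<lambda>v. ?R (W t v) - ?R (W s v)) = (\<lambda>v. ?R (W t v - W s v))" by (simp add: fst_diff snd_diff)
    moreover have "(\<lambda>v. ?R (W t v - W s v)) \<in> borel_measurable P" using D R measurable_compose by blast
    ultimately show "distributed P lborel (\<lambda>v. ?R (W t v) - ?R (W s v))
        (\<lambda>x. ennreal (\<Prod>i\<in>Basis. normal_density 0 (sqrt (t - s)) (x \<bullet> i)))"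
      unfolding distributed_def gauss_density_def by (simp del: fst_diff snd_diff)
  qed
qed

end

section \<open>Random walks in an environment\<close>

context shear_wiener begin

definition drift :: "(real ^ 'm \<Rightarrow> real \<Rightarrow> real) \<Rightarrow> real \<Rightarrow> real ^ 'm \<Rightarrow> 'v \<Rightarrow> real" where
  "drift \<beta> t y v = integral {0..t} (\<lambda>r. \<beta> (y + snd (W r v)) (t - r))"

text \<open>The Feynman-Kac functional. Formally, as a function of \<open>t\<close> and \<open>y\<close> it solves \<open>u\<^sub>t = \<Delta> u / 2 + (l\<^sup>2 / 2 - l * \<beta>) * u\<close> with initial
  value 1. The weight of \<open>W\<^sub>1\<close> is kept inside the expectation instead of being split off as the factor
  \<open>exp (l\<^sup>2 * t / 2)\<close>: then only the increments of the whole process \<open>W\<close> have to be independent.\<close>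

definition fk :: "real \<Rightarrow> (real ^ 'm \<Rightarrow> real \<Rightarrow> real) \<Rightarrow> real \<Rightarrow> real ^ 'm \<Rightarrow> real" where
  "fk l \<beta> t y = (\<integral>v. exp (- l * (fst (W t v) + drift \<beta> t y v)) \<partial>P)"

text \<open>The discrete counterpart of the integrand of the Feynman-Kac functional, as a function of the
  increments \<open>x\<close> of a walk with \<open>N\<close> steps of duration \<open>h\<close>; \<open>g j\<close> is the environment seen at step \<open>j\<close>.\<close>

definition walk_weight :: "real \<Rightarrow> (nat \<Rightarrow> real ^ 'm \<Rightarrow> real) \<Rightarrow> nat \<Rightarrow> real \<Rightarrow> real ^ 'm \<Rightarrow> (nat \<Rightarrow> real \<times> (real ^ 'm)) \<Rightarrow> real" where
  "walk_weight l g N h y x = exp (- l * (fst (\<Sum>i<N. x i) + h * (\<Sum>j<N. g j (y + snd (\<Sum>i<j. x i)))))"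

definition walk_fk :: "real \<Rightarrow> (nat \<Rightarrow> real ^ 'm \<Rightarrow> real) \<Rightarrow> nat \<Rightarrow> real \<Rightarrow> real ^ 'm \<Rightarrow> real" where
  "walk_fk l g N h y = (\<integral>v. walk_weight l g N h y (step_increments 0 h N v) \<partial>P)"

lemma walk_weight_increments:
  "walk_weight l g N h y (step_increments s h N v) = exp (- l * (fst (W (s + real N * h) v) - fst (W s v)
      + h * (\<Sum>j<N. g j (y + (snd (W (s + real j * h) v) - snd (W s v))))))"
proof -
  have "(\<Sum>j<N. g j (y + snd (\<Sum>i<j. step_increments s h N v i))) = (\<Sum>j<N. g j (y + (snd (W (s + real j * h) v) - snd (W s v))))"
    by (intro sum.cong refl) (simp add: step_increments_telescope snd_diff)
  then show ?thesis unfolding walk_weight_def by (simp add: step_increments_telescope fst_diff)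
qed

lemma walk_weight_increments_0:
  assumes "v \<in> space P"
  shows "walk_weight l g N h y (step_increments 0 h N v)
    = exp (- l * (fst (W (real N * h) v) + h * (\<Sum>j<N. g j (y + snd (W (real j * h) v)))))"
  unfolding walk_weight_increments using start[OF assms] by simp

lemma partial_sum_measurable:
  "(j::nat) \<le> N \<Longrightarrow> (\<lambda>x. \<Sum>i<j. x i) \<in> borel_measurable (\<Pi>\<^sub>M i\<in>{..<N}. (borel :: 'e::euclidean_space measure))"
  by (rule borel_measurable_sum[where f="\<lambda>i x. x i"]) (auto intro!: measurable_component_singleton)

lemma walk_weight_measurable:
  assumes g: "\<And>j. j < N \<Longrightarrow> g j \<in> borel_measurable borel"
  shows "(\<lambda>(y, x). walk_weight l g N h y x) \<in> borel_measurable (borel \<Otimes>\<^sub>M (\<Pi>\<^sub>M i\<in>{..<N}. borel))"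
proof -
  let ?M = "(borel :: (real ^ 'm) measure) \<Otimes>\<^sub>M (\<Pi>\<^sub>M i\<in>{..<N}. (borel :: (real \<times> (real ^ 'm)) measure))"
  have ps: "(\<lambda>p. \<Sum>i<j. snd p i) \<in> borel_measurable ?M"
    if "j \<le> N" for j
    using that by (intro measurable_compose[OF measurable_snd partial_sum_measurable])
  have "(\<lambda>p. g j (fst p + snd (\<Sum>i<j. snd p i))) \<in> borel_measurable ?M"
    if j: "j < N" for j
  proof -
    have "(\<lambda>p. snd (\<Sum>i<j. snd p i)) \<in> borel_measurable ?M"
      using j by (intro measurable_compose[OF ps[of j] borel_measurable_fst_snd(2)]) simp
    then show ?thesis by (rule measurable_compose[OF borel_measurable_add[OF measurable_fst] g[OF j]])
  qed
  then have [measurable]: "(\<lambda>p. \<Sum>j<N. g j (fst p + snd (\<Sum>i<j. snd p i))) \<in> borel_measurable ?M"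
    by (intro borel_measurable_sum) auto
  have [measurable]: "(\<lambda>p. fst (\<Sum>i<N. snd p i)) \<in> borel_measurable ?M"
    by (rule measurable_compose[OF ps borel_measurable_fst_snd(1)]) simp
  then show ?thesis unfolding walk_weight_def case_prod_beta' by measurable
qed

lemma walk_weight_measurable_path:
  assumes g: "\<And>j. j < N \<Longrightarrow> g j \<in> borel_measurable borel"
  shows "walk_weight l g N h y \<in> borel_measurable (\<Pi>\<^sub>M i\<in>{..<N}. borel)"
  using measurable_Pair2[OF walk_weight_measurable[OF g]] by (simp add: space_pair_measure)

lemma walk_weight_bound:
  assumes B: "\<And>j x. j < N \<Longrightarrow> \<bar>g j x\<bar> \<le> B" and h: "0 \<le> h"
  shows "walk_weight l g N h y (step_increments s h N v) \<le> exp (\<bar>l\<bar> * (real N * h * B)) * exp (- l * (fst (W (s + real N * h) v) - fst (W s v)))"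
proof -
  let ?S = "h * (\<Sum>j<N. g j (y + (snd (W (s + real j * h) v) - snd (W s v))))"
  have "\<bar>\<Sum>j<N. g j (y + (snd (W (s + real j * h) v) - snd (W s v)))\<bar> \<le> (\<Sum>j<N. B)"
    using B by (intro order_trans[OF sum_abs] sum_mono) auto
  then have "\<bar>?S\<bar> \<le> h * (real N * B)" using h by (simp add: abs_mult mult_left_mono)
  then have "\<bar>l\<bar> * \<bar>?S\<bar> \<le> \<bar>l\<bar> * (real N * h * B)" by (intro mult_left_mono) (auto simp: mult_ac)
  moreover have "- l * ?S \<le> \<bar>l\<bar> * \<bar>?S\<bar>"
    using abs_ge_self[of "- l * ?S"] by (simp only: abs_mult abs_minus_cancel)
  ultimately have "- l * ?S \<le> \<bar>l\<bar> * (real N * h * B)" by linarith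
  then show ?thesis
    unfolding walk_weight_increments exp_add[symmetric] exp_le_cancel_iff
    by (subst distrib_left) linarith
qed

lemma walk_weight_bound_0:
  assumes B: "\<And>j x. j < N \<Longrightarrow> \<bar>g j x\<bar> \<le> B" and h: "0 \<le> h" and v: "v \<in> space P"
  shows "walk_weight l g N h y (step_increments 0 h N v) \<le> exp (\<bar>l\<bar> * (real N * h * B)) * exp (- l * fst (W (real N * h) v))"
proof -
  have "W (0 + real N * h) v - W 0 v = W (real N * h) v" using start[OF v] by simp
  then have "fst (W (0 + real N * h) v) - fst (W 0 v) = fst (W (real N * h) v)" by (metis fst_diff)
  then show ?thesis using walk_weight_bound[of N g B h l y 0 v, OF B h] by (simp only:)
qed

lemma walk_weight_nonneg [simp]: "0 \<le> walk_weight l g N h y x"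
  by (simp add: walk_weight_def)

lemma walk_weight_integrable:
  assumes g: "\<And>j. j < N \<Longrightarrow> g j \<in> borel_measurable borel" and B: "\<And>j x. j < N \<Longrightarrow> \<bar>g j x\<bar> \<le> B"
    and h: "0 \<le> h"
  shows "integrable P (\<lambda>v. walk_weight l g N h y (step_increments 0 h N v))"
proof (rule Bochner_Integration.integrable_bound)
  show "integrable P (\<lambda>v. exp (\<bar>l\<bar> * (real N * h * B)) * exp (- l * fst (W (real N * h) v)))"
    using h by (intro integrable_mult_right exp_first) auto
  show "(\<lambda>v. walk_weight l g N h y (step_increments 0 h N v)) \<in> borel_measurable P"
    using h by (intro measurable_compose[OF step_increments_measurable walk_weight_measurable_path[OF g]]) auto
  show "AE v in P. norm (walk_weight l g N h y (step_increments 0 h N v))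
      \<le> norm (exp (\<bar>l\<bar> * (real N * h * B)) * exp (- l * fst (W (real N * h) v)))"
    using walk_weight_bound_0[of N g B, OF B h] by (intro AE_I2) simp
qed

lemma walk_fk_nonneg: "0 \<le> walk_fk l g N h y"
  unfolding walk_fk_def by (intro integral_nonneg_AE) simp

lemma walk_fk_le:
  assumes g: "\<And>j. j < N \<Longrightarrow> g j \<in> borel_measurable borel" and B: "\<And>j x. j < N \<Longrightarrow> \<bar>g j x\<bar> \<le> B"
    and h: "0 \<le> h"
  shows "walk_fk l g N h y \<le> exp (\<bar>l\<bar> * (real N * h * B)) * exp (l\<^sup>2 * (real N * h) / 2)"
proof -
  have "walk_fk l g N h y \<le> (\<integral>v. exp (\<bar>l\<bar> * (real N * h * B)) * exp (- l * fst (W (real N * h) v)) \<partial>P)"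
    unfolding walk_fk_def
  proof (rule integral_mono)
    show "integrable P (\<lambda>v. walk_weight l g N h y (step_increments 0 h N v))"
      by (rule walk_weight_integrable[OF g B h])
    show "integrable P (\<lambda>v. exp (\<bar>l\<bar> * (real N * h * B)) * exp (- l * fst (W (real N * h) v)))"
      using h by (intro integrable_mult_right exp_first) auto
    show "walk_weight l g N h y (step_increments 0 h N v) \<le> exp (\<bar>l\<bar> * (real N * h * B)) * exp (- l * fst (W (real N * h) v))"
      if "v \<in> space P" for v
      by (rule walk_weight_bound_0[OF B h that])
  qed
  also have "\<dots> = exp (\<bar>l\<bar> * (real N * h * B)) * exp (l\<^sup>2 * (real N * h) / 2)"
    using exp_first(2)[of "real N * h" l] h by simp
  finally show ?thesis .
qed

lemma walk_fk_measurable: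
  assumes g: "\<And>j. j < N \<Longrightarrow> g j \<in> borel_measurable borel" and h: "0 \<le> h"
  shows "walk_fk l g N h \<in> borel_measurable borel"
proof -
  have "(\<lambda>p. (fst p, step_increments 0 h N (snd p))) \<in> borel \<Otimes>\<^sub>M P \<rightarrow>\<^sub>M borel \<Otimes>\<^sub>M (\<Pi>\<^sub>M i\<in>{..<N}. borel)"
    using h by (intro measurable_Pair measurable_fst measurable_compose[OF measurable_snd step_increments_measurable]) auto
  from measurable_compose[OF this walk_weight_measurable[OF g]]
  have "(\<lambda>(y, v). walk_weight l g N h y (step_increments 0 h N v)) \<in> borel_measurable (borel \<Otimes>\<^sub>M P)"
    by (simp add: case_prod_beta')
  then show ?thesis unfolding walk_fk_def[abs_def] by (rule borel_measurable_lebesgue_integral)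
qed

text \<open>In this form the discrete functional depends on the law of the increments only, and is thus the
  same for all Wiener processes.\<close>

lemma walk_fk_eq_PiM:
  assumes g: "\<And>j. j < N \<Longrightarrow> g j \<in> borel_measurable borel" and h: "0 < h" "0 < N"
  shows "walk_fk l g N h y = (\<integral>x. walk_weight l g N h y x \<partial>(\<Pi>\<^sub>M i\<in>{..<N}. density lborel (\<lambda>x. ennreal (gauss_density h x))))"
  unfolding walk_fk_def using h step_increments_law[of 0 h N, symmetric] walk_weight_measurable_path[OF g] step_increments_measurable[of 0 h N]
  by (simp add: integral_distr)

text \<open>The walk restarted after \<open>N\<close> steps starts at \<open>y + W\<^sub>2 (N * a)\<close>, a function of the past increments. The
  identity is first obtained for extended nonnegative integrals, where Fubini's theorem has no side conditions.\<close>

lemma markov_walk: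
  assumes g: "\<And>j. j < N \<Longrightarrow> g j \<in> borel_measurable borel" "\<And>j. j < N \<Longrightarrow> g' j \<in> borel_measurable borel"
    and B: "\<And>j x. j < N \<Longrightarrow> \<bar>g' j x\<bar> \<le> B"
    and ab: "0 < a" "0 < b" "0 < N"
  shows "(\<integral>v. walk_weight l g N a y (step_increments 0 a N v) *
        walk_weight l g' N b (y + snd (W (real N * a) v)) (step_increments (real N * a) b N v) \<partial>P)
    = (\<integral>v. walk_weight l g N a y (step_increments 0 a N v) * walk_fk l g' N b (y + snd (W (real N * a) v)) \<partial>P)"
proof -
  let ?B = "\<Pi>\<^sub>M i\<in>{..<N}. (borel :: (real \<times> (real ^ 'm)) measure)"
  let ?s = "real N * a"
  have s: "0 \<le> ?s" using ab by simp
  have Ws[measurable]: "W ?s \<in> borel_measurable P" by (rule measurable[OF s])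
  have [measurable]: "(\<lambda>v. snd (W ?s v)) \<in> borel_measurable P"
    by (rule measurable_compose[OF Ws borel_measurable_fst_snd(2)])
  have U[measurable]: "step_increments 0 a N \<in> P \<rightarrow>\<^sub>M ?B" and V[measurable]: "step_increments ?s b N \<in> P \<rightarrow>\<^sub>M ?B"
    and V0[measurable]: "step_increments 0 b N \<in> P \<rightarrow>\<^sub>M ?B"
    using ab by (intro step_increments_measurable; simp)+
  note [measurable] = walk_weight_measurable[OF g(1)] walk_weight_measurable[OF g(2)]
    walk_weight_measurable_path[OF g(1)] walk_weight_measurable_path[OF g(2)] walk_fk_measurable[OF g(2)]
  have sums: "(\<lambda>u. \<Sum>i<N. u i) \<in> borel_measurable ?B"
    by (rule partial_sum_measurable) simp
  have [measurable]: "(\<lambda>u. snd (\<Sum>i<N. u i)) \<in> borel_measurable ?B"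
    by (rule measurable_compose[OF sums borel_measurable_fst_snd(2)])
  have sumU: "y + snd (\<Sum>i<N. step_increments 0 a N v i) = y + snd (W ?s v)" if "v \<in> space P" for v
    using start[OF that] by (simp add: step_increments_telescope)
  let ?k = "\<lambda>(u, w). ennreal (walk_weight l g N a y u * walk_weight l g' N b (y + snd (\<Sum>i<N. u i)) w)"
  have m2: "(\<lambda>p. walk_weight l g' N b (y + snd (\<Sum>i<N. fst p i)) (snd p)) \<in> borel_measurable (?B \<Otimes>\<^sub>M ?B)"
  proof -
    have "(\<lambda>p. (y + snd (\<Sum>i<N. fst p i), snd p)) \<in> ?B \<Otimes>\<^sub>M ?B \<rightarrow>\<^sub>M borel \<Otimes>\<^sub>M ?B"
      by measurable
    from measurable_compose[OF this walk_weight_measurable[OF g(2)]] show ?thesis by simp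
  qed
  have mU: "(\<lambda>p. walk_weight l g N a y (fst p)) \<in> borel_measurable (?B \<Otimes>\<^sub>M ?B)" by measurable
  have mk: "?k \<in> borel_measurable (?B \<Otimes>\<^sub>M ?B)"
    unfolding case_prod_beta' by (intro measurable_compose[OF borel_measurable_times[OF mU m2]] measurable_ennreal)
  have pf: "(\<integral>\<^sup>+v. ?k (step_increments 0 a N v, step_increments ?s b N v) \<partial>P) = (\<integral>\<^sup>+v. (\<integral>\<^sup>+v'. ?k (step_increments 0 a N v, step_increments 0 b N v') \<partial>P) \<partial>P)"
    by (rule past_future[OF ab mk])
  have inner: "(\<integral>\<^sup>+v'. ?k (step_increments 0 a N v, step_increments 0 b N v') \<partial>P)
      = ennreal (walk_weight l g N a y (step_increments 0 a N v) * walk_fk l g' N b (y + snd (W ?s v)))" if v: "v \<in> space P" for v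
  proof -
    have "(\<integral>\<^sup>+v'. ?k (step_increments 0 a N v, step_increments 0 b N v') \<partial>P)
       = (\<integral>\<^sup>+v'. ennreal (walk_weight l g N a y (step_increments 0 a N v)) * ennreal (walk_weight l g' N b (y + snd (W ?s v)) (step_increments 0 b N v')) \<partial>P)"
      using sumU[OF v] by (simp add: ennreal_mult walk_weight_def)
    also have "\<dots> = ennreal (walk_weight l g N a y (step_increments 0 a N v)) * (\<integral>\<^sup>+v'. ennreal (walk_weight l g' N b (y + snd (W ?s v)) (step_increments 0 b N v')) \<partial>P)"
      by (intro nn_integral_cmult measurable_compose[OF measurable_compose[OF V0 walk_weight_measurable_path[OF g(2)]] measurable_ennreal])
    also have "(\<integral>\<^sup>+v'. ennreal (walk_weight l g' N b (y + snd (W ?s v)) (step_increments 0 b N v')) \<partial>P) = ennreal (walk_fk l g' N b (y + snd (W ?s v)))"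
      unfolding walk_fk_def using ab
      by (intro nn_integral_eq_integral walk_weight_integrable[OF g(2) B]) (auto simp: walk_weight_def)
    finally show ?thesis using walk_fk_nonneg by (simp add: ennreal_mult walk_weight_def)
  qed
  let ?X = "\<lambda>v. walk_weight l g N a y (step_increments 0 a N v) * walk_weight l g' N b (y + snd (W ?s v)) (step_increments ?s b N v)"
  let ?Y = "\<lambda>v. walk_weight l g N a y (step_increments 0 a N v) * walk_fk l g' N b (y + snd (W ?s v))"
  have "(\<integral>\<^sup>+v. ennreal (?X v) \<partial>P) = (\<integral>\<^sup>+v. ?k (step_increments 0 a N v, step_increments ?s b N v) \<partial>P)"
    using sumU by (intro nn_integral_cong) simp
  also note pf
  also have "(\<integral>\<^sup>+v. (\<integral>\<^sup>+v'. ?k (step_increments 0 a N v, step_increments 0 b N v') \<partial>P) \<partial>P) = (\<integral>\<^sup>+v. ennreal (?Y v) \<partial>P)"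
    by (intro nn_integral_cong inner)
  finally have eq: "(\<integral>\<^sup>+v. ennreal (?X v) \<partial>P) = (\<integral>\<^sup>+v. ennreal (?Y v) \<partial>P)" .
  have mX: "?X \<in> borel_measurable P"
  proof -
    have "(\<lambda>v. (y + snd (W ?s v), step_increments ?s b N v)) \<in> P \<rightarrow>\<^sub>M borel \<Otimes>\<^sub>M ?B" by measurable
    from measurable_compose[OF this walk_weight_measurable[OF g(2)]]
    show ?thesis by (intro borel_measurable_times measurable_compose[OF U walk_weight_measurable_path[OF g(1)]]) simp_all
  qed
  have mY: "?Y \<in> borel_measurable P"
    using ab by (intro borel_measurable_times measurable_compose[OF U walk_weight_measurable_path[OF g(1)]]
        measurable_compose[OF _ walk_fk_measurable[OF g(2)]]) auto
  have "(\<integral>v. ?X v \<partial>P) = enn2real (\<integral>\<^sup>+v. ennreal (?X v) \<partial>P)"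
    by (intro integral_eq_nn_integral mX AE_I2) (simp add: walk_weight_def)
  also have "\<dots> = (\<integral>v. ?Y v \<partial>P)"
    unfolding eq by (intro integral_eq_nn_integral[symmetric] mY AE_I2) (simp add: walk_weight_def walk_fk_nonneg)
  finally show ?thesis .
qed

end

section \<open>The Feynman-Kac functional in a fixed environment\<close>

context shear_wiener begin

lemma grid_time_range:
  assumes "0 \<le> t" "j < N"
  shows "0 \<le> t - real j * (t / real N)" "t - real j * (t / real N) \<le> t"
proof -
  have "real j * (t / real N) \<le> real N * (t / real N)" using assms by (intro mult_right_mono) auto
  also have "\<dots> = t" using assms by simp
  finally show "0 \<le> t - real j * (t / real N)" by simp
  show "t - real j * (t / real N) \<le> t" using assms by simp
qed

lemma environment_bound_at:
  assumes "\<And>y s. 0 \<le> s \<Longrightarrow> s \<le> t \<Longrightarrow> \<bar>\<beta> y s\<bar> \<le> B" "j < N" "0 \<le> t"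
  shows "\<bar>\<beta> x (t - real j * (t / real N))\<bar> \<le> B"
  by (intro assms(1) grid_time_range assms(2,3))

lemma time_grid_measurable:
  assumes "environment L \<beta>" "0 \<le> t" "j < N"
  shows "(\<lambda>x. \<beta> x (t - real j * (t / real N))) \<in> borel_measurable borel"
  by (rule environment_continuous_space(2)[OF assms(1) grid_time_range(1)[OF assms(2,3)]])

lemma drift_integrand_continuous:
  assumes "environment L \<beta>" "v \<in> space P"
  shows "continuous_on {0..t} (\<lambda>r. \<beta> (y + snd (W r v)) (t - r))"
  using continuous_paths[OF assms(2)]
  by (intro environment_continuous_along[OF assms(1)] continuous_intros)
     (auto elim: continuous_on_subset)

text \<open>Riemann sums supply both the measurability of the drift and the passage from walks to paths.\<close>

lemma drift_riemann:
  assumes "environment L \<beta>" "0 \<le> t" "v \<in> space P"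
  shows "(\<lambda>N. t / real N * (\<Sum>j<N. \<beta> (y + snd (W (real j * (t / real N)) v)) (t - real j * (t / real N))))
    \<longlonglongrightarrow> drift \<beta> t y v"
  using riemann_sum_tendsto[of 0 t "\<lambda>r. \<beta> (y + snd (W r v)) (t - r)"] drift_integrand_continuous[OF assms(1,3)] assms(2)
  by (simp add: drift_def)

lemma drift_measurable:
  assumes "environment L \<beta>" "0 \<le> t"
  shows "drift \<beta> t y \<in> borel_measurable P"
proof (rule borel_measurable_LIMSEQ_real[OF drift_riemann[OF assms]])
  fix N
  have "(\<lambda>v. \<beta> (y + snd (W (real j * (t / real N)) v)) (t - real j * (t / real N))) \<in> borel_measurable P" if "j < N" for j
    using assms by (intro measurable_compose[OF _ time_grid_measurable[OF assms that]]
      borel_measurable_add measurable_compose[OF measurable borel_measurable_fst_snd(2)]) auto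
  then show "(\<lambda>v. t / real N * (\<Sum>j<N. \<beta> (y + snd (W (real j * (t / real N)) v)) (t - real j * (t / real N)))) \<in> borel_measurable P"
    by (intro borel_measurable_times borel_measurable_sum) auto
qed

lemma drift_integrand_integrable:
  assumes "environment L \<beta>" "v \<in> space P"
  shows "(\<lambda>r. \<beta> (y + snd (W r v)) (t - r)) integrable_on {0..t}"
  by (rule integrable_continuous_interval[OF drift_integrand_continuous[OF assms]])

lemma drift_bound:
  assumes "environment L \<beta>" "0 \<le> t" "v \<in> space P"
    and B: "\<And>y s. 0 \<le> s \<Longrightarrow> s \<le> t \<Longrightarrow> \<bar>\<beta> y s\<bar> \<le> B"
  shows "\<bar>drift \<beta> t y v\<bar> \<le> t * B"
  using integral_bound[OF assms(2) drift_integrand_continuous[OF assms(1,3)], of y B] B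
  by (simp add: drift_def mult.commute)

lemma exp_drift_bounds:
  assumes "environment L \<beta>" "0 \<le> t" "v \<in> space P"
    and B: "\<And>y s. 0 \<le> s \<Longrightarrow> s \<le> t \<Longrightarrow> \<bar>\<beta> y s\<bar> \<le> B"
  shows "exp (- l * (fst (W t v) + drift \<beta> t y v)) \<le> exp (\<bar>l\<bar> * (t * B)) * exp (- l * fst (W t v))"
    and "exp (- (\<bar>l\<bar> * (t * B))) * exp (- l * fst (W t v)) \<le> exp (- l * (fst (W t v) + drift \<beta> t y v))"
proof -
  have "\<bar>- l * drift \<beta> t y v\<bar> \<le> \<bar>l\<bar> * (t * B)"
    using drift_bound[OF assms] by (simp add: abs_mult mult_left_mono)
  then have "- l * (fst (W t v) + drift \<beta> t y v) \<le> \<bar>l\<bar> * (t * B) + - l * fst (W t v)"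
    "- (\<bar>l\<bar> * (t * B)) + - l * fst (W t v) \<le> - l * (fst (W t v) + drift \<beta> t y v)"
    unfolding distrib_left by linarith+
  then show "exp (- l * (fst (W t v) + drift \<beta> t y v)) \<le> exp (\<bar>l\<bar> * (t * B)) * exp (- l * fst (W t v))"
    "exp (- (\<bar>l\<bar> * (t * B))) * exp (- l * fst (W t v)) \<le> exp (- l * (fst (W t v) + drift \<beta> t y v))"
    by (simp_all only: exp_add[symmetric] exp_le_cancel_iff)
qed

lemma W_fst_measurable: "0 \<le> t \<Longrightarrow> (\<lambda>v. fst (W t v)) \<in> borel_measurable P"
  by (rule measurable_compose[OF measurable borel_measurable_fst_snd(1)])

lemma W_snd_measurable: "0 \<le> t \<Longrightarrow> (\<lambda>v. snd (W t v)) \<in> borel_measurable P"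
  by (rule measurable_compose[OF measurable borel_measurable_fst_snd(2)])

lemma fk_integrable:
  assumes "L > 0" "environment L \<beta>" "0 \<le> t"
  shows "integrable P (\<lambda>v. exp (- l * (fst (W t v) + drift \<beta> t y v)))"
proof -
  obtain B where B: "\<And>y s. 0 \<le> s \<Longrightarrow> s \<le> t \<Longrightarrow> \<bar>\<beta> y s\<bar> \<le> B"
    using environment_bounded[OF assms(1,2)] by metis
  note [measurable] = drift_measurable[OF assms(2,3)] W_fst_measurable[OF assms(3)]
  show ?thesis
  proof (rule Bochner_Integration.integrable_bound)
    show "integrable P (\<lambda>v. exp (\<bar>l\<bar> * (t * B)) * exp (- l * fst (W t v)))"
      using assms by (intro integrable_mult_right exp_first)
    show "AE v in P. norm (exp (- l * (fst (W t v) + drift \<beta> t y v))) \<le> norm (exp (\<bar>l\<bar> * (t * B)) * exp (- l * fst (W t v)))"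
      using exp_drift_bounds(1)[OF assms(2,3) _ B] by (intro AE_I2) simp
  qed measurable
qed

lemma fk_bounds:
  assumes "L > 0" "environment L \<beta>" "0 \<le> t"
    and B: "\<And>y s. 0 \<le> s \<Longrightarrow> s \<le> t \<Longrightarrow> \<bar>\<beta> y s\<bar> \<le> B"
  shows "fk l \<beta> t y \<le> exp (\<bar>l\<bar> * (t * B)) * exp (l\<^sup>2 * t / 2)"
    and "exp (- (\<bar>l\<bar> * (t * B))) * exp (l\<^sup>2 * t / 2) \<le> fk l \<beta> t y"
proof -
  have "fk l \<beta> t y \<le> (\<integral>v. exp (\<bar>l\<bar> * (t * B)) * exp (- l * fst (W t v)) \<partial>P)"
    unfolding fk_def using assms exp_drift_bounds(1)[OF assms(2,3) _ B]
    by (intro integral_mono fk_integrable integrable_mult_right exp_first) auto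
  then show "fk l \<beta> t y \<le> exp (\<bar>l\<bar> * (t * B)) * exp (l\<^sup>2 * t / 2)"
    using exp_first(2)[OF assms(3), of l] by simp
  have "(\<integral>v. exp (- (\<bar>l\<bar> * (t * B))) * exp (- l * fst (W t v)) \<partial>P) \<le> fk l \<beta> t y"
    unfolding fk_def using assms exp_drift_bounds(2)[OF assms(2,3) _ B]
    by (intro integral_mono fk_integrable integrable_mult_right exp_first) auto
  then show "exp (- (\<bar>l\<bar> * (t * B))) * exp (l\<^sup>2 * t / 2) \<le> fk l \<beta> t y"
    using exp_first(2)[OF assms(3), of l] by simp
qed

lemma fk_pos:
  assumes "L > 0" "environment L \<beta>" "0 \<le> t"
  shows "0 < fk l \<beta> t y"
proof -
  obtain B where "\<And>y s. 0 \<le> s \<Longrightarrow> s \<le> t \<Longrightarrow> \<bar>\<beta> y s\<bar> \<le> B"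
    using environment_bounded[OF assms(1,2)] by metis
  from fk_bounds(2)[OF assms this] show ?thesis
    by (meson exp_gt_zero less_le_trans mult_pos_pos)
qed

lemma fk_0: "fk l \<beta> 0 y = 1"
proof -
  have "fk l \<beta> 0 y = (\<integral>v. 1 \<partial>P)"
    unfolding fk_def drift_def using start by (intro Bochner_Integration.integral_cong) auto
  then show ?thesis by (simp add: prob_space)
qed

lemma fk_modulus:
  assumes "L > 0" "environment L \<beta>" "0 \<le> t"
    and d: "\<And>x x' s. 0 \<le> s \<Longrightarrow> s \<le> t \<Longrightarrow> dist x x' < d \<Longrightarrow> \<bar>\<beta> x s - \<beta> x' s\<bar> \<le> e"
    and yy: "dist y y' < d"
  shows "fk l \<beta> t y \<le> exp (\<bar>l\<bar> * (t * e)) * fk l \<beta> t y'"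
proof -
  have "fk l \<beta> t y \<le> (\<integral>v. exp (\<bar>l\<bar> * (t * e)) * exp (- l * (fst (W t v) + drift \<beta> t y' v)) \<partial>P)"
    unfolding fk_def
  proof (intro integral_mono fk_integrable[OF assms(1-3)] integrable_mult_right)
    fix v assume v: "v \<in> space P"
    have "\<bar>drift \<beta> t y v - drift \<beta> t y' v\<bar> \<le> e * (t - 0)"
    proof -
      have "drift \<beta> t y v - drift \<beta> t y' v = integral {0..t} (\<lambda>r. \<beta> (y + snd (W r v)) (t - r) - \<beta> (y' + snd (W r v)) (t - r))"
        unfolding drift_def
        by (rule Henstock_Kurzweil_Integration.integral_diff[symmetric]; rule drift_integrand_integrable[OF assms(2) v])
      moreover have "norm (integral {0..t} (\<lambda>r. \<beta> (y + snd (W r v)) (t - r) - \<beta> (y' + snd (W r v)) (t - r))) \<le> e * (t - 0)"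
      proof (rule integral_bound[OF assms(3)])
        show "continuous_on {0..t} (\<lambda>r. \<beta> (y + snd (W r v)) (t - r) - \<beta> (y' + snd (W r v)) (t - r))"
          by (intro continuous_on_diff drift_integrand_continuous[OF assms(2) v])
        fix r assume "r \<in> {0..t}"
        then show "norm (\<beta> (y + snd (W r v)) (t - r) - \<beta> (y' + snd (W r v)) (t - r)) \<le> e"
          using d[of "t - r" "y + snd (W r v)" "y' + snd (W r v)"] yy by simp
      qed
      ultimately show ?thesis by simp
    qed
    then have "\<bar>- l * (drift \<beta> t y v - drift \<beta> t y' v)\<bar> \<le> \<bar>l\<bar> * (t * e)"
      by (simp add: abs_mult mult_left_mono mult.commute)
    then have "- l * (fst (W t v) + drift \<beta> t y v) \<le> \<bar>l\<bar> * (t * e) + - l * (fst (W t v) + drift \<beta> t y' v)"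
      unfolding distrib_left right_diff_distrib by linarith
    then show "exp (- l * (fst (W t v) + drift \<beta> t y v)) \<le> exp (\<bar>l\<bar> * (t * e)) * exp (- l * (fst (W t v) + drift \<beta> t y' v))"
      by (simp only: exp_add[symmetric] exp_le_cancel_iff)
  qed
  also have "\<dots> = exp (\<bar>l\<bar> * (t * e)) * fk l \<beta> t y'" unfolding fk_def by simp
  finally show ?thesis .
qed

lemma ln_fk_continuous:
  assumes "L > 0" "environment L \<beta>" "0 \<le> t"
  shows "continuous_on UNIV (\<lambda>y. ln (fk l \<beta> t y))"
  unfolding continuous_on_iff
proof (intro ballI allI impI)
  fix y and e :: real assume "e > 0"
  define e' where "e' = e / (2 * (\<bar>l\<bar> * t + 1))"
  have lt: "0 \<le> \<bar>l\<bar> * t" using assms by simp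
  then have e': "e' > 0" using \<open>e > 0\<close> by (simp add: e'_def)
  have small: "\<bar>l\<bar> * (t * e') < e"
  proof -
    have "\<bar>l\<bar> * t * e' \<le> (\<bar>l\<bar> * t + 1) * e'" using e' by (intro mult_right_mono) auto
    also have "\<dots> = e / 2" using lt by (simp add: e'_def field_simps)
    finally show ?thesis using \<open>e > 0\<close> by (simp add: mult.assoc)
  qed
  obtain d where d: "d > 0" "\<And>y y' s. 0 \<le> s \<Longrightarrow> s \<le> t \<Longrightarrow> dist y y' < d \<Longrightarrow> \<bar>\<beta> y s - \<beta> y' s\<bar> < e'"
    using environment_uniformly_continuous[OF assms(1,2) e'] by metis
  have one: "ln (fk l \<beta> t x) \<le> \<bar>l\<bar> * (t * e') + ln (fk l \<beta> t x')" if "dist x x' < d" for x x'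
  proof -
    have "fk l \<beta> t x \<le> exp (\<bar>l\<bar> * (t * e')) * fk l \<beta> t x'"
      using fk_modulus[OF assms _ that] d(2) by (meson less_imp_le)
    then have "ln (fk l \<beta> t x) \<le> ln (exp (\<bar>l\<bar> * (t * e')) * fk l \<beta> t x')"
      using fk_pos[OF assms] by (intro ln_mono) auto
    then show ?thesis using fk_pos[OF assms, of l x'] by (simp add: ln_mult)
  qed
  show "\<exists>d>0. \<forall>x'\<in>UNIV. dist x' y < d \<longrightarrow> dist (ln (fk l \<beta> t x')) (ln (fk l \<beta> t y)) < e"
  proof (intro exI[of _ d] conjI d(1) ballI impI)
    fix x' assume "dist x' y < d"
    with one[of x' y] one[of y x'] small show "dist (ln (fk l \<beta> t x')) (ln (fk l \<beta> t y)) < e"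
      by (simp add: dist_real_def dist_commute abs_less_iff)
  qed
qed

lemma fk_measurable:
  assumes "L > 0" "environment L \<beta>" "0 \<le> t"
  shows "fk l \<beta> t \<in> borel_measurable borel"
proof -
  have "continuous_on UNIV (\<lambda>y. exp (ln (fk l \<beta> t y)))"
    by (intro continuous_on_exp ln_fk_continuous[OF assms])
  then show ?thesis using fk_pos[OF assms] by (simp add: borel_measurable_continuous_onI)
qed

lemma fk_periodic:
  assumes "environment L \<beta>"
  shows "fk l \<beta> t (y + lattice_vec L k) = fk l \<beta> t y"
proof -
  have "drift \<beta> t (y + lattice_vec L k) v = drift \<beta> t y v" for v
    unfolding drift_def
  proof (rule Henstock_Kurzweil_Integration.integral_cong)
    fix r assume "r \<in> {0..t}"
    then have "cell_periodic L (\<lambda>y. \<beta> y (t - r))" using assms by (simp add: environment_def)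
    from cell_periodic_lattice[OF this, of "y + snd (W r v)" k]
    show "\<beta> (y + lattice_vec L k + snd (W r v)) (t - r) = \<beta> (y + snd (W r v)) (t - r)"
      by (simp add: add_ac)
  qed
  then show ?thesis by (simp add: fk_def)
qed

text \<open>The walk may use environments \<open>g N j\<close> that are only uniformly close to the true one; this covers
  both the exact environment and its rounding to a spatial grid.\<close>

lemma walk_fk_tendsto:
  assumes L: "L > 0" "environment L \<beta>" and t: "0 \<le> t"
    and gm: "\<And>N j. j < N \<Longrightarrow> g N j \<in> borel_measurable borel"
    and gB: "\<And>N j x. j < N \<Longrightarrow> \<bar>g N j x\<bar> \<le> B"
    and close: "\<And>e. 0 < e \<Longrightarrow> \<forall>\<^sub>F N in sequentially. \<forall>j<N. \<forall>x. \<bar>g N j x - \<beta> x (t - real j * (t / real N))\<bar> \<le> e"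
  shows "(\<lambda>N. walk_fk l (g N) N (t / real N) y) \<longlonglongrightarrow> fk l \<beta> t y"
proof -
  note [measurable] = drift_measurable[OF L(2) t] W_fst_measurable[OF t]
  have "(\<lambda>N. walk_fk l (g (Suc N)) (Suc N) (t / real (Suc N)) y) \<longlonglongrightarrow> fk l \<beta> t y"
    unfolding walk_fk_def fk_def
  proof (rule integral_dominated_convergence)
    show "(\<lambda>v. exp (- l * (fst (W t v) + drift \<beta> t y v))) \<in> borel_measurable P" by measurable
    show "(\<lambda>v. walk_weight l (g (Suc N)) (Suc N) (t / real (Suc N)) y (step_increments 0 (t / real (Suc N)) (Suc N) v)) \<in> borel_measurable P" for N
      using t gm by (intro measurable_compose[OF step_increments_measurable walk_weight_measurable_path]) auto
    show "integrable P (\<lambda>v. exp (\<bar>l\<bar> * (t * B)) * exp (- l * fst (W t v)))"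
      using t by (intro integrable_mult_right exp_first)
    show "AE v in P. norm (walk_weight l (g (Suc N)) (Suc N) (t / real (Suc N)) y (step_increments 0 (t / real (Suc N)) (Suc N) v))
        \<le> exp (\<bar>l\<bar> * (t * B)) * exp (- l * fst (W t v))" for N
    proof (rule AE_I2)
      fix v assume v: "v \<in> space P"
      have "real (Suc N) * (t / real (Suc N)) = t" by simp
      with walk_weight_bound_0[of "Suc N" "g (Suc N)" B "t / real (Suc N)" v l y] gB t v
      show "norm (walk_weight l (g (Suc N)) (Suc N) (t / real (Suc N)) y (step_increments 0 (t / real (Suc N)) (Suc N) v))
        \<le> exp (\<bar>l\<bar> * (t * B)) * exp (- l * fst (W t v))" by simp
    qed
    show "AE v in P. (\<lambda>N. walk_weight l (g (Suc N)) (Suc N) (t / real (Suc N)) y (step_increments 0 (t / real (Suc N)) (Suc N) v))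
       \<longlonglongrightarrow> exp (- l * (fst (W t v) + drift \<beta> t y v))"
    proof (rule AE_I2)
      fix v assume v: "v \<in> space P"
      let ?x = "\<lambda>N j. y + snd (W (real j * (t / real N)) v)"
      let ?S = "\<lambda>N. t / real N * (\<Sum>j<N. g N j (?x N j))"
      let ?T = "\<lambda>N. t / real N * (\<Sum>j<N. \<beta> (?x N j) (t - real j * (t / real N)))"
      have "(\<lambda>N. ?S N - ?T N) \<longlonglongrightarrow> 0"
      proof (rule tendstoI)
        fix r :: real assume "r > 0"
        define e where "e = r / (t + 1)"
        have e: "e > 0" using \<open>r > 0\<close> t by (simp add: e_def)
        have "t * e < (t + 1) * e" using e by (intro mult_strict_right_mono) auto
        also have "\<dots> = r" using t by (simp add: e_def)
        finally have te: "t * e < r" .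
        show "\<forall>\<^sub>F N in sequentially. dist (?S N - ?T N) 0 < r"
          using eventually_gt_at_top[of 0] close[OF e]
        proof eventually_elim
          case (elim N)
          have "\<bar>\<Sum>j<N. g N j (?x N j) - \<beta> (?x N j) (t - real j * (t / real N))\<bar> \<le> (\<Sum>j<N. e)"
            using elim(2) by (intro order_trans[OF sum_abs] sum_mono) auto
          then have "t / real N * \<bar>\<Sum>j<N. g N j (?x N j) - \<beta> (?x N j) (t - real j * (t / real N))\<bar> \<le> t / real N * (real N * e)"
            using t by (intro mult_left_mono) auto
          also have "\<dots> = t * e" using elim(1) by simp
          also have "t / real N * \<bar>\<Sum>j<N. g N j (?x N j) - \<beta> (?x N j) (t - real j * (t / real N))\<bar> = norm (?S N - ?T N)"
            using t by (simp only: right_diff_distrib[symmetric] sum_subtractf[symmetric] real_norm_def abs_mult) simp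
          finally show ?case using te by (simp only: dist_norm diff_zero)
        qed
      qed
      from tendsto_add[OF this drift_riemann[OF L(2) t v, of y]] have "?S \<longlonglongrightarrow> drift \<beta> t y v"
        by (simp only: add_0 diff_add_cancel)
      then have "(\<lambda>N. exp (- l * (fst (W t v) + ?S (Suc N)))) \<longlonglongrightarrow> exp (- l * (fst (W t v) + drift \<beta> t y v))"
        by (intro tendsto_intros LIMSEQ_Suc)
      moreover have "walk_weight l (g (Suc N)) (Suc N) (t / real (Suc N)) y (step_increments 0 (t / real (Suc N)) (Suc N) v) = exp (- l * (fst (W t v) + ?S (Suc N)))" for N
      proof -
        have "real (Suc N) * (t / real (Suc N)) = t" by simp
        then show ?thesis unfolding walk_weight_increments_0[OF v] by (simp only:)
      qed
      ultimately show "(\<lambda>N. walk_weight l (g (Suc N)) (Suc N) (t / real (Suc N)) y (step_increments 0 (t / real (Suc N)) (Suc N) v))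
       \<longlonglongrightarrow> exp (- l * (fst (W t v) + drift \<beta> t y v))" by (simp only:)
    qed
  qed
  then show ?thesis by (rule LIMSEQ_imp_Suc)
qed

lemma walk_fk_tendsto_fk:
  assumes L: "L > 0" "environment L \<beta>" and t: "0 \<le> t"
  shows "(\<lambda>N. walk_fk l (\<lambda>j x. \<beta> x (t - real j * (t / real N))) N (t / real N) y) \<longlonglongrightarrow> fk l \<beta> t y"
proof -
  obtain B where B: "\<And>y s. 0 \<le> s \<Longrightarrow> s \<le> t \<Longrightarrow> \<bar>\<beta> y s\<bar> \<le> B"
    using environment_bounded[OF L] by metis
  show ?thesis
    by (rule walk_fk_tendsto[OF L t, where B=B])
       (use time_grid_measurable[OF L(2) t] environment_bound_at[OF B] t in auto)
qed

end

section \<open>Markov property and reflection\<close>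

context shear_wiener begin

lemma walk_weight_increments_measurable:
  assumes g: "\<And>j. j < N \<Longrightarrow> g j \<in> borel_measurable borel" and s: "0 \<le> s" "0 \<le> h"
    and f: "f \<in> borel_measurable P"
  shows "(\<lambda>v. walk_weight l g N h (f v) (step_increments s h N v)) \<in> borel_measurable P"
proof -
  have "(\<lambda>v. (f v, step_increments s h N v)) \<in> P \<rightarrow>\<^sub>M borel \<Otimes>\<^sub>M (\<Pi>\<^sub>M i\<in>{..<N}. borel)"
    by (intro measurable_Pair f step_increments_measurable s)
  from measurable_compose[OF this walk_weight_measurable[OF g]] show ?thesis by simp
qed

text \<open>The discrete identity of the walks passes to the limit by dominated convergence: the integrands are
  bounded by multiples of \<open>exp (- l * W\<^sub>1 (s + t))\<close> and \<open>exp (- l * W\<^sub>1 s)\<close>. The piece of path before time \<open>s\<close> sees the environment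
  at times above \<open>t\<close>, because the environment is read backwards in time.\<close>

theorem fk_markov:
  assumes L: "L > 0" and env: "environment L \<beta>" and s: "0 \<le> s" and t: "0 \<le> t"
  shows "fk l \<beta> (s + t) y = (\<integral>v. exp (- l * (fst (W s v) + drift (\<lambda>x u. \<beta> x (u + t)) s y v))
      * fk l \<beta> t (y + snd (W s v)) \<partial>P)"
proof -
  consider "s = 0" | "t = 0" | "s > 0" "t > 0" using s t by linarith
  then show ?thesis
  proof cases
    case 1
    have "(\<integral>v. exp (- l * (fst (W s v) + drift (\<lambda>x u. \<beta> x (u + t)) s y v)) * fk l \<beta> t (y + snd (W s v)) \<partial>P)
        = (\<integral>v. fk l \<beta> t y \<partial>P)"
      using start 1 by (intro Bochner_Integration.integral_cong) (auto simp: drift_def)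
    then show ?thesis using 1 by (simp add: prob_space)
  next
    case 2
    then show ?thesis by (simp add: fk_0) (simp add: fk_def)
  next
    case 3
    define \<beta>' where "\<beta>' x u = \<beta> x (u + t)" for x u
    have env': "environment L \<beta>'" unfolding \<beta>'_def using env t by (rule environment_shift)
    obtain B where B0: "B \<ge> 0" and B: "\<And>y u. 0 \<le> u \<Longrightarrow> u \<le> s + t \<Longrightarrow> \<bar>\<beta> y u\<bar> \<le> B"
      using environment_bounded[OF L env] by metis
    have Bt: "\<bar>\<beta> y u\<bar> \<le> B" if "0 \<le> u" "u \<le> t" for y u using B that s by simp
    have B': "\<bar>\<beta>' y u\<bar> \<le> B" if "0 \<le> u" "u \<le> s" for y u using B that t by (simp add: \<beta>'_def)
    define g where "g N j x = \<beta>' x (s - real j * (s / real N))" for N j x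
    define k where "k N j x = \<beta> x (t - real j * (t / real N))" for N j x
    have gm: "\<And>j. j < N \<Longrightarrow> g N j \<in> borel_measurable borel" for N
      unfolding g_def using time_grid_measurable[OF env' s] by simp
    have km: "\<And>j. j < N \<Longrightarrow> k N j \<in> borel_measurable borel" for N
      unfolding k_def using time_grid_measurable[OF env t] by simp
    have gB: "\<And>j x. j < N \<Longrightarrow> \<bar>g N j x\<bar> \<le> B" for N
      unfolding g_def using environment_bound_at[OF B'] s by simp
    have kB: "\<And>j x. j < N \<Longrightarrow> \<bar>k N j x\<bar> \<le> B" for N
      unfolding k_def using environment_bound_at[OF Bt] t by simp
    define a where "a N = s / real (Suc N)" for N
    define b where "b N = t / real (Suc N)" for N
    have ab: "0 < a N" "0 < b N" "real (Suc N) * a N = s" "real (Suc N) * b N = t" for N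
      using 3 by (auto simp: a_def b_def)
    let ?U = "\<lambda>N v. walk_weight l (g (Suc N)) (Suc N) (a N) y (step_increments 0 (a N) (Suc N) v)"
    let ?V = "\<lambda>N v. walk_weight l (k (Suc N)) (Suc N) (b N) (y + snd (W s v)) (step_increments s (b N) (Suc N) v)"
    let ?D = "\<lambda>N v. walk_fk l (k (Suc N)) (Suc N) (b N) (y + snd (W s v))"
    have eq: "(\<integral>v. ?U N v * ?V N v \<partial>P) = (\<integral>v. ?U N v * ?D N v \<partial>P)" for N
      using markov_walk[of "Suc N" "g (Suc N)" "k (Suc N)" B "a N" "b N" l y, OF gm km kB ab(1,2)] ab(3)[of N]
      by (simp only: zero_less_Suc simp_thms) 
    have Uconv: "(\<lambda>N. ?U N v) \<longlonglongrightarrow> exp (- l * (fst (W s v) + drift \<beta>' s y v))" if v: "v \<in> space P" for v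
    proof -
      have "?U N v = exp (- l * (fst (W s v) + s / real (Suc N) * (\<Sum>j<Suc N. \<beta>' (y + snd (W (real j * (s / real (Suc N))) v)) (s - real j * (s / real (Suc N))))))" for N
        unfolding walk_weight_increments_0[OF v] ab(3) g_def by (simp only: a_def)
      then show ?thesis
        using LIMSEQ_Suc[OF drift_riemann[OF env' s v, of y]] by (simp only:) (intro tendsto_intros)
    qed
    have Ub: "?U N v \<le> exp (\<bar>l\<bar> * (s * B)) * exp (- l * fst (W s v))" if v: "v \<in> space P" for v N
      using walk_weight_bound_0[of "Suc N" "g (Suc N)" B "a N" v l y, OF gB less_imp_le[OF ab(1)] v] ab(3)[of N]
      by (simp only:)
    note [measurable] = drift_measurable[OF env' s] W_fst_measurable[OF s] W_snd_measurable[OF s]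
      W_fst_measurable[OF add_nonneg_nonneg[OF s t]] drift_measurable[OF env add_nonneg_nonneg[OF s t]] fk_measurable[OF L env t]
    have Um: "?U N \<in> borel_measurable P" for N
      using gm less_imp_le[OF ab(1)] by (intro walk_weight_increments_measurable) auto
    have Vm: "?V N \<in> borel_measurable P" for N
      using km less_imp_le[OF ab(2)] s by (intro walk_weight_increments_measurable) auto
    have Dm: "?D N \<in> borel_measurable P" for N
      using less_imp_le[OF ab(2)] by (intro measurable_compose[OF _ walk_fk_measurable[OF km]]) auto
    have lim1: "(\<lambda>N. \<integral>v. ?U N v * ?D N v \<partial>P) \<longlonglongrightarrow> (\<integral>v. exp (- l * (fst (W s v) + drift \<beta>' s y v)) * fk l \<beta> t (y + snd (W s v)) \<partial>P)"
    proof (rule integral_dominated_convergence)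
      show "(\<lambda>v. exp (- l * (fst (W s v) + drift \<beta>' s y v)) * fk l \<beta> t (y + snd (W s v))) \<in> borel_measurable P"
        by measurable
      show "(\<lambda>v. ?U N v * ?D N v) \<in> borel_measurable P" for N using Um Dm by measurable
      let ?c = "exp (\<bar>l\<bar> * (t * B)) * exp (l\<^sup>2 * t / 2)"
      show "integrable P (\<lambda>v. exp (\<bar>l\<bar> * (s * B)) * exp (- l * fst (W s v)) * ?c)"
        using exp_first(1)[OF s, of l] by simp
      show "AE v in P. (\<lambda>N. ?U N v * ?D N v) \<longlonglongrightarrow> exp (- l * (fst (W s v) + drift \<beta>' s y v)) * fk l \<beta> t (y + snd (W s v))"
      proof (rule AE_I2)
        fix v assume v: "v \<in> space P"
        have "(\<lambda>N. ?D N v) \<longlonglongrightarrow> fk l \<beta> t (y + snd (W s v))"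
          using LIMSEQ_Suc[OF walk_fk_tendsto_fk[OF L env t, of l "y + snd (W s v)"]] unfolding k_def b_def .
        then show "(\<lambda>N. ?U N v * ?D N v) \<longlonglongrightarrow> exp (- l * (fst (W s v) + drift \<beta>' s y v)) * fk l \<beta> t (y + snd (W s v))"
          by (intro tendsto_mult Uconv v)
      qed
      show "AE v in P. norm (?U N v * ?D N v) \<le> exp (\<bar>l\<bar> * (s * B)) * exp (- l * fst (W s v)) * ?c" for N
      proof (rule AE_I2)
        fix v assume v: "v \<in> space P"
        have "?D N v \<le> ?c"
          using walk_fk_le[of "Suc N" "k (Suc N)" B "b N", OF km kB less_imp_le[OF ab(2)]] unfolding ab(4) .
        then have "?U N v * ?D N v \<le> exp (\<bar>l\<bar> * (s * B)) * exp (- l * fst (W s v)) * ?c"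
          by (intro mult_mono Ub v walk_fk_nonneg) simp_all
        then show "norm (?U N v * ?D N v) \<le> exp (\<bar>l\<bar> * (s * B)) * exp (- l * fst (W s v)) * ?c"
          using walk_fk_nonneg by simp
      qed
    qed
    have lim2: "(\<lambda>N. \<integral>v. ?U N v * ?V N v \<partial>P) \<longlonglongrightarrow> (\<integral>v. exp (- l * (fst (W (s + t) v) + drift \<beta> (s + t) y v)) \<partial>P)"
    proof (rule integral_dominated_convergence)
      show "(\<lambda>v. exp (- l * (fst (W (s + t) v) + drift \<beta> (s + t) y v))) \<in> borel_measurable P"
        using s t by measurable
      show "(\<lambda>v. ?U N v * ?V N v) \<in> borel_measurable P" for N using Um Vm by measurable
      show "integrable P (\<lambda>v. exp (\<bar>l\<bar> * ((s + t) * B)) * exp (- l * fst (W (s + t) v)))"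
        using s t by (intro integrable_mult_right exp_first) simp
      show "AE v in P. norm (?U N v * ?V N v) \<le> exp (\<bar>l\<bar> * ((s + t) * B)) * exp (- l * fst (W (s + t) v))" for N
      proof (rule AE_I2)
        fix v assume v: "v \<in> space P"
        have "?V N v \<le> exp (\<bar>l\<bar> * (t * B)) * exp (- l * (fst (W (s + t) v) - fst (W s v)))"
          using walk_weight_bound[of "Suc N" "k (Suc N)" B "b N" l "y + snd (W s v)" s v, OF kB less_imp_le[OF ab(2)]]
          unfolding ab(4) .
        then have "?U N v * ?V N v \<le> (exp (\<bar>l\<bar> * (s * B)) * exp (- l * fst (W s v))) * (exp (\<bar>l\<bar> * (t * B)) * exp (- l * (fst (W (s + t) v) - fst (W s v))))"
          by (intro mult_mono Ub v) simp_all
        also have "\<dots> = exp (\<bar>l\<bar> * ((s + t) * B)) * exp (- l * fst (W (s + t) v))"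
          unfolding exp_add[symmetric] by (simp add: algebra_simps)
        finally show "norm (?U N v * ?V N v) \<le> exp (\<bar>l\<bar> * ((s + t) * B)) * exp (- l * fst (W (s + t) v))" by simp
      qed
      show "AE v in P. (\<lambda>N. ?U N v * ?V N v) \<longlonglongrightarrow> exp (- l * (fst (W (s + t) v) + drift \<beta> (s + t) y v))"
      proof (rule AE_I2)
        fix v assume v: "v \<in> space P"
        let ?f = "\<lambda>r. \<beta> (y + snd (W r v)) (s + t - r)"
        have c: "continuous_on {0..s + t} ?f" by (rule drift_integrand_continuous[OF env v])
        have c': "continuous_on {s..s + t} ?f" using s by (intro continuous_on_subset[OF c]) auto
        have split: "drift \<beta>' s y v + integral {s..s + t} ?f = drift \<beta> (s + t) y v"
        proof -
          have "drift \<beta>' s y v = integral {0..s} ?f"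
            unfolding drift_def \<beta>'_def by (intro Henstock_Kurzweil_Integration.integral_cong) (simp add: algebra_simps)
          moreover have "integral {0..s} ?f + integral {s..s + t} ?f = integral {0..s + t} ?f"
            using s t by (intro Henstock_Kurzweil_Integration.integral_combine integrable_continuous_interval[OF c]) auto
          ultimately show ?thesis by (simp add: drift_def)
        qed
        have "?V N v = exp (- l * (fst (W (s + t) v) - fst (W s v) + t / real (Suc N) * (\<Sum>j<Suc N. ?f (s + real j * (t / real (Suc N))))))" for N
        proof -
          have "k (Suc N) j (y + snd (W s v) + (snd (W (s + real j * b N) v) - snd (W s v))) = ?f (s + real j * (t / real (Suc N)))" for j
            by (simp add: k_def b_def)
          then show ?thesis unfolding walk_weight_increments ab(4) by (simp only: b_def)
        qed
        moreover have "(\<lambda>N. exp (- l * (fst (W (s + t) v) - fst (W s v) + t / real (Suc N) * (\<Sum>j<Suc N. ?f (s + real j * (t / real (Suc N)))))))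
           \<longlonglongrightarrow> exp (- l * (fst (W (s + t) v) - fst (W s v) + integral {s..s + t} ?f))"
          by (intro tendsto_intros LIMSEQ_Suc[OF riemann_sum_tendsto[OF c' t]])
        ultimately have "(\<lambda>N. ?V N v) \<longlonglongrightarrow> exp (- l * (fst (W (s + t) v) - fst (W s v) + integral {s..s + t} ?f))"
          by (simp only:)
        have e: "- l * (A + D) + - l * (C - A + I) = - l * (C + (D + I))" for A C D I :: real
          by (simp add: algebra_simps)
        from tendsto_mult[OF Uconv[OF v] \<open>(\<lambda>N. ?V N v) \<longlonglongrightarrow> _\<close>]
        show "(\<lambda>N. ?U N v * ?V N v) \<longlonglongrightarrow> exp (- l * (fst (W (s + t) v) + drift \<beta> (s + t) y v))"
          unfolding exp_add[symmetric] e split .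
      qed
    qed
    have "fk l \<beta> (s + t) y = (\<integral>v. exp (- l * (fst (W s v) + drift \<beta>' s y v)) * fk l \<beta> t (y + snd (W s v)) \<partial>P)"
      unfolding fk_def[of l \<beta> "s + t"] by (rule LIMSEQ_unique[OF lim2[unfolded eq] lim1])
    then show ?thesis unfolding \<beta>'_def .
  qed
qed

text \<open>The functional depends on the law of \<open>W\<close> only, and \<open>(- W\<^sub>1, W\<^sub>2)\<close> is a Wiener process as well.\<close>

lemma fk_reflect:
  assumes L: "L > 0" and env: "environment L \<beta>" and t: "0 \<le> t"
  shows "fk l \<beta> t y = fk (- l) (\<lambda>x u. - \<beta> x u) t y"
proof (cases "t = 0")
  case True
  then show ?thesis by (simp add: fk_0)
next
  case False
  with t have "t > 0" by simp
  let ?W' = "\<lambda>t v. (- fst (W t v), snd (W t v))"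
  interpret R: shear_wiener P ?W' by (rule reflected_wiener)
  let ?g = "\<lambda>N j x. \<beta> x (t - real j * (t / real N))"
  have "walk_fk l (?g (Suc N)) (Suc N) (t / real (Suc N)) y = R.walk_fk l (?g (Suc N)) (Suc N) (t / real (Suc N)) y" for N
  proof -
    have h: "0 < t / real (Suc N)" "0 < Suc N" using \<open>t > 0\<close> by auto
    show ?thesis
      by (rule trans[OF walk_fk_eq_PiM R.walk_fk_eq_PiM[symmetric]]; (rule time_grid_measurable[OF env t] h; assumption?))
  qed
  then have "(\<lambda>N. walk_fk l (?g (Suc N)) (Suc N) (t / real (Suc N)) y) \<longlonglongrightarrow> R.fk l \<beta> t y"
    using LIMSEQ_Suc[OF R.walk_fk_tendsto_fk[OF L env t, of l y]] by simp
  then have "fk l \<beta> t y = R.fk l \<beta> t y"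
    using LIMSEQ_Suc[OF walk_fk_tendsto_fk[OF L env t, of l y]] by (rule LIMSEQ_unique[rotated])
  also have "\<dots> = fk (- l) (\<lambda>x u. - \<beta> x u) t y"
  proof -
    have "drift (\<lambda>x u. - \<beta> x u) t y v = - R.drift \<beta> t y v" for v
      unfolding drift_def R.drift_def by simp
    then show ?thesis unfolding fk_def R.fk_def by (simp add: algebra_simps)
  qed
  finally show ?thesis .
qed

end

section \<open>Harnack inequality and additivity of the logarithm\<close>

text \<open>Equivalent to \<open>(u + c)\<^sup>2 \<le> 2 * u\<^sup>2 + 2 * c\<^sup>2\<close>. A Gaussian density is not comparable to its own translates, but
  it is dominated by the translates of a Gaussian of twice the variance; this is why the Harnack
  inequality compares time 1 with time 2.\<close>

lemma normal_density_compare: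
  "normal_density 0 1 u \<le> sqrt 2 * exp (c\<^sup>2 / 2) * normal_density 0 (sqrt 2) (u + c)"
proof -
  have "0 \<le> (u - c)\<^sup>2" by simp
  then have "- u\<^sup>2 / 2 \<le> c\<^sup>2 / 2 + - (u + c)\<^sup>2 / 4"
    by (simp add: power2_eq_square field_simps)
  then have "exp (- u\<^sup>2 / 2) \<le> exp (c\<^sup>2 / 2) * exp (- (u + c)\<^sup>2 / 4)"
    by (simp only: exp_add[symmetric] exp_le_cancel_iff)
  then have "1 / sqrt (2 * pi) * exp (- u\<^sup>2 / 2) \<le> 1 / sqrt (2 * pi) * (exp (c\<^sup>2 / 2) * exp (- (u + c)\<^sup>2 / 4))"
    by (intro mult_left_mono) auto
  also have "\<dots> = sqrt 2 * exp (c\<^sup>2 / 2) * (1 / sqrt (2 * pi * 2) * exp (- (u + c)\<^sup>2 / 4))"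
  proof -
    have "sqrt (2 * pi * 2) = sqrt 2 * sqrt (2 * pi)" by (metis mult.commute real_sqrt_mult)
    then show ?thesis by (simp only:) (simp del: real_sqrt_mult)
  qed
  finally show ?thesis by (simp add: normal_density_def)
qed

lemma gauss_density_compare:
  fixes a x :: "'e::euclidean_space"
  shows "gauss_density 1 x \<le> sqrt 2 ^ DIM('e) * exp ((norm a)\<^sup>2 / 2) * gauss_density 2 (x + a)"
proof -
  have "gauss_density 1 x \<le> (\<Prod>i\<in>Basis. sqrt 2 * exp ((a \<bullet> i)\<^sup>2 / 2) * normal_density 0 (sqrt 2) (x \<bullet> i + a \<bullet> i))"
    unfolding gauss_density_def using normal_density_compare by (intro prod_mono) simp
  also have "\<dots> = sqrt 2 ^ DIM('e) * exp (\<Sum>i\<in>Basis. (a \<bullet> i)\<^sup>2 / 2) * gauss_density 2 (x + a)"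
    by (simp add: prod.distrib gauss_density_def inner_add_left exp_sum)
  also have "(\<Sum>i\<in>Basis. (a \<bullet> i)\<^sup>2 / 2) = (norm a)\<^sup>2 / 2"
    unfolding sum_divide_distrib[symmetric]
    by (subst euclidean_inner[of a a, unfolded power2_eq_square[symmetric] power2_norm_eq_inner[symmetric]]) simp
  finally show ?thesis .
qed

lemma (in standard_wiener_process) nn_integral_shift_compare:
  assumes h[measurable]: "h \<in> borel_measurable borel"
  shows "(\<integral>\<^sup>+v. h (W 1 v) \<partial>P) \<le> ennreal (sqrt 2 ^ DIM('e) * exp ((norm a)\<^sup>2 / 2)) * (\<integral>\<^sup>+v. h (W 2 v - a) \<partial>P)"
proof -
  let ?C = "sqrt 2 ^ DIM('e) * exp ((norm a)\<^sup>2 / 2)"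
  have [measurable]: "W 1 \<in> borel_measurable P" "W 2 \<in> borel_measurable P" by (rule measurable; simp)+
  have "(\<integral>\<^sup>+v. h (W 1 v) \<partial>P) = (\<integral>\<^sup>+x. h x \<partial>distr P borel (W 1))"
    by (subst nn_integral_distr) auto
  also have "\<dots> = (\<integral>\<^sup>+x. ennreal (gauss_density 1 x) * h x \<partial>lborel)"
    by (subst W_law) (auto simp: nn_integral_density)
  also have "\<dots> \<le> (\<integral>\<^sup>+x. ennreal ?C * (ennreal (gauss_density 2 (x + a)) * h x) \<partial>lborel)"
  proof (intro nn_integral_mono)
    fix x :: 'e
    have "ennreal (gauss_density 1 x) \<le> ennreal ?C * ennreal (gauss_density 2 (x + a))"
      using gauss_density_compare[of x a] by (simp add: ennreal_mult[symmetric] gauss_density_nonneg ennreal_leI)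
    then show "ennreal (gauss_density 1 x) * h x \<le> ennreal ?C * (ennreal (gauss_density 2 (x + a)) * h x)"
      by (metis mult.assoc mult_right_mono zero_le)
  qed
  also have "\<dots> = ennreal ?C * (\<integral>\<^sup>+x. ennreal (gauss_density 2 (x + a)) * h x \<partial>lborel)"
    by (intro nn_integral_cmult) measurable
  also have "(\<integral>\<^sup>+x. ennreal (gauss_density 2 (x + a)) * h x \<partial>lborel) = (\<integral>\<^sup>+x. ennreal (gauss_density 2 (x + a)) * h x \<partial>distr lborel borel ((+) (- a)))"
    by (simp only: lborel_distr_plus)
  also have "\<dots> = (\<integral>\<^sup>+x. ennreal (gauss_density 2 x) * h (x - a) \<partial>lborel)"
    by (subst nn_integral_distr) auto
  also have "\<dots> = (\<integral>\<^sup>+x. h (x - a) \<partial>distr P borel (W 2))"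
    by (subst W_law) (auto simp: nn_integral_density)
  also have "\<dots> = (\<integral>\<^sup>+v. h (W 2 v - a) \<partial>P)"
    by (subst nn_integral_distr) auto
  finally show ?thesis .
qed

context shear_wiener begin

lemma fk_bounded:
  assumes "L > 0" "environment L \<beta>" "0 \<le> t"
  obtains C where "\<And>y. fk l \<beta> t y \<le> C" "C \<ge> 0"
proof -
  obtain B where B: "\<And>y s. 0 \<le> s \<Longrightarrow> s \<le> t \<Longrightarrow> \<bar>\<beta> y s\<bar> \<le> B"
    using environment_bounded[OF assms(1,2)] by metis
  show ?thesis by (rule that[of "exp (\<bar>l\<bar> * (t * B)) * exp (l\<^sup>2 * t / 2)"]) (use fk_bounds(1)[OF assms B] in auto)
qed

lemma weighted_fk_integrable:
  assumes "L > 0" "environment L \<beta>" "0 \<le> t" and X: "integrable P X" and s: "0 \<le> s"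
  shows "integrable P (\<lambda>v. X v * fk l \<beta> t (y + snd (W s v)))"
proof -
  obtain C where C: "\<And>y. fk l \<beta> t y \<le> C" "C \<ge> 0" using fk_bounded[OF assms(1-3)] by metis
  note [measurable] = fk_measurable[OF assms(1-3)] W_snd_measurable[OF s]
  have [measurable]: "X \<in> borel_measurable P" using X by auto
  show ?thesis
  proof (rule Bochner_Integration.integrable_bound)
    show "integrable P (\<lambda>v. X v * C)" using X by simp
    show "AE v in P. norm (X v * fk l \<beta> t (y + snd (W s v))) \<le> norm (X v * C)"
    proof -
      have "\<bar>fk l \<beta> t x\<bar> \<le> \<bar>C\<bar>" for x using C fk_pos[OF assms(1-3), of l x] by simp
      then show ?thesis by (intro AE_I2) (simp add: abs_mult mult_left_mono)
    qed
  qed measurable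
qed

text \<open>The second factor uses that two points of the period cell differ by a vector whose squared norm is at most \<open>CARD('m) * L\<^sup>2\<close>.\<close>

definition harnack_const :: "real \<Rightarrow> real" where
  "harnack_const L = sqrt 2 ^ DIM(real \<times> (real ^ 'm)) * exp (real CARD('m) * L\<^sup>2 / 2)"

text \<open>By the Markov property, the functional at the times \<open>1 + t\<close> and \<open>2 + t\<close> is the functional at time \<open>t\<close>, averaged over
  the end points of paths of length 1 and 2. The drifts of these short paths cost at most
  \<open>exp (\<bar>l\<bar> * B)\<close> and \<open>exp (2 * \<bar>l\<bar> * B)\<close>, and the remaining Gaussian averages are compared by densities,
  after both starting points have been moved into the period cell.\<close>

lemma harnack:
  assumes L: "L > 0" and env: "environment L \<beta>" and t: "0 \<le> t"
    and B: "\<And>y s. 0 \<le> s \<Longrightarrow> s \<le> 2 \<Longrightarrow> \<bar>\<beta> y (s + t)\<bar> \<le> B"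
  shows "fk l \<beta> (1 + t) y \<le> harnack_const L * exp (3 * \<bar>l\<bar> * B) * fk l \<beta> (2 + t) y'"
proof -
  obtain k where k: "\<And>i. 0 \<le> (y + lattice_vec L k) $ i" "\<And>i. (y + lattice_vec L k) $ i \<le> L"
    using lattice_reduction[OF L] by metis
  obtain k' where k': "\<And>i. 0 \<le> (y' + lattice_vec L k') $ i" "\<And>i. (y' + lattice_vec L k') $ i \<le> L"
    using lattice_reduction[OF L] by metis
  define z where "z = y + lattice_vec L k"
  define z' where "z' = y' + lattice_vec L k'"
  have zz: "fk l \<beta> (1 + t) y = fk l \<beta> (1 + t) z" "fk l \<beta> (2 + t) y' = fk l \<beta> (2 + t) z'"
    unfolding z_def z'_def using fk_periodic[OF env] by auto
  have nz: "(norm (z - z'))\<^sup>2 \<le> CARD('m) * L\<^sup>2"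
  proof -
    have "(norm (z - z'))\<^sup>2 = (\<Sum>i\<in>UNIV. ((z - z') $ i)\<^sup>2)"
      unfolding power2_norm_eq_inner by (simp add: inner_vec_def power2_eq_square)
    also have "\<dots> \<le> (\<Sum>i\<in>(UNIV :: 'm set). L\<^sup>2)"
    proof (rule sum_mono)
      fix i :: 'm
      have "\<bar>(z - z') $ i\<bar> \<le> \<bar>L\<bar>" using k[of i] k'[of i] L by (simp add: z_def z'_def)
      then show "((z - z') $ i)\<^sup>2 \<le> L\<^sup>2" by (rule abs_le_square_iff[THEN iffD1])
    qed
    finally show ?thesis by simp
  qed
  define \<beta>' where "\<beta>' x u = \<beta> x (u + t)" for x u
  have env': "environment L \<beta>'" unfolding \<beta>'_def using env t by (rule environment_shift)
  let ?g = "fk l \<beta> t"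
  have g0: "0 < ?g x" for x by (rule fk_pos[OF L env t])
  have e1: "exp (- l * (fst (W 1 v) + drift \<beta>' 1 z v)) \<le> exp (\<bar>l\<bar> * B) * exp (- l * fst (W 1 v))" if "v \<in> space P" for v
    using exp_drift_bounds(1)[OF env' _ that, of 1 B l z] B by (simp add: \<beta>'_def)
  have e2: "exp (- (\<bar>l\<bar> * (2 * B))) * exp (- l * fst (W 2 v)) \<le> exp (- l * (fst (W 2 v) + drift \<beta>' 2 z' v))" if "v \<in> space P" for v
    using exp_drift_bounds(2)[OF env' _ that, of 2 B l z'] B by (simp add: \<beta>'_def)
  note int = weighted_fk_integrable[OF L env t]
  have up: "fk l \<beta> (1 + t) z \<le> exp (\<bar>l\<bar> * B) * (\<integral>v. exp (- l * fst (W 1 v)) * ?g (z + snd (W 1 v)) \<partial>P)"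
  proof -
    have "fk l \<beta> (1 + t) z = (\<integral>v. exp (- l * (fst (W 1 v) + drift \<beta>' 1 z v)) * ?g (z + snd (W 1 v)) \<partial>P)"
      unfolding \<beta>'_def using L env t by (intro fk_markov) auto
    also have "\<dots> \<le> (\<integral>v. (exp (\<bar>l\<bar> * B) * exp (- l * fst (W 1 v))) * ?g (z + snd (W 1 v)) \<partial>P)"
      using e1 less_imp_le[OF g0]
      by (intro integral_mono int fk_integrable[OF L env'] integrable_mult_right exp_first mult_right_mono) auto
    also have "\<dots> = exp (\<bar>l\<bar> * B) * (\<integral>v. exp (- l * fst (W 1 v)) * ?g (z + snd (W 1 v)) \<partial>P)"
      by (simp add: mult.assoc)
    finally show ?thesis .
  qed
  have down: "(\<integral>v. exp (- l * fst (W 2 v)) * ?g (z' + snd (W 2 v)) \<partial>P) \<le> exp (\<bar>l\<bar> * (2 * B)) * fk l \<beta> (2 + t) z'"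
  proof -
    have "exp (- (\<bar>l\<bar> * (2 * B))) * (\<integral>v. exp (- l * fst (W 2 v)) * ?g (z' + snd (W 2 v)) \<partial>P)
        = (\<integral>v. (exp (- (\<bar>l\<bar> * (2 * B))) * exp (- l * fst (W 2 v))) * ?g (z' + snd (W 2 v)) \<partial>P)"
      by (simp add: mult.assoc)
    also have "\<dots> \<le> (\<integral>v. exp (- l * (fst (W 2 v) + drift \<beta>' 2 z' v)) * ?g (z' + snd (W 2 v)) \<partial>P)"
      using e2 less_imp_le[OF g0]
      by (intro integral_mono int fk_integrable[OF L env'] integrable_mult_right exp_first mult_right_mono) auto
    also have "\<dots> = fk l \<beta> (2 + t) z'"
      unfolding \<beta>'_def using L env t by (intro fk_markov[symmetric]) auto
    finally have "exp (\<bar>l\<bar> * (2 * B)) * (exp (- (\<bar>l\<bar> * (2 * B))) * (\<integral>v. exp (- l * fst (W 2 v)) * ?g (z' + snd (W 2 v)) \<partial>P))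
        \<le> exp (\<bar>l\<bar> * (2 * B)) * fk l \<beta> (2 + t) z'"
      by (intro mult_left_mono) auto
    then show ?thesis by (simp add: mult.assoc[symmetric] exp_add[symmetric])
  qed
  have mid: "(\<integral>v. exp (- l * fst (W 1 v)) * ?g (z + snd (W 1 v)) \<partial>P)
      \<le> harnack_const L * (\<integral>v. exp (- l * fst (W 2 v)) * ?g (z' + snd (W 2 v)) \<partial>P)"
  proof -
    let ?h = "\<lambda>x. exp (- l * fst x) * ?g (z + snd x)"
    let ?a = "(0, z - z') :: real \<times> (real ^ 'm)"
    note [measurable] = fk_measurable[OF L env t]
    have hm: "(\<lambda>x. ennreal (?h x)) \<in> borel_measurable borel" by measurable
    have i1: "integrable P (\<lambda>v. ?h (W 1 v))" by (intro int exp_first) auto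
    have i2: "integrable P (\<lambda>v. exp (- l * fst (W 2 v)) * ?g (z' + snd (W 2 v)))" by (intro int exp_first) auto
    have "ennreal (\<integral>v. ?h (W 1 v) \<partial>P) = (\<integral>\<^sup>+v. ennreal (?h (W 1 v)) \<partial>P)"
      using i1 less_imp_le[OF g0] by (intro nn_integral_eq_integral[symmetric]) auto
    also have "\<dots> \<le> ennreal (sqrt 2 ^ DIM(real \<times> (real ^ 'm)) * exp ((norm ?a)\<^sup>2 / 2)) * (\<integral>\<^sup>+v. ennreal (?h (W 2 v - ?a)) \<partial>P)"
      by (rule nn_integral_shift_compare[OF hm])
    also have "\<dots> \<le> ennreal (harnack_const L) * (\<integral>\<^sup>+v. ennreal (?h (W 2 v - ?a)) \<partial>P)"
      unfolding harnack_const_def using nz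
      by (intro mult_right_mono ennreal_leI mult_left_mono) (auto simp: norm_Pair)
    also have "(\<integral>\<^sup>+v. ennreal (?h (W 2 v - ?a)) \<partial>P) = ennreal (\<integral>v. exp (- l * fst (W 2 v)) * ?g (z' + snd (W 2 v)) \<partial>P)"
      using i2 less_imp_le[OF g0] by (subst nn_integral_eq_integral[symmetric]) (auto simp: algebra_simps)
    also have "ennreal (harnack_const L) * \<dots> = ennreal (harnack_const L * (\<integral>v. exp (- l * fst (W 2 v)) * ?g (z' + snd (W 2 v)) \<partial>P))"
      using less_imp_le[OF g0] by (intro ennreal_mult[symmetric] integral_nonneg_AE) (auto simp: harnack_const_def)
    finally show ?thesis
      using less_imp_le[OF g0] by (subst (asm) ennreal_le_iff) (auto simp: harnack_const_def intro!: mult_nonneg_nonneg integral_nonneg_AE)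
  qed
  have C0: "0 \<le> harnack_const L" by (simp add: harnack_const_def)
  have "fk l \<beta> (1 + t) z \<le> exp (\<bar>l\<bar> * B) * (harnack_const L * (exp (\<bar>l\<bar> * (2 * B)) * fk l \<beta> (2 + t) z'))"
    using up mid down C0 by (meson exp_ge_zero mult_left_mono order_trans)
  also have "\<dots> = harnack_const L * (exp (\<bar>l\<bar> * B) * exp (\<bar>l\<bar> * (2 * B))) * fk l \<beta> (2 + t) z'"
    by (simp only: mult_ac)
  also have "exp (\<bar>l\<bar> * B) * exp (\<bar>l\<bar> * (2 * B)) = exp (3 * \<bar>l\<bar> * B)"
    unfolding exp_add[symmetric] by (simp add: algebra_simps)
  finally show ?thesis unfolding zz .
qed

definition sup_ln_fk :: "real \<Rightarrow> (real ^ 'm \<Rightarrow> real \<Rightarrow> real) \<Rightarrow> real \<Rightarrow> real" where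
  "sup_ln_fk l \<beta> t = (SUP y. ln (fk l \<beta> t y))"

definition inf_ln_fk :: "real \<Rightarrow> (real ^ 'm \<Rightarrow> real \<Rightarrow> real) \<Rightarrow> real \<Rightarrow> real" where
  "inf_ln_fk l \<beta> t = (INF y. ln (fk l \<beta> t y))"

lemma ln_fk_bounds:
  assumes "L > 0" "environment L \<beta>" "0 \<le> t"
    and B: "\<And>y s. 0 \<le> s \<Longrightarrow> s \<le> t \<Longrightarrow> \<bar>\<beta> y s\<bar> \<le> B"
  shows "\<bar>ln (fk l \<beta> t y) - l\<^sup>2 * t / 2\<bar> \<le> \<bar>l\<bar> * (t * B)"
proof -
  have p: "0 < fk l \<beta> t y" by (rule fk_pos[OF assms(1-3)])
  have "fk l \<beta> t y \<le> exp (\<bar>l\<bar> * (t * B) + l\<^sup>2 * t / 2)" "exp (- (\<bar>l\<bar> * (t * B)) + l\<^sup>2 * t / 2) \<le> fk l \<beta> t y"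
    using fk_bounds[OF assms] unfolding exp_add by auto
  then have "ln (fk l \<beta> t y) \<le> \<bar>l\<bar> * (t * B) + l\<^sup>2 * t / 2" "- (\<bar>l\<bar> * (t * B)) + l\<^sup>2 * t / 2 \<le> ln (fk l \<beta> t y)"
    using p by (metis exp_gt_zero ln_exp ln_le_cancel_iff)+
  then show ?thesis by linarith
qed

lemma ln_fk_between:
  assumes "L > 0" "environment L \<beta>" "0 \<le> t"
  shows "bdd_above (range (\<lambda>y. ln (fk l \<beta> t y)))" "bdd_below (range (\<lambda>y. ln (fk l \<beta> t y)))"
    and "inf_ln_fk l \<beta> t \<le> ln (fk l \<beta> t y)" "ln (fk l \<beta> t y) \<le> sup_ln_fk l \<beta> t"
    and "fk l \<beta> t y \<le> exp (sup_ln_fk l \<beta> t)" "exp (inf_ln_fk l \<beta> t) \<le> fk l \<beta> t y"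
proof -
  obtain B where "\<And>y s. 0 \<le> s \<Longrightarrow> s \<le> t \<Longrightarrow> \<bar>\<beta> y s\<bar> \<le> B"
    using environment_bounded[OF assms(1,2)] by metis
  note b = ln_fk_bounds[OF assms this]
  show 1: "bdd_above (range (\<lambda>y. ln (fk l \<beta> t y)))"
    by (rule bdd_aboveI2[of _ _ "l\<^sup>2 * t / 2 + \<bar>l\<bar> * (t * B)"]) (use b in \<open>smt (verit)\<close>)
  show 2: "bdd_below (range (\<lambda>y. ln (fk l \<beta> t y)))"
    by (rule bdd_belowI2[of _ "l\<^sup>2 * t / 2 - \<bar>l\<bar> * (t * B)"]) (use b in \<open>smt (verit)\<close>)
  show 3: "inf_ln_fk l \<beta> t \<le> ln (fk l \<beta> t y)" unfolding inf_ln_fk_def by (rule cINF_lower[OF 2]) simp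
  show 4: "ln (fk l \<beta> t y) \<le> sup_ln_fk l \<beta> t" unfolding sup_ln_fk_def by (rule cSUP_upper[OF _ 1]) simp
  have p: "exp (ln (fk l \<beta> t y)) = fk l \<beta> t y" using fk_pos[OF assms] by simp
  show "fk l \<beta> t y \<le> exp (sup_ln_fk l \<beta> t)" "exp (inf_ln_fk l \<beta> t) \<le> fk l \<beta> t y"
    using 3 4 p by (metis exp_le_cancel_iff)+
qed

lemma sup_inf_ln_fk_bounds:
  assumes "L > 0" "environment L \<beta>" "0 \<le> t"
    and B: "\<And>y s. 0 \<le> s \<Longrightarrow> s \<le> t \<Longrightarrow> \<bar>\<beta> y s\<bar> \<le> B"
  shows "\<bar>sup_ln_fk l \<beta> t - l\<^sup>2 * t / 2\<bar> \<le> \<bar>l\<bar> * (t * B)" "\<bar>inf_ln_fk l \<beta> t - l\<^sup>2 * t / 2\<bar> \<le> \<bar>l\<bar> * (t * B)"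
proof -
  note b = ln_fk_bounds[OF assms]
  have "sup_ln_fk l \<beta> t \<le> l\<^sup>2 * t / 2 + \<bar>l\<bar> * (t * B)"
    unfolding sup_ln_fk_def using b by (intro cSUP_least) (auto, smt (verit))
  moreover have "inf_ln_fk l \<beta> t \<ge> l\<^sup>2 * t / 2 - \<bar>l\<bar> * (t * B)"
    unfolding inf_ln_fk_def using b by (intro cINF_greatest) (auto, smt (verit))
  moreover have "inf_ln_fk l \<beta> t \<le> ln (fk l \<beta> t 0)" "ln (fk l \<beta> t 0) \<le> sup_ln_fk l \<beta> t"
    using ln_fk_between(3,4)[OF assms(1-3)] by auto
  ultimately show "\<bar>sup_ln_fk l \<beta> t - l\<^sup>2 * t / 2\<bar> \<le> \<bar>l\<bar> * (t * B)" "\<bar>inf_ln_fk l \<beta> t - l\<^sup>2 * t / 2\<bar> \<le> \<bar>l\<bar> * (t * B)"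
    using b[of l 0] by linarith+
qed

text \<open>Bound the second factor in the Markov property by its supremum or infimum over the end point.\<close>

lemma ln_fk_sub_and_superadditive:
  assumes L: "L > 0" and env: "environment L \<beta>" and s: "0 \<le> s" and t: "0 \<le> t"
  shows "sup_ln_fk l \<beta> (s + t) \<le> sup_ln_fk l (\<lambda>x u. \<beta> x (u + t)) s + sup_ln_fk l \<beta> t"
    and "inf_ln_fk l (\<lambda>x u. \<beta> x (u + t)) s + inf_ln_fk l \<beta> t \<le> inf_ln_fk l \<beta> (s + t)"
proof -
  let ?\<beta>' = "\<lambda>x u. \<beta> x (u + t)"
  have env': "environment L ?\<beta>'" using env t by (rule environment_shift)
  note bt = ln_fk_between[OF L env t]
  note bs = ln_fk_between[OF L env' s]
  have st: "0 \<le> s + t" using s t by simp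
  have up: "fk l \<beta> (s + t) y \<le> fk l ?\<beta>' s y * exp (sup_ln_fk l \<beta> t)" for y
  proof -
    have "fk l \<beta> (s + t) y \<le> (\<integral>v. exp (- l * (fst (W s v) + drift ?\<beta>' s y v)) * exp (sup_ln_fk l \<beta> t) \<partial>P)"
      unfolding fk_markov[OF assms] using bt(5)
      by (intro integral_mono weighted_fk_integrable[OF L env t] fk_integrable[OF L env' s] integrable_mult_left s mult_left_mono) auto
    then show ?thesis by (simp add: fk_def)
  qed
  have down: "fk l ?\<beta>' s y * exp (inf_ln_fk l \<beta> t) \<le> fk l \<beta> (s + t) y" for y
  proof -
    have "(\<integral>v. exp (- l * (fst (W s v) + drift ?\<beta>' s y v)) * exp (inf_ln_fk l \<beta> t) \<partial>P) \<le> fk l \<beta> (s + t) y"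
      unfolding fk_markov[OF assms] using bt(6)
      by (intro integral_mono weighted_fk_integrable[OF L env t] fk_integrable[OF L env' s] integrable_mult_left s mult_left_mono) auto
    then show ?thesis by (simp add: fk_def)
  qed
  show "sup_ln_fk l \<beta> (s + t) \<le> sup_ln_fk l ?\<beta>' s + sup_ln_fk l \<beta> t"
    unfolding sup_ln_fk_def[of l \<beta> "s + t"]
  proof (rule cSUP_least)
    fix y
    have "ln (fk l \<beta> (s + t) y) \<le> ln (fk l ?\<beta>' s y * exp (sup_ln_fk l \<beta> t))"
      using up fk_pos[OF L env st] by (intro ln_mono) auto
    also have "\<dots> = ln (fk l ?\<beta>' s y) + sup_ln_fk l \<beta> t"
      using fk_pos[OF L env' s, of l y] by (simp add: ln_mult)
    finally show "ln (fk l \<beta> (s + t) y) \<le> sup_ln_fk l ?\<beta>' s + sup_ln_fk l \<beta> t" using bs(4)[of l y] by linarith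
  qed simp
  show "inf_ln_fk l ?\<beta>' s + inf_ln_fk l \<beta> t \<le> inf_ln_fk l \<beta> (s + t)"
    unfolding inf_ln_fk_def[of l \<beta> "s + t"]
  proof (rule cINF_greatest)
    fix y
    have "ln (fk l ?\<beta>' s y) + inf_ln_fk l \<beta> t = ln (fk l ?\<beta>' s y * exp (inf_ln_fk l \<beta> t))"
      using fk_pos[OF L env' s, of l y] by (simp add: ln_mult)
    also have "\<dots> \<le> ln (fk l \<beta> (s + t) y)"
      using down fk_pos[OF L env' s, of l y] by (intro ln_mono) auto
    finally show "inf_ln_fk l ?\<beta>' s + inf_ln_fk l \<beta> t \<le> ln (fk l \<beta> (s + t) y)" using bs(3)[of l y] by linarith
  qed simp
qed

lemma sup_le_inf_ln_fk:
  assumes L: "L > 0" and env: "environment L \<beta>" and t: "0 \<le> t"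
    and B: "\<And>y s. 0 \<le> s \<Longrightarrow> s \<le> 2 \<Longrightarrow> \<bar>\<beta> y (s + t)\<bar> \<le> B"
  shows "sup_ln_fk l \<beta> (1 + t) \<le> inf_ln_fk l \<beta> (2 + t) + (ln (harnack_const L) + 3 * \<bar>l\<bar> * B)"
proof -
  have "ln (fk l \<beta> (1 + t) y) - (ln (harnack_const L) + 3 * \<bar>l\<bar> * B) \<le> ln (fk l \<beta> (2 + t) y')" for y y'
  proof -
    have p: "0 < fk l \<beta> (1 + t) y" "0 < fk l \<beta> (2 + t) y'" using fk_pos[OF L env] t by auto
    have "ln (fk l \<beta> (1 + t) y) \<le> ln (harnack_const L * exp (3 * \<bar>l\<bar> * B) * fk l \<beta> (2 + t) y')"
      by (intro ln_mono harnack[OF assms] p)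
    also have "\<dots> = (ln (harnack_const L) + 3 * \<bar>l\<bar> * B) + ln (fk l \<beta> (2 + t) y')"
      using p(2) by (simp add: ln_mult harnack_const_def)
    finally show ?thesis by simp
  qed
  then have "ln (fk l \<beta> (1 + t) y) - (ln (harnack_const L) + 3 * \<bar>l\<bar> * B) \<le> inf_ln_fk l \<beta> (2 + t)" for y
    unfolding inf_ln_fk_def by (intro cINF_greatest) auto
  then have "ln (fk l \<beta> (1 + t) y) \<le> inf_ln_fk l \<beta> (2 + t) + (ln (harnack_const L) + 3 * \<bar>l\<bar> * B)" for y
    by (simp add: algebra_simps)
  then show ?thesis unfolding sup_ln_fk_def by (intro cSUP_least) auto
qed

end

section \<open>The random field as a random environment\<close>

text \<open>Both suprema in the norm are finite and nonnegative: the first by compactness of the period cell, the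
  second by the Lipschitz condition.\<close>

lemma periodic_lipschitz_abs_le_norm:
  assumes L: "L > 0" and g: "g \<in> periodic_lipschitz L"
  shows "\<bar>g y\<bar> \<le> lipschitz_norm g"
proof -
  obtain C where C: "C-lipschitz_on UNIV g" and per: "cell_periodic L g"
    using g by (auto simp: periodic_lipschitz_def)
  have "environment L (\<lambda>y t. g y)"
    using per lipschitz_on_continuous_on[OF C]
    by (auto simp: environment_def split_beta intro!: continuous_on_compose2[OF lipschitz_on_continuous_on[OF C]] continuous_intros)
  then obtain B where B: "\<And>y. \<bar>g y\<bar> \<le> B"
    using environment_bounded[OF L, of "\<lambda>y t. g y" 0] by (metis order_refl)
  let ?D = "{(y, y'). y \<noteq> y'} :: ((real ^ 'a) \<times> (real ^ 'a)) set"
  let ?q = "\<lambda>(y, y'). \<bar>g y - g y'\<bar> / dist y y'"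
  have q: "?q p \<le> C" if "p \<in> ?D" for p
    using that lipschitz_onD[OF C, of "fst p" "snd p"] by (auto simp: divide_le_eq dist_real_def)
  have "bdd_above (?q ` ?D)" using q by (intro bdd_aboveI2)
  moreover have "(0, 1) \<in> ?D" by simp
  ultimately have "?q (0, 1) \<le> (SUP p\<in>?D. ?q p)" by (rule cSUP_upper[rotated])
  moreover have "0 \<le> ?q (0, 1)" by simp
  moreover have "\<bar>g y\<bar> \<le> (SUP y. \<bar>g y\<bar>)" by (rule cSUP_upper) (auto intro!: bdd_aboveI2 B)
  ultimately show ?thesis unfolding lipschitz_norm_def by linarith
qed

lemma continuous_into_lipschitz_environment:
  assumes L: "L > 0" and J: "continuous_into_lipschitz L J"
  shows "environment L (\<lambda>y t. J t y)"
proof -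
  have lip: "J t \<in> periodic_lipschitz L" if "t \<ge> 0" for t using J that by (simp add: continuous_into_lipschitz_def)
  have diff: "(\<lambda>y. J s y - J t y) \<in> periodic_lipschitz L" if st: "s \<ge> 0" "t \<ge> 0" for s t
  proof -
    obtain C D where "C-lipschitz_on UNIV (J s)" "D-lipschitz_on UNIV (J t)"
      using lip[OF st(1)] lip[OF st(2)] by (auto simp: periodic_lipschitz_def)
    then have "(C + D)-lipschitz_on UNIV (\<lambda>y. J s y - J t y)" by (rule lipschitz_on_diff)
    then show ?thesis using lip st by (auto simp: periodic_lipschitz_def cell_periodic_def)
  qed
  have "continuous_on (UNIV \<times> {0..}) (\<lambda>(y, t). J t y)"
    unfolding continuous_on_iff
  proof (intro ballI allI impI)
    fix q :: "(real ^ 'a) \<times> real" and e :: real assume q: "q \<in> UNIV \<times> {0..}" and e: "e > 0"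
    obtain y t where yt: "q = (y, t)" and t: "t \<in> {0..}" using q by (cases q) auto
    obtain C where C: "C-lipschitz_on UNIV (J t)" using lip t by (auto simp: periodic_lipschitz_def)
    then have C0: "0 \<le> C" by (rule lipschitz_on_nonneg)
    have "((\<lambda>s. lipschitz_norm (\<lambda>y. J s y - J t y)) \<longlongrightarrow> 0) (at t within {0..})"
      using J t by (simp add: continuous_into_lipschitz_def)
    from tendstoD[OF this, of "e / 2"] e obtain d where d: "d > 0"
      "\<And>s. s \<in> {0..} \<Longrightarrow> s \<noteq> t \<Longrightarrow> dist s t < d \<Longrightarrow> \<bar>lipschitz_norm (\<lambda>y. J s y - J t y)\<bar> < e / 2"
      unfolding eventually_at by auto
    show "\<exists>d>0. \<forall>p\<in>UNIV \<times> {0..}. dist p q < d \<longrightarrow>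
        dist (case p of (y, t) \<Rightarrow> J t y) (case q of (y, t) \<Rightarrow> J t y) < e"
    proof (intro exI[of _ "min d (e / (2 * (C + 1)))"] conjI ballI impI)
      show "0 < min d (e / (2 * (C + 1)))" using d e C0 by simp
      fix p assume p: "p \<in> UNIV \<times> {0..}" "dist p q < min d (e / (2 * (C + 1)))"
      obtain y' s where ps: "p = (y', s)" by (cases p)
      have s: "s \<in> {0..}" using p ps by simp
      have dy: "dist y' y < e / (2 * (C + 1))" and ds: "dist s t < d"
        using p(2) dist_fst_le[of p "(y, t)"] dist_snd_le[of p "(y, t)"] by (auto simp: ps yt)
      have 1: "\<bar>J s y' - J t y'\<bar> < e / 2"
      proof (cases "s = t")
        case False
        have "\<bar>J s y' - J t y'\<bar> \<le> lipschitz_norm (\<lambda>y. J s y - J t y)"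
          using periodic_lipschitz_abs_le_norm[OF L diff, of s t y'] s t by simp
        with d(2)[OF s False ds] show ?thesis by linarith
      qed (use e in simp)
      have "\<bar>J t y' - J t y\<bar> \<le> C * dist y' y" using lipschitz_onD[OF C, of y' y] by (simp add: dist_real_def)
      also have "\<dots> \<le> (C + 1) * dist y' y" by (intro mult_right_mono) auto
      also have "\<dots> < e / 2" using dy C0 by (simp add: field_simps)
      finally show "dist (case p of (y, t) \<Rightarrow> J t y) (case q of (y, t) \<Rightarrow> J t y) < e"
        using 1 abs_triangle_ineq[of "J s y' - J t y'" "J t y' - J t y"] by (simp add: ps yt dist_real_def)
    qed
  qed
  then show ?thesis using lip by (auto simp: environment_def periodic_lipschitz_def)
qed


context random_shear_field begin

abbreviation env :: "'w \<Rightarrow> real ^ 'm \<Rightarrow> real \<Rightarrow> real" where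
  "env \<omega> \<equiv> (\<lambda>y t. b y t \<omega>)"

lemma environment_env:
  assumes "\<omega> \<in> space Q"
  shows "environment L (env \<omega>)"
proof -
  obtain J where J: "continuous_into_lipschitz L J" "\<And>t. t \<ge> 0 \<Longrightarrow> (\<lambda>y. b y t \<omega>) = J t"
    using A1[OF assms] by blast
  have "environment L (\<lambda>y t. J t y)" by (rule continuous_into_lipschitz_environment[OF L_pos J(1)])
  moreover have "J t y = b y t \<omega>" if "t \<ge> 0" for t y using J(2)[OF that] by metis
  moreover from this have "continuous_on (UNIV \<times> {0..}) (\<lambda>(y, t). J t y) \<longleftrightarrow> continuous_on (UNIV \<times> {0..}) (\<lambda>(y, t). b y t \<omega>)"
    by (intro continuous_on_cong) auto
  ultimately show ?thesis
    unfolding environment_def using periodic[OF _ assms] by simp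
qed

lemma field_measurable: "t \<ge> 0 \<Longrightarrow> b y t \<in> borel_measurable Q"
  using gaussian_field_component[OF gaussian, of "(y, t)"] by (auto simp: gaussian_rv_def)

lemma field_mean_zero:
  assumes "t \<ge> 0"
  shows "(\<integral>\<omega>. b y t \<omega> \<partial>Q) = 0"
proof -
  obtain k where k: "\<And>i. 0 \<le> (y + lattice_vec L k) $ i" "\<And>i. (y + lattice_vec L k) $ i \<le> L"
    using lattice_reduction[OF L_pos] by metis
  have "(\<integral>\<omega>. b y t \<omega> \<partial>Q) = (\<integral>\<omega>. b (y + lattice_vec L k) t \<omega> \<partial>Q)"
    using cell_periodic_lattice[OF periodic[OF assms]]
    by (intro Bochner_Integration.integral_cong) auto
  also have "\<dots> = 0"
    using assms k by (intro A4_mean) (auto simp: period_cell_def mem_box_cart)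
  finally show ?thesis .
qed

lemma centered_field: "centered_gaussian_field Q (UNIV \<times> {0..}) (\<lambda>(y, t). b y t)"
  unfolding centered_gaussian_field_def using gaussian field_mean_zero by auto

text \<open>Finite for every \<open>\<omega>\<close> in the probability space, by continuity and periodicity.\<close>

definition max_field :: "real \<Rightarrow> 'w \<Rightarrow> real" where
  "max_field T \<omega> = (SUP p\<in>UNIV \<times> {0..T}. \<bar>case p of (y, t) \<Rightarrow> b y t \<omega>\<bar>)"

lemma abs_field_le_max:
  assumes "\<omega> \<in> space Q"
  shows "bdd_above ((\<lambda>p. \<bar>case p of (y, t) \<Rightarrow> b y t \<omega>\<bar>) ` (UNIV \<times> {0..T}))"
    and "0 \<le> s \<Longrightarrow> s \<le> T \<Longrightarrow> \<bar>b y s \<omega>\<bar> \<le> max_field T \<omega>"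
proof -
  obtain B where "\<And>y s. 0 \<le> s \<Longrightarrow> s \<le> T \<Longrightarrow> \<bar>b y s \<omega>\<bar> \<le> B"
    using environment_bounded[OF L_pos environment_env[OF assms]] by metis
  then show 1: "bdd_above ((\<lambda>p. \<bar>case p of (y, t) \<Rightarrow> b y t \<omega>\<bar>) ` (UNIV \<times> {0..T}))"
    by (intro bdd_aboveI2[of _ _ B]) auto
  show "\<bar>b y s \<omega>\<bar> \<le> max_field T \<omega>" if "0 \<le> s" "s \<le> T"
    unfolding max_field_def using cSUP_upper[OF _ 1, of "(y, s)"] that by simp
qed

text \<open>Continuity reduces the supremum to a countable dense set of points, where Fernique's argument applies.\<close>

lemma max_field_integrable:
  assumes "0 \<le> T"
  shows "integrable Q (max_field T)"
proof -
  let ?S = "UNIV \<times> {0..T} :: ((real ^ 'm) \<times> real) set"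
  obtain D where D: "countable D" "D \<subseteq> ?S" "?S \<subseteq> closure D" by (rule separable)
  have ne: "D \<noteq> {}" using D assms by auto
  have cl: "closed ?S" by (intro closed_Times) auto
  have eq: "max_field T \<omega> = (SUP p\<in>D. \<bar>(case p of (y, t) \<Rightarrow> b y t) \<omega>\<bar>)" if w: "\<omega> \<in> space Q" for \<omega>
  proof -
    have "continuous_on ?S (\<lambda>p. \<bar>case p of (y, t) \<Rightarrow> b y t \<omega>\<bar>)"
      using environment_env[OF w] unfolding environment_def
      by (intro continuous_on_rabs) (auto elim: continuous_on_subset)
    from SUP_dense[OF cl this D(2,3) ne abs_field_le_max(1)[OF w]]
    show ?thesis unfolding max_field_def by (simp add: case_prod_beta')
  qed
  have "bdd_above ((\<lambda>p. \<bar>(case p of (y, t) \<Rightarrow> b y t) \<omega>\<bar>) ` D)" if "\<omega> \<in> space Q" for \<omega>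
    using bdd_above_mono[OF abs_field_le_max(1)[OF that, of T] image_mono[OF D(2)]] by (simp add: case_prod_beta')
  then have "integrable Q (\<lambda>\<omega>. SUP p\<in>D. \<bar>(case p of (y, t) \<Rightarrow> b y t) \<omega>\<bar>)"
    using D by (intro fernique[OF centered_field D(1) ne]) auto
  then show ?thesis using eq by (subst Bochner_Integration.integrable_cong[OF refl]) auto
qed

lemma max_field_nonneg: "\<omega> \<in> space Q \<Longrightarrow> 0 \<le> T \<Longrightarrow> 0 \<le> max_field T \<omega>"
  using abs_field_le_max(2)[of \<omega> 0 T 0] by linarith

end

section \<open>Discretising space and time\<close>

definition grid :: "real \<Rightarrow> nat \<Rightarrow> (real ^ 'm) set" where
  "grid L N = (\<lambda>k. \<chi> i. L / real N * of_int (k i)) ` (UNIV \<rightarrow>\<^sub>E {0..<int N})"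

text \<open>Rounding followed by reduction modulo the period, so that only finitely many values occur.\<close>

definition grid_round :: "real \<Rightarrow> nat \<Rightarrow> real ^ 'm \<Rightarrow> real ^ 'm" where
  "grid_round L N y = (\<chi> i. L / real N * of_int (\<lfloor>real N * y $ i / L\<rfloor> mod int N))"

lemma finite_grid: "finite (grid L N)"
  unfolding grid_def by (intro finite_imageI finite_PiE) auto

lemma grid_round_in_grid: "0 < N \<Longrightarrow> grid_round L N y \<in> grid L N"
  unfolding grid_def grid_round_def
  by (rule image_eqI[where x="\<lambda>i. \<lfloor>real N * y $ i / L\<rfloor> mod int N"]) auto

lemma grid_round_measurable: "grid_round L N \<in> borel_measurable borel"
proof (subst borel_measurable_euclidean_space, rule ballI)
  fix e :: "real ^ 'm" assume "e \<in> Basis"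
  then obtain i where e: "e = axis i 1" by (auto simp: Basis_vec_def)
  have [measurable]: "(\<lambda>y :: real ^ 'm. y $ i) \<in> borel_measurable borel"
    by (intro borel_measurable_continuous_onI continuous_intros)
  have "(\<lambda>k :: int. real_of_int (k mod int N)) \<in> count_space UNIV \<rightarrow>\<^sub>M borel" by simp
  then have [measurable]: "(\<lambda>y :: real ^ 'm. real_of_int (\<lfloor>real N * y $ i / L\<rfloor> mod int N)) \<in> borel_measurable borel"
    by (rule measurable_compose[rotated]) measurable
  show "(\<lambda>y :: real ^ 'm. grid_round L N y \<bullet> e) \<in> borel_measurable borel"
    unfolding e by (simp add: grid_round_def inner_axis)
qed

text \<open>To a periodic function, the rounded point looks like the point rounded without reduction
  modulo the period, which is close to \<open>y\<close>.\<close>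

lemma grid_round_periodic:
  assumes L: "L > 0" and N: "0 < N" and g: "cell_periodic L g"
  obtains y' where "dist y y' \<le> real CARD('m) * (L / real N)" "g (grid_round L N y) = g (y' :: real ^ 'm)"
proof -
  define n where "n i = \<lfloor>real N * y $ i / L\<rfloor>" for i
  define y' where "y' = (\<chi> i. L / real N * of_int (n i))"
  have "grid_round L N y + lattice_vec L (\<lambda>i. n i div int N) = y'"
  proof (simp add: vec_eq_iff, intro allI)
    fix i
    have "real_of_int (n i) = of_int (n i mod int N) + of_int (n i div int N) * real N"
      by (metis add.commute mult.commute of_int_add of_int_mult of_int_of_nat_eq mult_div_mod_eq)
    then show "grid_round L N y $ i + lattice_vec L (\<lambda>i. n i div int N) $ i = y' $ i"
      using N by (simp add: grid_round_def lattice_vec_def y'_def n_def[symmetric] field_simps)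
  qed
  then have "g (grid_round L N y) = g y'" using cell_periodic_lattice[OF g] by metis
  moreover have "dist y y' \<le> real CARD('m) * (L / real N)"
  proof -
    have "\<bar>(y - y') $ i\<bar> \<le> L / real N" for i
    proof -
      define x where "x = real N * y $ i / L"
      have y: "y $ i = L / real N * x" using L N by (simp add: x_def)
      have "0 \<le> x - of_int \<lfloor>x\<rfloor>" "x - of_int \<lfloor>x\<rfloor> \<le> 1" by linarith+
      then have "\<bar>L / real N * (x - of_int \<lfloor>x\<rfloor>)\<bar> \<le> L / real N * 1"
        unfolding abs_mult using L N by (intro mult_mono) auto
      then show ?thesis unfolding y'_def n_def x_def[symmetric] by (simp add: y right_diff_distrib)
    qed
    then have "(\<Sum>i\<in>UNIV. \<bar>(y - y') $ i\<bar>) \<le> (\<Sum>i\<in>(UNIV :: 'm set). L / real N)" by (intro sum_mono)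
    then show ?thesis using norm_le_l1_cart[of "y - y'"] by (simp add: dist_norm)
  qed
  ultimately show ?thesis using that by blast
qed

context shear_wiener begin

text \<open>A rounded walk visits one of finitely many sequences \<open>p\<close> of grid points; \<open>w p\<close> is the expectation of the
  weight of \<open>W\<^sub>1\<close> on the event that it follows \<open>p\<close>. These coefficients do not depend on
  the environment \<open>g\<close>, so the functional becomes an explicit function of finitely many field values.\<close>

lemma walk_fk_grid:
  assumes N: "0 < N" and h: "0 \<le> h"
  obtains w where "\<And>p. 0 \<le> w p" "(\<Sum>p\<in>{..<N} \<rightarrow>\<^sub>E grid L N. w p) = exp (l\<^sup>2 * (real N * h) / 2)"
    "\<And>g. walk_fk l (\<lambda>j x. g j (grid_round L N x)) N h y
       = (\<Sum>p\<in>{..<N} \<rightarrow>\<^sub>E grid L N. w p * exp (- l * (h * (\<Sum>j<N. g j (p j)))))"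
proof -
  let ?G = "{..<N} \<rightarrow>\<^sub>E (grid L N :: (real ^ 'm) set)"
  define path where "path v = (\<lambda>j\<in>{..<N}. grid_round L N (y + snd (W (real j * h) v)))" for v
  have finG: "finite ?G" by (intro finite_PiE finite_grid) auto
  have path: "path v \<in> ?G" for v using grid_round_in_grid[OF N] by (auto simp: path_def)
  let ?E = "\<lambda>v. exp (- l * fst (W (real N * h) v))"
  have Nh: "0 \<le> real N * h" using h by simp
  have sets: "{v\<in>space P. path v = p} \<in> sets P" for p
  proof -
    have ext: "path v \<in> extensional {..<N}" for v by (simp add: path_def)
    show ?thesis
    proof (cases "p \<in> extensional {..<N}")
      case True
      have "path v = p \<longleftrightarrow> (\<forall>j\<in>{..<N}. grid_round L N (y + snd (W (real j * h) v)) = p j)" for v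
        using extensionalityI[OF ext True, of v] by (auto simp: path_def)
      moreover have "{v\<in>space P. \<forall>j\<in>{..<N}. grid_round L N (y + snd (W (real j * h) v)) = p j} \<in> sets P"
      proof (intro sets.sets_Collect_finite_All)
        fix j
        have [measurable]: "(\<lambda>v. grid_round L N (y + snd (W (real j * h) v))) \<in> borel_measurable P"
          using h by (intro measurable_compose[OF _ grid_round_measurable] borel_measurable_add W_snd_measurable) auto
        show "{v\<in>space P. grid_round L N (y + snd (W (real j * h) v)) = p j} \<in> sets P" by measurable
      qed simp
      ultimately show ?thesis by simp
    next
      case False
      then have "{v\<in>space P. path v = p} = {}" using ext by blast
      then show ?thesis by (simp only: sets.empty_sets)
    qed
  qed
  define w where "w p = (\<integral>v. indicator {v\<in>space P. path v = p} v * ?E v \<partial>P)" for p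
  have intE: "integrable P (\<lambda>v. indicator {v\<in>space P. path v = p} v * ?E v)" for p
    using integrable_mult_indicator[OF sets[of p] exp_first(1)[OF Nh, of l]] by (simp only: real_scaleR_def)
  have sum_ind: "(\<Sum>p\<in>?G. indicator {v\<in>space P. path v = p} v * c p) = (c (path v) :: real)" if "v \<in> space P" for v c
  proof -
    have "(\<Sum>p\<in>?G. indicator {v\<in>space P. path v = p} v * c p) = (\<Sum>p\<in>?G. if p = path v then c p else 0)"
      using that by (intro sum.cong) (auto simp: indicator_def)
    then show ?thesis using path[of v] finG by (simp add: sum.delta)
  qed
  have tot: "(\<Sum>p\<in>?G. w p * a p) = (\<integral>v. ?E v * a (path v) \<partial>P)" for a
  proof -
    have "(\<Sum>p\<in>?G. w p * a p) = (\<integral>v. (\<Sum>p\<in>?G. indicator {v\<in>space P. path v = p} v * ?E v * a p) \<partial>P)"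
      unfolding w_def using intE by (subst Bochner_Integration.integral_sum) auto
    also have "\<dots> = (\<integral>v. ?E v * a (path v) \<partial>P)"
    proof (intro Bochner_Integration.integral_cong refl)
      fix v assume v: "v \<in> space P"
      show "(\<Sum>p\<in>?G. indicator {v\<in>space P. path v = p} v * ?E v * a p) = ?E v * a (path v)"
        using sum_ind[OF v, of "\<lambda>p. ?E v * a p"] by (simp add: mult.assoc)
    qed
    finally show ?thesis .
  qed
  show ?thesis
  proof (rule that[of w])
    show "0 \<le> w p" for p unfolding w_def by (intro integral_nonneg_AE) auto
    show "(\<Sum>p\<in>?G. w p) = exp (l\<^sup>2 * (real N * h) / 2)"
      using tot[of "\<lambda>_. 1"] exp_first(2)[OF Nh, of l] by simp
    fix g :: "nat \<Rightarrow> real ^ 'm \<Rightarrow> real"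
    have "walk_fk l (\<lambda>j x. g j (grid_round L N x)) N h y
        = (\<integral>v. ?E v * exp (- l * (h * (\<Sum>j<N. g j (path v j)))) \<partial>P)"
      unfolding walk_fk_def
    proof (intro Bochner_Integration.integral_cong refl)
      fix v assume v: "v \<in> space P"
      have "(\<Sum>j<N. g j (path v j)) = (\<Sum>j<N. g j (grid_round L N (y + snd (W (real j * h) v))))"
        by (intro sum.cong) (auto simp: path_def)
      then show "walk_weight l (\<lambda>j x. g j (grid_round L N x)) N h y (step_increments 0 h N v) = ?E v * exp (- l * (h * (\<Sum>j<N. g j (path v j))))"
        unfolding walk_weight_increments_0[OF v] exp_add[symmetric] distrib_left[symmetric] by (simp only:)
    qed
    also have "\<dots> = (\<Sum>p\<in>?G. w p * exp (- l * (h * (\<Sum>j<N. g j (p j)))))" by (rule tot[symmetric])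
    finally show "walk_fk l (\<lambda>j x. g j (grid_round L N x)) N h y = (\<Sum>p\<in>?G. w p * exp (- l * (h * (\<Sum>j<N. g j (p j)))))" .
  qed
qed

lemma walk_fk_grid_tendsto:
  assumes L: "L > 0" and env: "environment L \<beta>" and t: "0 \<le> t"
  shows "(\<lambda>N. walk_fk l (\<lambda>j x. \<beta> (grid_round L N x) (t - real j * (t / real N))) N (t / real N) y) \<longlonglongrightarrow> fk l \<beta> t y"
proof -
  obtain B where B: "\<And>y s. 0 \<le> s \<Longrightarrow> s \<le> t \<Longrightarrow> \<bar>\<beta> y s\<bar> \<le> B"
    using environment_bounded[OF L env] by metis
  note tg = grid_time_range[OF t]
  show ?thesis
  proof (rule walk_fk_tendsto[OF L env t])
    show "\<bar>\<beta> (grid_round L N x) (t - real j * (t / real N))\<bar> \<le> B" if "j < N" for N j x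
      using environment_bound_at[OF B that t] by simp
    show "(\<lambda>x. \<beta> (grid_round L N x) (t - real j * (t / real N))) \<in> borel_measurable borel" if "j < N" for N j
      by (rule measurable_compose[OF grid_round_measurable time_grid_measurable[OF env t that]])
    fix e :: real assume e: "e > 0"
    obtain d where d: "d > 0" "\<And>y y' s. 0 \<le> s \<Longrightarrow> s \<le> t \<Longrightarrow> dist y y' < d \<Longrightarrow> \<bar>\<beta> y s - \<beta> y' s\<bar> < e"
      using environment_uniformly_continuous[OF L env e] by metis
    have "(\<lambda>N. real CARD('m) * L / real N) \<longlonglongrightarrow> 0" by (rule lim_const_over_n)
    then have "\<forall>\<^sub>F N in sequentially. real CARD('m) * L / real N < d" using d(1) by (rule order_tendstoD)
    then show "\<forall>\<^sub>F N in sequentially. \<forall>j<N. \<forall>x. \<bar>\<beta> (grid_round L N x) (t - real j * (t / real N)) - \<beta> x (t - real j * (t / real N))\<bar> \<le> e"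
      using eventually_gt_at_top[of 0]
    proof eventually_elim
      case (elim N)
      show ?case
      proof (intro allI impI)
        fix j x assume j: "j < N"
        let ?s = "t - real j * (t / real N)"
        have "cell_periodic L (\<lambda>y. \<beta> y ?s)" using env tg(1)[OF j] by (simp add: environment_def)
        then obtain y' where y': "dist x y' \<le> real CARD('m) * (L / real N)" "\<beta> (grid_round L N x) ?s = \<beta> y' ?s"
          using grid_round_periodic[OF L elim(2), of "\<lambda>y. \<beta> y ?s" x] by metis
        then have "dist y' x < d" using elim(1) by (simp add: dist_commute)
        then show "\<bar>\<beta> (grid_round L N x) ?s - \<beta> x ?s\<bar> \<le> e"
          using d(2)[OF tg[OF j]] y'(2) by (simp add: less_imp_le)
      qed
    qed
  qed
qed

end

section \<open>Expectations over the random field\<close>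

lemma ln_weighted_exp_bound:
  fixes w x :: "'p \<Rightarrow> real"
  assumes "finite G" "\<And>p. p \<in> G \<Longrightarrow> 0 \<le> w p" "(\<Sum>p\<in>G. w p) = A" "A > 0"
    and x: "\<And>p. p \<in> G \<Longrightarrow> \<bar>x p\<bar> \<le> c"
  shows "\<bar>ln (\<Sum>p\<in>G. w p * exp (x p)) - ln A\<bar> \<le> c" "0 < (\<Sum>p\<in>G. w p * exp (x p))"
proof -
  let ?S = "\<Sum>p\<in>G. w p * exp (x p)"
  have "?S \<le> (\<Sum>p\<in>G. w p * exp c)"
    using assms x by (intro sum_mono mult_left_mono) (auto simp: abs_le_iff)
  also have "\<dots> = A * exp c" using assms by (simp add: sum_distrib_right[symmetric])
  finally have up: "?S \<le> A * exp c" .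
  have "A * exp (- c) = (\<Sum>p\<in>G. w p * exp (- c))" using assms by (simp add: sum_distrib_right[symmetric])
  also have "\<dots> \<le> ?S"
    using assms x by (intro sum_mono mult_left_mono) (auto simp: abs_le_iff minus_le_iff)
  finally have low: "A * exp (- c) \<le> ?S" .
  have "0 < A * exp (- c)" using assms by simp
  with low show pos: "0 < ?S" by linarith
  have "ln ?S \<le> ln (A * exp c)" "ln (A * exp (- c)) \<le> ln ?S"
    using up low pos assms by (auto intro!: ln_mono)
  then show "\<bar>ln ?S - ln A\<bar> \<le> c" using assms by (simp add: ln_mult)
qed

text \<open>Jensen's inequality for the logarithm, from \<open>1 + z \<le> exp z\<close> for the deviations \<open>z\<close> from the mean.\<close>

lemma ln_weighted_exp_ge_mean:
  fixes w x :: "'p \<Rightarrow> real"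
  assumes "finite G" "\<And>p. p \<in> G \<Longrightarrow> 0 \<le> w p" "(\<Sum>p\<in>G. w p) = A" "A > 0"
  shows "ln A + (\<Sum>p\<in>G. w p * x p) / A \<le> ln (\<Sum>p\<in>G. w p * exp (x p))"
proof -
  define m where "m = (\<Sum>p\<in>G. w p * x p) / A"
  have "(\<Sum>p\<in>G. w p * (1 + (x p - m))) = (\<Sum>p\<in>G. w p) + (\<Sum>p\<in>G. w p * x p) - (\<Sum>p\<in>G. w p) * m"
    by (simp add: distrib_left right_diff_distrib sum.distrib sum_subtractf sum_distrib_right)
  moreover have "(\<Sum>p\<in>G. w p * x p) = A * m" using assms by (simp add: m_def)
  ultimately have "A * 1 = (\<Sum>p\<in>G. w p * (1 + (x p - m)))" using assms by simp
  also have "\<dots> \<le> (\<Sum>p\<in>G. w p * exp (x p - m))"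
    using assms by (intro sum_mono mult_left_mono exp_ge_add_one_self) auto
  also have "\<dots> = (\<Sum>p\<in>G. w p * exp (x p)) * exp (- m)"
    by (simp add: sum_distrib_right exp_diff exp_minus divide_inverse mult.assoc)
  finally have "A * exp m \<le> (\<Sum>p\<in>G. w p * exp (x p))"
    using assms by (simp add: exp_minus field_simps)
  then have "ln (A * exp m) \<le> ln (\<Sum>p\<in>G. w p * exp (x p))"
    using assms by (intro ln_mono) (auto intro: less_le_trans[of _ "A * exp m"])
  then show ?thesis using assms by (simp add: ln_mult m_def)
qed

locale random_shear_wiener =
  field: random_shear_field Q L b \<tau> + shear_wiener P W
  for Q :: "'w measure" and L :: real and b :: "real ^ 'm \<Rightarrow> real \<Rightarrow> 'w \<Rightarrow> real"
    and \<tau> :: "real \<Rightarrow> 'w \<Rightarrow> 'w" and P :: "'v measure" and W :: "real \<Rightarrow> 'v \<Rightarrow> real \<times> (real ^ 'm)"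
begin

abbreviation env :: "'w \<Rightarrow> real ^ 'm \<Rightarrow> real \<Rightarrow> real" where
  "env \<omega> \<equiv> (\<lambda>y t. b y t \<omega>)"

abbreviation grid_time :: "real \<Rightarrow> nat \<Rightarrow> nat \<Rightarrow> real" where
  "grid_time t N j \<equiv> t - real j * (t / real (Suc N))"

text \<open>The number of steps is \<open>Suc N\<close>, so that no step has length \<open>t / 0\<close>.\<close>

definition grid_fk :: "real \<Rightarrow> real \<Rightarrow> real ^ 'm \<Rightarrow> nat \<Rightarrow> (real ^ 'm \<Rightarrow> real \<Rightarrow> real) \<Rightarrow> real" where
  "grid_fk l t y N \<beta> = walk_fk l (\<lambda>j x. \<beta> (grid_round L (Suc N) x) (grid_time t N j)) (Suc N) (t / real (Suc N)) y"

definition grid_paths :: "nat \<Rightarrow> (nat \<Rightarrow> real ^ 'm) set" where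
  "grid_paths N = {..<Suc N} \<rightarrow>\<^sub>E grid L (Suc N)"

lemma finite_grid_paths: "finite (grid_paths N)"
  unfolding grid_paths_def by (intro finite_PiE finite_grid) auto

lemmas grid_time_bounds = grid_time_range[where N="Suc N" for N]

lemma grid_fk_rep:
  assumes t: "0 \<le> t"
  obtains w where "\<And>p. 0 \<le> w p" "(\<Sum>p\<in>grid_paths N. w p) = exp (l\<^sup>2 * t / 2)"
    "\<And>\<beta>. grid_fk l t y N \<beta> = (\<Sum>p\<in>grid_paths N. w p * exp (- l * (t / real (Suc N) * (\<Sum>j<Suc N. \<beta> (p j) (grid_time t N j)))))"
proof -
  have Nt: "real (Suc N) * (t / real (Suc N)) = t" by simp
  have h: "0 \<le> t / real (Suc N)" using t by simp
  obtain w where w: "\<And>p. 0 \<le> w p" "(\<Sum>p\<in>{..<Suc N} \<rightarrow>\<^sub>E grid L (Suc N). w p) = exp (l\<^sup>2 * t / 2)"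
    "\<And>g. walk_fk l (\<lambda>j x. g j (grid_round L (Suc N) x)) (Suc N) (t / real (Suc N)) y
       = (\<Sum>p\<in>{..<Suc N} \<rightarrow>\<^sub>E grid L (Suc N). w p * exp (- l * (t / real (Suc N) * (\<Sum>j<Suc N. g j (p j)))))"
    by (rule walk_fk_grid[OF zero_less_Suc h, of N L l y, unfolded Nt]) blast
  show ?thesis
    by (rule that[of w]) (use w in \<open>auto simp: grid_paths_def grid_fk_def\<close>)
qed

lemma grid_fk_tendsto:
  assumes "environment L \<beta>" "0 \<le> t"
  shows "(\<lambda>N. grid_fk l t y N \<beta>) \<longlonglongrightarrow> fk l \<beta> t y"
  using LIMSEQ_Suc[OF walk_fk_grid_tendsto[OF field.L_pos assms]] unfolding grid_fk_def .

lemma ln_grid_fk_bound: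
  assumes t: "0 \<le> t" and B: "\<And>y s. 0 \<le> s \<Longrightarrow> s \<le> t \<Longrightarrow> \<bar>\<beta> y s\<bar> \<le> B"
  shows "\<bar>ln (grid_fk l t y N \<beta>) - l\<^sup>2 * t / 2\<bar> \<le> \<bar>l\<bar> * (t * B)" "0 < grid_fk l t y N \<beta>"
proof -
  obtain w where w0: "\<And>p. 0 \<le> w p" "(\<Sum>p\<in>grid_paths N. w p) = exp (l\<^sup>2 * t / 2)"
      "\<And>\<beta>. grid_fk l t y N \<beta> = (\<Sum>p\<in>grid_paths N. w p * exp (- l * (t / real (Suc N) * (\<Sum>j<Suc N. \<beta> (p j) (grid_time t N j)))))"
      by (rule grid_fk_rep[OF t, where l=l and N=N and y=y]) (rule that; assumption)
  note w = w0(1,2) w0(3)[of \<beta>]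
  have "\<bar>- l * (t / real (Suc N) * (\<Sum>j<Suc N. \<beta> (p j) (grid_time t N j)))\<bar> \<le> \<bar>l\<bar> * (t * B)" for p
  proof -
    have "\<bar>\<Sum>j<Suc N. \<beta> (p j) (grid_time t N j)\<bar> \<le> (\<Sum>j<Suc N. B)"
      using B grid_time_bounds[OF t] by (intro order_trans[OF sum_abs] sum_mono) auto
    then have "t / real (Suc N) * \<bar>\<Sum>j<Suc N. \<beta> (p j) (grid_time t N j)\<bar> \<le> t / real (Suc N) * (real (Suc N) * B)"
      using t by (intro mult_left_mono) (auto simp del: of_nat_Suc)
    also have "\<dots> = t * B" by (simp del: of_nat_Suc)
    finally have le: "\<bar>l\<bar> * (t / real (Suc N) * \<bar>\<Sum>j<Suc N. \<beta> (p j) (grid_time t N j)\<bar>) \<le> \<bar>l\<bar> * (t * B)"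
      by (rule mult_left_mono) simp
    have "\<bar>t / real (Suc N)\<bar> = t / real (Suc N)" using t by simp
    with le show ?thesis by (simp only: abs_mult abs_minus_cancel)
  qed
  then show "\<bar>ln (grid_fk l t y N \<beta>) - l\<^sup>2 * t / 2\<bar> \<le> \<bar>l\<bar> * (t * B)" "0 < grid_fk l t y N \<beta>"
    using ln_weighted_exp_bound[OF finite_grid_paths[of N], of w "exp (l\<^sup>2 * t / 2)"
        "\<lambda>p. - l * (t / real (Suc N) * (\<Sum>j<Suc N. \<beta> (p j) (grid_time t N j)))" "\<bar>l\<bar> * (t * B)"] w
    by (simp_all only: ln_exp exp_gt_zero)
qed

lemma grid_fk_measurable:
  assumes t: "0 \<le> t"
  shows "(\<lambda>\<omega>. grid_fk l t y N (env \<omega>)) \<in> borel_measurable Q"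
proof -
  obtain w where w0: "\<And>p. 0 \<le> w p" "(\<Sum>p\<in>grid_paths N. w p) = exp (l\<^sup>2 * t / 2)"
      "\<And>\<beta>. grid_fk l t y N \<beta> = (\<Sum>p\<in>grid_paths N. w p * exp (- l * (t / real (Suc N) * (\<Sum>j<Suc N. \<beta> (p j) (grid_time t N j)))))"
      by (rule grid_fk_rep[OF t, where l=l and N=N and y=y]) (rule that; assumption)
  note w = w0(3)
  have [measurable]: "(\<lambda>\<omega>. \<Sum>j<Suc N. b (p j) (grid_time t N j) \<omega>) \<in> borel_measurable Q" for p
    using grid_time_bounds(1)[OF t] by (intro borel_measurable_sum field.field_measurable) auto
  show ?thesis unfolding w by measurable
qed

lemma fk_env_measurable:
  assumes t: "0 \<le> t"
  shows "(\<lambda>\<omega>. fk l (env \<omega>) t y) \<in> borel_measurable Q"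
  by (rule borel_measurable_LIMSEQ_real[OF grid_fk_tendsto[OF field.environment_env t] grid_fk_measurable[OF t]])

lemma expectation_ln_grid_fk_tendsto:
  assumes t: "0 \<le> t" and X: "\<And>\<omega>. \<omega> \<in> space Q \<Longrightarrow> X \<omega> = env \<omega> \<or> X \<omega> = (\<lambda>y s. - b y s \<omega>)"
    and m: "\<And>N. (\<lambda>\<omega>. grid_fk l t y N (X \<omega>)) \<in> borel_measurable Q"
  shows "(\<lambda>N. \<integral>\<omega>. ln (grid_fk l t y N (X \<omega>)) \<partial>Q) \<longlonglongrightarrow> (\<integral>\<omega>. ln (fk l (X \<omega>) t y) \<partial>Q)"
    and "\<And>N. integrable Q (\<lambda>\<omega>. ln (grid_fk l t y N (X \<omega>)))"
proof -
  have env: "environment L (X \<omega>)" if "\<omega> \<in> space Q" for \<omega>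
    using X[OF that] field.environment_env[OF that] environment_uminus[OF field.environment_env[OF that]] by metis
  have bd: "\<bar>X \<omega> y s\<bar> \<le> field.max_field t \<omega>" if "\<omega> \<in> space Q" "0 \<le> s" "s \<le> t" for \<omega> y s
    using X[OF that(1)] field.abs_field_le_max(2)[OF that] by auto
  note [measurable] = m
  have lim: "(\<lambda>N. grid_fk l t y N (X \<omega>)) \<longlonglongrightarrow> fk l (X \<omega>) t y" if "\<omega> \<in> space Q" for \<omega>
    by (rule grid_fk_tendsto[OF env[OF that] t])
  have [measurable]: "(\<lambda>\<omega>. fk l (X \<omega>) t y) \<in> borel_measurable Q"
    by (rule borel_measurable_LIMSEQ_real[OF lim m])
  let ?w = "\<lambda>\<omega>. l\<^sup>2 * t / 2 + \<bar>l\<bar> * (t * field.max_field t \<omega>)"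
  have iw: "integrable Q ?w" using field.max_field_integrable[OF t] by auto
  have bound: "AE \<omega> in Q. norm (ln (grid_fk l t y N (X \<omega>))) \<le> ?w \<omega>" for N
  proof (rule AE_I2)
    fix \<omega> assume w: "\<omega> \<in> space Q"
    have "0 \<le> l\<^sup>2 * t / 2" using t by simp
    moreover have "\<bar>ln (grid_fk l t y N (X \<omega>)) - l\<^sup>2 * t / 2\<bar> \<le> \<bar>l\<bar> * (t * field.max_field t \<omega>)"
      by (rule ln_grid_fk_bound(1)[OF t]) (rule bd[OF w])
    ultimately show "norm (ln (grid_fk l t y N (X \<omega>))) \<le> ?w \<omega>"
      unfolding real_norm_def by linarith
  qed
  show "(\<lambda>N. \<integral>\<omega>. ln (grid_fk l t y N (X \<omega>)) \<partial>Q) \<longlonglongrightarrow> (\<integral>\<omega>. ln (fk l (X \<omega>) t y) \<partial>Q)"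
  proof (rule integral_dominated_convergence[OF _ _ iw _ bound])
    show "AE \<omega> in Q. (\<lambda>N. ln (grid_fk l t y N (X \<omega>))) \<longlonglongrightarrow> ln (fk l (X \<omega>) t y)"
    proof (rule AE_I2)
      fix \<omega> assume w: "\<omega> \<in> space Q"
      show "(\<lambda>N. ln (grid_fk l t y N (X \<omega>))) \<longlonglongrightarrow> ln (fk l (X \<omega>) t y)"
        using fk_pos[OF field.L_pos env[OF w] t, of l y] by (intro tendsto_ln lim[OF w]) auto
    qed
  qed measurable
  show "integrable Q (\<lambda>\<omega>. ln (grid_fk l t y N (X \<omega>)))" for N
    by (rule Bochner_Integration.integrable_bound[OF iw]) (use bound[of N] in \<open>auto elim!: eventually_mono\<close>)
qed

text \<open>On the grid, the mean of the exponents is a linear combination of field values and has expectation 0.\<close>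

lemma expectation_ln_fk_ge:
  assumes t: "0 \<le> t"
  shows "l\<^sup>2 * t / 2 \<le> (\<integral>\<omega>. ln (fk l (env \<omega>) t y) \<partial>Q)"
proof (rule LIMSEQ_le_const[OF expectation_ln_grid_fk_tendsto(1)[where X=env, OF t]], goal_cases)
  case 3
  show ?case
  proof (intro exI allI impI)
    fix N
    obtain w where w: "\<And>p. 0 \<le> w p" "(\<Sum>p\<in>grid_paths N. w p) = exp (l\<^sup>2 * t / 2)"
      "\<And>\<beta>. grid_fk l t y N \<beta> = (\<Sum>p\<in>grid_paths N. w p * exp (- l * (t / real (Suc N) * (\<Sum>j<Suc N. \<beta> (p j) (grid_time t N j)))))"
      by (rule grid_fk_rep[OF t, where l=l and N=N and y=y]) (rule that; assumption)
    let ?A = "exp (l\<^sup>2 * t / 2)"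
    let ?x = "\<lambda>\<omega> p. - l * (t / real (Suc N) * (\<Sum>j<Suc N. b (p j) (grid_time t N j) \<omega>))"
    have ib: "integrable Q (\<lambda>\<omega>. b (p j) (grid_time t N j) \<omega>)" if "j < Suc N" for p :: "nat \<Rightarrow> real ^ 'm" and j
      using field.gaussian_rv_square_integrable(1)[OF field.gaussian_field_component[OF field.gaussian, of "(p j, grid_time t N j)"]]
        grid_time_bounds(1)[OF t that] by simp
    have isum: "integrable Q (\<lambda>\<omega>. \<Sum>j<Suc N. b (p j) (grid_time t N j) \<omega>)" for p :: "nat \<Rightarrow> real ^ 'm"
      by (intro Bochner_Integration.integrable_sum ib) auto
    have ms: "(\<integral>\<omega>. (\<Sum>j<Suc N. b (p j) (grid_time t N j) \<omega>) \<partial>Q) = 0" for p :: "nat \<Rightarrow> real ^ 'm"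
    proof -
      have "(\<integral>\<omega>. (\<Sum>j<Suc N. b (p j) (grid_time t N j) \<omega>) \<partial>Q) = (\<Sum>j<Suc N. (\<integral>\<omega>. b (p j) (grid_time t N j) \<omega> \<partial>Q))"
        by (rule Bochner_Integration.integral_sum) (rule ib, simp)
      also have "\<dots> = (\<Sum>j<Suc N. 0)"
        by (intro sum.cong refl field.field_mean_zero grid_time_bounds(1)[OF t]) simp
      finally show ?thesis by simp
    qed
    have i: "integrable Q (\<lambda>\<omega>. ln ?A + (\<Sum>p\<in>grid_paths N. w p * ?x \<omega> p) / ?A)"
      by (intro Bochner_Integration.integrable_add integrable_divide Bochner_Integration.integrable_sum integrable_mult_right isum field.integrable_const)
    have "l\<^sup>2 * t / 2 = (\<integral>\<omega>. ln ?A + (\<Sum>p\<in>grid_paths N. w p * ?x \<omega> p) / ?A \<partial>Q)"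
    proof -
      have ix: "integrable Q (\<lambda>\<omega>. w p * ?x \<omega> p)" for p by (intro integrable_mult_right isum)
      have "(\<integral>\<omega>. ln ?A + (\<Sum>p\<in>grid_paths N. w p * ?x \<omega> p) / ?A \<partial>Q) = (\<integral>\<omega>. ln ?A \<partial>Q) + (\<integral>\<omega>. (\<Sum>p\<in>grid_paths N. w p * ?x \<omega> p) / ?A \<partial>Q)"
        by (intro Bochner_Integration.integral_add field.integrable_const integrable_divide Bochner_Integration.integrable_sum ix)
      also have "(\<integral>\<omega>. (\<Sum>p\<in>grid_paths N. w p * ?x \<omega> p) / ?A \<partial>Q) = (\<Sum>p\<in>grid_paths N. (\<integral>\<omega>. w p * ?x \<omega> p \<partial>Q)) / ?A"
        unfolding integral_divide_zero by (subst Bochner_Integration.integral_sum) (rule ix refl)+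
      also have "\<dots> = 0" by (simp only: integral_mult_right_zero ms mult_zero_right sum.neutral_const div_0)
      finally show ?thesis by (simp add: field.prob_space)
    qed
    also have "\<dots> \<le> (\<integral>\<omega>. ln (grid_fk l t y N (env \<omega>)) \<partial>Q)"
    proof (rule integral_mono[OF i])
      show "integrable Q (\<lambda>\<omega>. ln (grid_fk l t y N (env \<omega>)))"
        by (rule expectation_ln_grid_fk_tendsto(2)[OF t _ grid_fk_measurable[OF t]]) simp
      show "ln ?A + (\<Sum>p\<in>grid_paths N. w p * ?x \<omega> p) / ?A \<le> ln (grid_fk l t y N (env \<omega>))" for \<omega>
        unfolding w(3) by (rule ln_weighted_exp_ge_mean[OF finite_grid_paths w(1) w(2) exp_gt_zero])
    qed
    finally show "l\<^sup>2 * t / 2 \<le> (\<integral>\<omega>. ln (grid_fk l t y N (env \<omega>)) \<partial>Q)" .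
  qed
qed (use grid_fk_measurable[OF t] in auto)

text \<open>On the grid, the functional depends on finitely many field values, whose joint law is symmetric.\<close>

lemma law_grid_fk_uminus:
  assumes t: "0 \<le> t"
  shows "(\<integral>\<omega>. ln (grid_fk l t y N (\<lambda>x s. - b x s \<omega>)) \<partial>Q) = (\<integral>\<omega>. ln (grid_fk l t y N (env \<omega>)) \<partial>Q)"
    and "(\<lambda>\<omega>. grid_fk l t y N (\<lambda>x s. - b x s \<omega>)) \<in> borel_measurable Q"
proof -
  obtain w where w0: "\<And>p. 0 \<le> w p" "(\<Sum>p\<in>grid_paths N. w p) = exp (l\<^sup>2 * t / 2)"
      "\<And>\<beta>. grid_fk l t y N \<beta> = (\<Sum>p\<in>grid_paths N. w p * exp (- l * (t / real (Suc N) * (\<Sum>j<Suc N. \<beta> (p j) (grid_time t N j)))))"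
      by (rule grid_fk_rep[OF t, where l=l and N=N and y=y]) (rule that; assumption)
  note w = w0(3)
  define S where "S = (grid L (Suc N) :: (real ^ 'm) set) \<times> grid_time t N ` {..<Suc N}"
  have S: "finite S" "S \<subseteq> UNIV \<times> {0..}"
    unfolding S_def using grid_time_bounds(1)[OF t]
    by (auto intro!: finite_cartesian_product finite_grid finite_imageI simp del: of_nat_Suc)
  let ?B = "\<Pi>\<^sub>M i\<in>S. (borel :: real measure)"
  define F where "F z = (\<Sum>p\<in>grid_paths N. w p * exp (- l * (t / real (Suc N) * (\<Sum>j<Suc N. z (p j, grid_time t N j)))))" for z :: "(real ^ 'm) \<times> real \<Rightarrow> real"
  have inS: "(p j, grid_time t N j) \<in> S" if "p \<in> grid_paths N" "j < Suc N" for p j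
    using that by (auto simp: S_def grid_paths_def PiE_def)
  have "(\<lambda>z. \<Sum>j<Suc N. z (p j, grid_time t N j)) \<in> borel_measurable ?B" if "p \<in> grid_paths N" for p
    using inS[OF that] by (intro borel_measurable_sum measurable_component_singleton) auto
  moreover have "(\<lambda>z. c * exp (- l * (a * s z))) \<in> borel_measurable ?B" if "s \<in> borel_measurable ?B" for s and a c :: real
    using that by measurable
  ultimately have F[measurable]: "F \<in> borel_measurable ?B"
    unfolding F_def by (intro borel_measurable_sum) blast
  let ?X = "\<lambda>(y, t). b y t"
  have restr: "(\<Sum>j<Suc N. (\<lambda>i\<in>S. f i) (p j, grid_time t N j)) = (\<Sum>j<Suc N. f (p j, grid_time t N j))"
    if "p \<in> grid_paths N" for f :: "_ \<Rightarrow> real" and p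
    using inS[OF that] by (intro sum.cong refl) (simp only: restrict_apply lessThan_iff if_True)
  have F1: "F (\<lambda>i\<in>S. ?X i \<omega>) = grid_fk l t y N (env \<omega>)" for \<omega>
    unfolding F_def w using inS by (intro sum.cong refl) (simp only: restr prod.case)
  have F2: "F (\<lambda>i\<in>S. - ?X i \<omega>) = grid_fk l t y N (\<lambda>x s. - b x s \<omega>)" for \<omega>
    unfolding F_def w using inS by (intro sum.cong refl) (simp only: restr prod.case)
  have mX: "(\<lambda>\<omega>. ?X i \<omega>) \<in> borel_measurable Q" if "i \<in> S" for i
    using that S(2) field.field_measurable by auto
  have m1: "(\<lambda>\<omega>. \<lambda>i\<in>S. ?X i \<omega>) \<in> Q \<rightarrow>\<^sub>M ?B" by (intro measurable_restrict mX)
  have m2: "(\<lambda>\<omega>. \<lambda>i\<in>S. - ?X i \<omega>) \<in> Q \<rightarrow>\<^sub>M ?B" by (intro measurable_restrict borel_measurable_uminus mX)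
  have "(\<integral>\<omega>. ln (grid_fk l t y N (\<lambda>x s. - b x s \<omega>)) \<partial>Q) = (\<integral>z. ln (F z) \<partial>distr Q ?B (\<lambda>\<omega>. \<lambda>i\<in>S. - ?X i \<omega>))"
    by (subst integral_distr[OF m2]) (simp_all only: F2 borel_measurable_ln F)
  also have "distr Q ?B (\<lambda>\<omega>. \<lambda>i\<in>S. - ?X i \<omega>) = distr Q ?B (\<lambda>\<omega>. \<lambda>i\<in>S. ?X i \<omega>)"
    by (rule field.centered_gaussian_law_symmetric[OF field.centered_field S])
  also have "(\<integral>z. ln (F z) \<partial>distr Q ?B (\<lambda>\<omega>. \<lambda>i\<in>S. ?X i \<omega>)) = (\<integral>\<omega>. ln (grid_fk l t y N (env \<omega>)) \<partial>Q)"
    by (subst integral_distr[OF m1]) (simp_all only: F1 borel_measurable_ln F)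
  finally show "(\<integral>\<omega>. ln (grid_fk l t y N (\<lambda>x s. - b x s \<omega>)) \<partial>Q) = (\<integral>\<omega>. ln (grid_fk l t y N (env \<omega>)) \<partial>Q)" .
  show "(\<lambda>\<omega>. grid_fk l t y N (\<lambda>x s. - b x s \<omega>)) \<in> borel_measurable Q"
    using measurable_compose[OF m2 F] unfolding F2 .
qed

text \<open>Reflecting \<open>W\<^sub>1\<close> turns \<open>- l\<close> into \<open>l\<close> at the price of replacing \<open>b\<close> by \<open>- b\<close>, which has the same law.\<close>

lemma expectation_ln_fk_even:
  assumes t: "0 \<le> t"
  shows "(\<integral>\<omega>. ln (fk (- l) (env \<omega>) t y) \<partial>Q) = (\<integral>\<omega>. ln (fk l (env \<omega>) t y) \<partial>Q)"
proof -
  have "(\<integral>\<omega>. ln (fk (- l) (env \<omega>) t y) \<partial>Q) = (\<integral>\<omega>. ln (fk l (\<lambda>x s. - b x s \<omega>) t y) \<partial>Q)"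
    using fk_reflect[OF field.L_pos field.environment_env t, of _ "- l" y]
    by (intro Bochner_Integration.integral_cong) auto
  also have "\<dots> = (\<integral>\<omega>. ln (fk l (env \<omega>) t y) \<partial>Q)"
  proof (rule LIMSEQ_unique)
    show "(\<lambda>N. \<integral>\<omega>. ln (grid_fk l t y N (\<lambda>x s. - b x s \<omega>)) \<partial>Q) \<longlonglongrightarrow> (\<integral>\<omega>. ln (fk l (\<lambda>x s. - b x s \<omega>) t y) \<partial>Q)"
      by (rule expectation_ln_grid_fk_tendsto(1)[OF t _ law_grid_fk_uminus(2)[OF t]]) simp
    show "(\<lambda>N. \<integral>\<omega>. ln (grid_fk l t y N (\<lambda>x s. - b x s \<omega>)) \<partial>Q) \<longlonglongrightarrow> (\<integral>\<omega>. ln (fk l (env \<omega>) t y) \<partial>Q)"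
      unfolding law_grid_fk_uminus(1)[OF t]
      by (rule expectation_ln_grid_fk_tendsto(1)[OF t _ grid_fk_measurable[OF t]]) simp
  qed
  finally show ?thesis .
qed

end

section \<open>The Lyapunov exponent\<close>

context shear_wiener begin

text \<open>The functional ignores negative times, where the shift relation for the field is not available.\<close>

lemma fk_cong:
  assumes "\<And>y s. 0 \<le> s \<Longrightarrow> s \<le> t \<Longrightarrow> \<beta> y s = \<beta>' y s"
  shows "fk l \<beta> t y = fk l \<beta>' t y"
proof -
  have "drift \<beta> t y v = drift \<beta>' t y v" for v
    unfolding drift_def using assms by (intro Henstock_Kurzweil_Integration.integral_cong) auto
  then show ?thesis by (simp add: fk_def)
qed

lemma sup_inf_ln_fk_cong:
  assumes "\<And>y s. 0 \<le> s \<Longrightarrow> s \<le> t \<Longrightarrow> \<beta> y s = \<beta>' y s"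
  shows "sup_ln_fk l \<beta> t = sup_ln_fk l \<beta>' t" "inf_ln_fk l \<beta> t = inf_ln_fk l \<beta>' t"
  unfolding sup_ln_fk_def inf_ln_fk_def using fk_cong[OF assms, where l=l] by simp_all

text \<open>Hoelder's inequality: dividing the integrands by their integrals \<open>exp a\<close> and \<open>exp a'\<close>, it follows from
  pointwise convexity of the exponential function.\<close>

lemma ln_fk_convex:
  assumes L: "L > 0" and env: "environment L \<beta>" and t: "0 \<le> t" and u: "0 \<le> u" "u \<le> 1"
  shows "ln (fk ((1 - u) * l + u * l') \<beta> t y) \<le> (1 - u) * ln (fk l \<beta> t y) + u * ln (fk l' \<beta> t y)"
proof -
  define X where "X v = fst (W t v) + drift \<beta> t y v" for v
  define a where "a = ln (fk l \<beta> t y)"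
  define a' where "a' = ln (fk l' \<beta> t y)"
  define m where "m = (1 - u) * l + u * l'"
  note int = fk_integrable[OF L env t, of _ y, folded X_def]
  note pos = fk_pos[OF L env t]
  have fa: "fk l \<beta> t y = exp a" "fk l' \<beta> t y = exp a'" using pos by (simp_all add: a_def a'_def)
  have fkX: "fk c \<beta> t y = (\<integral>v. exp (- c * X v) \<partial>P)" for c by (simp add: fk_def X_def)
  have pt: "exp (- m * X v) * exp (- ((1 - u) * a + u * a')) \<le> (1 - u) * (exp (- l * X v) * exp (- a)) + u * (exp (- l' * X v) * exp (- a'))" for v
  proof -
    have "exp ((1 - u) *\<^sub>R (- l * X v + - a) + u *\<^sub>R (- l' * X v + - a')) \<le> (1 - u) * exp (- l * X v + - a) + u * exp (- l' * X v + - a')"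
      using u by (intro convex_onD[OF exp_convex]) auto
    moreover have e: "(1 - u) *\<^sub>R (- l * X v + - a) + u *\<^sub>R (- l' * X v + - a') = - m * X v + - ((1 - u) * a + u * a')"
      by (simp add: m_def algebra_simps)
    ultimately show ?thesis by (simp only: exp_add[symmetric] e)
  qed
  have "fk m \<beta> t y * exp (- ((1 - u) * a + u * a')) = (\<integral>v. exp (- m * X v) * exp (- ((1 - u) * a + u * a')) \<partial>P)"
    unfolding fkX by simp
  also have "\<dots> \<le> (\<integral>v. (1 - u) * (exp (- l * X v) * exp (- a)) + u * (exp (- l' * X v) * exp (- a')) \<partial>P)"
    by (intro integral_mono pt integrable_mult_left int Bochner_Integration.integrable_add integrable_mult_right)
  also have "\<dots> = (1 - u) * (fk l \<beta> t y * exp (- a)) + u * (fk l' \<beta> t y * exp (- a'))"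
    unfolding fkX using int by (subst Bochner_Integration.integral_add) (auto intro!: integrable_mult_left int integrable_mult_right)
  also have "\<dots> = 1" unfolding fa by (simp add: exp_minus)
  finally have "fk m \<beta> t y * exp (- ((1 - u) * a + u * a')) \<le> 1" .
  moreover have "x \<le> exp d" if "x * exp (- d) \<le> 1" for x d :: real
    using that by (simp add: exp_minus field_simps)
  ultimately have "fk m \<beta> t y \<le> exp ((1 - u) * a + u * a')" by blast
  then have "ln (fk m \<beta> t y) \<le> ln (exp ((1 - u) * a + u * a'))" using pos by (intro ln_mono) auto
  then show ?thesis by (simp add: m_def a_def a'_def)
qed

end

lemma filterlim_nat_floor_div:
  assumes "(k::real) > 0"
  shows "filterlim (\<lambda>t. nat \<lfloor>t / k\<rfloor>) sequentially at_top"
proof (rule filterlim_at_top[THEN iffD2], intro allI)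
  fix n :: nat
  show "\<forall>\<^sub>F t in at_top. n \<le> nat \<lfloor>t / k\<rfloor>"
    using eventually_ge_at_top[of "real n * k"]
  proof eventually_elim
    case (elim t)
    then have "real n \<le> t / k" using assms by (simp add: field_simps)
    then show ?case by linarith
  qed
qed

lemma nat_floor_div_over:
  assumes "(k::real) > 0"
  shows "((\<lambda>t. real (nat \<lfloor>t / k\<rfloor>) / t) \<longlongrightarrow> 1 / k) at_top"
proof (rule tendsto_sandwich)
  show "\<forall>\<^sub>F t in at_top. 1 / k - 1 / t \<le> real (nat \<lfloor>t / k\<rfloor>) / t"
    using eventually_gt_at_top[of 0]
  proof eventually_elim
    case (elim t)
    have "t / k - 1 \<le> real (nat \<lfloor>t / k\<rfloor>)" by linarith
    then have "(t / k - 1) / t \<le> real (nat \<lfloor>t / k\<rfloor>) / t" using elim by (intro divide_right_mono) auto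
    moreover have "(t / k - 1) / t = 1 / k - 1 / t" using elim assms by (simp add: field_simps)
    ultimately show ?case by simp
  qed
  show "\<forall>\<^sub>F t in at_top. real (nat \<lfloor>t / k\<rfloor>) / t \<le> 1 / k"
    using eventually_gt_at_top[of 0]
  proof eventually_elim
    case (elim t)
    have "0 \<le> t / k" using elim assms by simp
    then have "real (nat \<lfloor>t / k\<rfloor>) \<le> t / k" by linarith
    then have "real (nat \<lfloor>t / k\<rfloor>) / t \<le> (t / k) / t" using elim by (intro divide_right_mono) auto
    then show ?case using elim by simp
  qed
  have "((\<lambda>t::real. 1 / t) \<longlongrightarrow> 0) at_top" by (intro tendsto_divide_0[OF tendsto_const] filterlim_at_top_imp_at_infinity filterlim_ident)
  from tendsto_diff[OF tendsto_const this] show "((\<lambda>t. 1 / k - 1 / t) \<longlongrightarrow> 1 / k) at_top" by simp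
qed simp

context random_shear_wiener begin

lemma sup_inf_measurable:
  assumes t: "0 \<le> t"
  shows "(\<lambda>\<omega>. sup_ln_fk l (env \<omega>) t) \<in> borel_measurable Q" "(\<lambda>\<omega>. inf_ln_fk l (env \<omega>) t) \<in> borel_measurable Q"
proof -
  obtain D :: "(real ^ 'm) set" where D: "countable D" "D \<subseteq> UNIV" "UNIV \<subseteq> closure D" by (rule separable)
  have ne: "D \<noteq> {}" using D(3) by auto
  have [measurable]: "(\<lambda>\<omega>. ln (fk l (env \<omega>) t y)) \<in> borel_measurable Q" for y
    using fk_env_measurable[OF t] by measurable
  note bt = ln_fk_between[OF field.L_pos field.environment_env t]
  have bb: "bdd_above (range (\<lambda>y. - ln (fk l (env \<omega>) t y)))" if "\<omega> \<in> space Q" for \<omega>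
    using bt(2)[OF that, of l] by (auto simp: bdd_above_def bdd_below_def) (metis neg_le_iff_le)
  have cont: "continuous_on UNIV (\<lambda>y. ln (fk l (env \<omega>) t y))" if "\<omega> \<in> space Q" for \<omega>
    by (rule ln_fk_continuous[OF field.L_pos field.environment_env[OF that] t])
  have 1: "sup_ln_fk l (env \<omega>) t = (SUP y\<in>D. ln (fk l (env \<omega>) t y))" if w: "\<omega> \<in> space Q" for \<omega>
    unfolding sup_ln_fk_def by (rule SUP_dense[OF closed_UNIV cont[OF w] D(2,3) ne bt(1)[OF w]])
  have 2: "inf_ln_fk l (env \<omega>) t = - (SUP y\<in>D. - ln (fk l (env \<omega>) t y))" if w: "\<omega> \<in> space Q" for \<omega>
  proof -
    have "inf_ln_fk l (env \<omega>) t = - (SUP y. - ln (fk l (env \<omega>) t y))"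
      unfolding inf_ln_fk_def Inf_real_def by (simp add: image_image)
    also have "(SUP y. - ln (fk l (env \<omega>) t y)) = (SUP y\<in>D. - ln (fk l (env \<omega>) t y))"
      by (rule SUP_dense[OF closed_UNIV continuous_on_minus[OF cont[OF w]] D(2,3) ne bb[OF w]])
    finally show ?thesis .
  qed
  have "bdd_above ((\<lambda>y. ln (fk l (env \<omega>) t y)) ` D)" if "\<omega> \<in> space Q" for \<omega>
    by (rule bdd_above_mono[OF bt(1)[OF that]]) auto
  then have "(\<lambda>\<omega>. SUP y\<in>D. ln (fk l (env \<omega>) t y)) \<in> borel_measurable Q"
    using D(1) by (intro borel_measurable_cSUP) auto
  then show "(\<lambda>\<omega>. sup_ln_fk l (env \<omega>) t) \<in> borel_measurable Q"
    by (subst measurable_cong[OF 1]) auto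
  have "bdd_above ((\<lambda>y. - ln (fk l (env \<omega>) t y)) ` D)" if "\<omega> \<in> space Q" for \<omega>
    by (rule bdd_above_mono[OF bb[OF that]]) auto
  then have "(\<lambda>\<omega>. SUP y\<in>D. - ln (fk l (env \<omega>) t y)) \<in> borel_measurable Q"
    using D(1) by (intro borel_measurable_cSUP) auto
  then show "(\<lambda>\<omega>. inf_ln_fk l (env \<omega>) t) \<in> borel_measurable Q"
    by (subst measurable_cong[OF 2]) auto
qed

lemma sup_inf_ln_fk_integrable:
  assumes t: "0 \<le> t"
  shows "integrable Q (\<lambda>\<omega>. sup_ln_fk l (env \<omega>) t)" "integrable Q (\<lambda>\<omega>. inf_ln_fk l (env \<omega>) t)"
    "integrable Q (\<lambda>\<omega>. ln (fk l (env \<omega>) t y))"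
proof -
  let ?w = "\<lambda>\<omega>. l\<^sup>2 * t / 2 + \<bar>l\<bar> * (t * field.max_field t \<omega>)"
  have iw: "integrable Q ?w" using field.max_field_integrable[OF t] by auto
  have e0: "0 \<le> l\<^sup>2 * t / 2" using t by simp
  have bd: "\<bar>sup_ln_fk l (env \<omega>) t - l\<^sup>2 * t / 2\<bar> \<le> \<bar>l\<bar> * (t * field.max_field t \<omega>)"
    "\<bar>inf_ln_fk l (env \<omega>) t - l\<^sup>2 * t / 2\<bar> \<le> \<bar>l\<bar> * (t * field.max_field t \<omega>)"
    "\<bar>ln (fk l (env \<omega>) t y) - l\<^sup>2 * t / 2\<bar> \<le> \<bar>l\<bar> * (t * field.max_field t \<omega>)" if w: "\<omega> \<in> space Q" for \<omega>
    by (rule sup_inf_ln_fk_bounds[OF field.L_pos field.environment_env[OF w] t] ln_fk_bounds[OF field.L_pos field.environment_env[OF w] t];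
        rule field.abs_field_le_max(2)[OF w]; assumption)+
  have r: "\<bar>c\<bar> \<le> \<bar>l\<^sup>2 * t / 2 + d\<bar>" if "\<bar>c - l\<^sup>2 * t / 2\<bar> \<le> d" for c d
    using that e0 by linarith
  show "integrable Q (\<lambda>\<omega>. sup_ln_fk l (env \<omega>) t)"
    by (rule Bochner_Integration.integrable_bound[OF iw sup_inf_measurable(1)[OF t]])
       (auto intro!: AE_I2 r bd)
  show "integrable Q (\<lambda>\<omega>. inf_ln_fk l (env \<omega>) t)"
    by (rule Bochner_Integration.integrable_bound[OF iw sup_inf_measurable(2)[OF t]])
       (auto intro!: AE_I2 r bd)
  have "(\<lambda>\<omega>. ln (fk l (env \<omega>) t y)) \<in> borel_measurable Q" using fk_env_measurable[OF t] by measurable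
  then show "integrable Q (\<lambda>\<omega>. ln (fk l (env \<omega>) t y))"
    by (rule Bochner_Integration.integrable_bound[OF iw]) (auto intro!: AE_I2 r bd)
qed

lemma tau_space: "0 \<le> s \<Longrightarrow> \<omega> \<in> space Q \<Longrightarrow> \<tau> s \<omega> \<in> space Q"
  using field.A2_preserving[of s] by (auto simp: measure_preserving_map_def dest: measurable_space)

text \<open>Iterating \<open>\<tau> k\<close> acts on the field as the shift by a multiple of \<open>k\<close>.\<close>

lemma env_orbit:
  assumes "0 \<le> k" "\<omega> \<in> space Q"
  shows "(\<tau> k ^^ j) \<omega> \<in> space Q" "0 \<le> t \<Longrightarrow> b y t ((\<tau> k ^^ j) \<omega>) = b y (t + real j * k) \<omega>"
proof -
  have "(\<tau> k ^^ j) \<omega> \<in> space Q \<and> (\<forall>t\<ge>0. b y t ((\<tau> k ^^ j) \<omega>) = b y (t + real j * k) \<omega>)"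
  proof (induction j)
    case (Suc j)
    have "b y t (\<tau> k ((\<tau> k ^^ j) \<omega>)) = b y (t + real (Suc j) * k) \<omega>" if "t \<ge> 0" for t
    proof -
      have "b y t (\<tau> k ((\<tau> k ^^ j) \<omega>)) = b y (t + k) ((\<tau> k ^^ j) \<omega>)"
        using field.A2_shift[OF assms(1) that, of "(\<tau> k ^^ j) \<omega>" y] Suc by simp
      also have "\<dots> = b y (t + k + real j * k) \<omega>" using Suc that assms by simp
      finally show ?thesis by (simp add: algebra_simps)
    qed
    then show ?case using Suc tau_space[OF assms(1)] by simp
  qed (use assms in simp)
  then show "(\<tau> k ^^ j) \<omega> \<in> space Q" "0 \<le> t \<Longrightarrow> b y t ((\<tau> k ^^ j) \<omega>) = b y (t + real j * k) \<omega>" by auto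
qed

definition mean_sup :: "real \<Rightarrow> real \<Rightarrow> real" where
  "mean_sup l k = (\<integral>\<omega>. sup_ln_fk l (env \<omega>) k \<partial>Q)"

definition mean_inf :: "real \<Rightarrow> real \<Rightarrow> real" where
  "mean_inf l k = (\<integral>\<omega>. inf_ln_fk l (env \<omega>) k \<partial>Q)"

text \<open>Cut \<open>[0, t]\<close> into \<open>n\<close> intervals of length \<open>k\<close> and a shorter last one, whose contribution is bounded by \<open>C\<close>.\<close>

lemma orbit_block_bounds:
  fixes l :: real
  assumes k: "0 < k" and t: "0 \<le> t" and w: "\<omega> \<in> space Q"
  defines "n \<equiv> nat \<lfloor>t / k\<rfloor>"
  defines "C \<equiv> \<lambda>\<omega>. l\<^sup>2 * k / 2 + \<bar>l\<bar> * (k * field.max_field k \<omega>)"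
  shows "sup_ln_fk l (env \<omega>) t \<le> (\<Sum>j<n. sup_ln_fk l (env ((\<tau> k ^^ j) \<omega>)) k) + C ((\<tau> k ^^ n) \<omega>)"
    and "(\<Sum>j<n. inf_ln_fk l (env ((\<tau> k ^^ j) \<omega>)) k) - C ((\<tau> k ^^ n) \<omega>) \<le> inf_ln_fk l (env \<omega>) t"
proof -
  have k0: "0 \<le> k" using k by simp
  note env = field.environment_env[OF w]
  let ?sh = "\<lambda>j y u. b y (u + real j * k) \<omega>"
  have sh: "sup_ln_fk l (?sh j) r = sup_ln_fk l (env ((\<tau> k ^^ j) \<omega>)) r"
    "inf_ln_fk l (?sh j) r = inf_ln_fk l (env ((\<tau> k ^^ j) \<omega>)) r" for j r
    by (rule sup_inf_ln_fk_cong; simp add: env_orbit(2)[OF k0 w])+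
  have zero: "sup_ln_fk l (env \<omega>) 0 = 0" "inf_ln_fk l (env \<omega>) 0 = 0"
    by (simp_all add: sup_ln_fk_def inf_ln_fk_def fk_0)
  have sums: "sup_ln_fk l (env \<omega>) (real n * k) \<le> (\<Sum>j<n. sup_ln_fk l (env ((\<tau> k ^^ j) \<omega>)) k)
      \<and> (\<Sum>j<n. inf_ln_fk l (env ((\<tau> k ^^ j) \<omega>)) k) \<le> inf_ln_fk l (env \<omega>) (real n * k)" for n
  proof (induction n)
    case (Suc n)
    have nk: "0 \<le> real n * k" using k0 by simp
    have e: "k + real n * k = real (Suc n) * k" by (simp add: algebra_simps)
    show ?case
      using Suc ln_fk_sub_and_superadditive[OF field.L_pos env k0 nk, of l, unfolded sh e] by simp
  qed (simp add: zero)
  have nk: "0 \<le> real n * k" using k0 by simp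
  define r where "r = t - real n * k"
  have r: "0 \<le> r" "r \<le> k"
  proof -
    have "0 \<le> t / k" using t k by simp
    then have "real n \<le> t / k" "t / k \<le> real n + 1" unfolding n_def by linarith+
    then have "real n * k \<le> t" "t \<le> (real n + 1) * k" using k by (simp_all add: field_simps)
    then show "0 \<le> r" "r \<le> k" by (simp_all add: r_def algebra_simps)
  qed
  have rt: "r + real n * k = t" by (simp add: r_def)
  let ?w = "(\<tau> k ^^ n) \<omega>"
  have w': "?w \<in> space Q" by (rule env_orbit(1)[OF k0 w])
  have B: "\<bar>b y s ?w\<bar> \<le> field.max_field k ?w" if "0 \<le> s" "s \<le> r" for y s
    using field.abs_field_le_max(2)[OF w' that(1), of k y] that r by simp
  note bb = sup_inf_ln_fk_bounds[OF field.L_pos field.environment_env[OF w'] r(1), of "field.max_field k ?w" l, OF B]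
  have "\<bar>l\<bar> * (r * field.max_field k ?w) \<le> \<bar>l\<bar> * (k * field.max_field k ?w)" 
    using r field.max_field_nonneg[OF w' k0] by (intro mult_left_mono mult_right_mono) auto
  moreover have "l\<^sup>2 * r / 2 \<le> l\<^sup>2 * k / 2" "0 \<le> l\<^sup>2 * r / 2" using r by (auto simp: mult_left_mono)
  ultimately have Cb: "sup_ln_fk l (env ?w) r \<le> C ?w" "- C ?w \<le> inf_ln_fk l (env ?w) r"
    using bb unfolding C_def by linarith+
  note sub = ln_fk_sub_and_superadditive[OF field.L_pos env r(1) nk, of l, unfolded sh rt]
  show "sup_ln_fk l (env \<omega>) t \<le> (\<Sum>j<n. sup_ln_fk l (env ((\<tau> k ^^ j) \<omega>)) k) + C ?w"
    using sub(1) sums[of n] Cb by linarith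
  show "(\<Sum>j<n. inf_ln_fk l (env ((\<tau> k ^^ j) \<omega>)) k) - C ?w \<le> inf_ln_fk l (env \<omega>) t"
    using sub(2) sums[of n] Cb by linarith
qed

text \<open>The ergodic theorem for \<open>\<tau> k\<close> handles the sums over the intervals of length \<open>k\<close>, and integrability of \<open>C\<close>
  makes the contribution of the last interval negligible.\<close>

lemma ergodic_bounds:
  assumes k: "0 < k"
  shows "AE \<omega> in Q. \<exists>U V. (U \<longlongrightarrow> mean_sup l k / k) at_top \<and> (V \<longlongrightarrow> mean_inf l k / k) at_top \<and>
    (\<forall>t>0. sup_ln_fk l (env \<omega>) t / t \<le> U t \<and> V t \<le> inf_ln_fk l (env \<omega>) t / t)"
proof -
  have k0: "0 \<le> k" using k by simp
  let ?T = "\<tau> k"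
  let ?C = "\<lambda>\<omega>. l\<^sup>2 * k / 2 + \<bar>l\<bar> * (k * field.max_field k \<omega>)"
  note mp = field.A2_preserving[OF k0]
  note erg = field.A3[OF k]
  have iC: "integrable Q ?C" using field.max_field_integrable[OF k0] by auto
  note b1 = field.birkhoff_ergodic[OF mp erg sup_inf_ln_fk_integrable(1)[OF k0, of l]]
  note b2 = field.birkhoff_ergodic[OF mp erg sup_inf_ln_fk_integrable(2)[OF k0, of l]]
  note b3 = field.orbit_value_sublinear[OF mp erg iC]
  from b1 b2 b3 AE_space show ?thesis
  proof eventually_elim
    case (elim \<omega>)
    let ?n = "\<lambda>t. nat \<lfloor>t / k\<rfloor>"
    note n = filterlim_nat_floor_div[OF k]
    note nt = nat_floor_div_over[OF k]
    let ?A = "\<lambda>n. \<Sum>j<n. sup_ln_fk l (env ((?T ^^ j) \<omega>)) k"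
    let ?B = "\<lambda>n. \<Sum>j<n. inf_ln_fk l (env ((?T ^^ j) \<omega>)) k"
    let ?D = "\<lambda>n. ?C ((?T ^^ n) \<omega>)"
    have S: "((\<lambda>t. F (?n t) / t) \<longlongrightarrow> x / k) at_top" if "(\<lambda>n. F n / real n) \<longlonglongrightarrow> x" for F x
    proof -
      have "((\<lambda>t. F (?n t) / real (?n t) * (real (?n t) / t)) \<longlongrightarrow> x * (1 / k)) at_top"
        by (intro tendsto_mult nt filterlim_compose[OF that n])
      moreover have "\<forall>\<^sub>F t in at_top. F (?n t) / real (?n t) * (real (?n t) / t) = F (?n t) / t"
        using eventually_ge_at_top[of k]
      proof eventually_elim
        case (elim t)
        then have "1 \<le> t / k" using k by simp
        then have n0: "real (?n t) \<noteq> 0" by linarith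
        have "x / c * (c / t) = x / t" if "c \<noteq> 0" for x c :: real using that by simp
        then show ?case using n0 by blast
      qed
      ultimately have "((\<lambda>t. F (?n t) / t) \<longlongrightarrow> x * (1 / k)) at_top"
        by (rule Lim_transform_eventually)
      then show ?thesis by simp
    qed
    let ?U = "\<lambda>t. ?A (?n t) / t + ?D (?n t) / t" and ?V = "\<lambda>t. ?B (?n t) / t - ?D (?n t) / t"
    have "(?U \<longlongrightarrow> mean_sup l k / k + 0 / k) at_top" "(?V \<longlongrightarrow> mean_inf l k / k - 0 / k) at_top"
      unfolding mean_sup_def mean_inf_def using elim by (intro tendsto_add tendsto_diff S; simp)+
    moreover have "sup_ln_fk l (env \<omega>) t / t \<le> ?U t \<and> ?V t \<le> inf_ln_fk l (env \<omega>) t / t" if t: "t > 0" for t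
    proof -
      note bb = orbit_block_bounds[OF k less_imp_le[OF t] elim(4), of l]
      show ?thesis
        unfolding add_divide_distrib[symmetric] diff_divide_distrib[symmetric]
        using bb t by (intro conjI divide_right_mono) auto
    qed
    ultimately show ?case by (intro exI[of _ ?U] exI[of _ ?V]) simp
  qed
qed

text \<open>Both sides bound the same limit points, so the inequality holds for different \<open>j\<close> and \<open>k\<close>.\<close>

lemma mean_inf_le_mean_sup:
  assumes "0 < j" "0 < k"
  shows "mean_inf l j / j \<le> mean_sup l k / k"
proof -
  have "AE \<omega> in Q. mean_inf l j / j \<le> mean_sup l k / k"
    using ergodic_bounds[OF assms(1), of l] ergodic_bounds[OF assms(2), of l] AE_space
  proof eventually_elim
    case (elim \<omega>)
    from elim(1) obtain V where V: "(V \<longlongrightarrow> mean_inf l j / j) at_top" "\<And>t. t > 0 \<Longrightarrow> V t \<le> inf_ln_fk l (env \<omega>) t / t" by blast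
    from elim(2) obtain U where U: "(U \<longlongrightarrow> mean_sup l k / k) at_top" "\<And>t. t > 0 \<Longrightarrow> sup_ln_fk l (env \<omega>) t / t \<le> U t" by blast
    show ?case
    proof (rule tendsto_le[OF _ U(1) V(1)])
      show "\<forall>\<^sub>F t in at_top. V t \<le> U t"
        using eventually_gt_at_top[of 0]
      proof eventually_elim
        case t: (elim t)
        have "inf_ln_fk l (env \<omega>) t \<le> sup_ln_fk l (env \<omega>) t"
          using ln_fk_between(3,4)[OF field.L_pos field.environment_env[OF elim(3)], of t l 0] t by linarith
        then have "inf_ln_fk l (env \<omega>) t / t \<le> sup_ln_fk l (env \<omega>) t / t" using t by (intro divide_right_mono) auto
        then show ?case using U(2)[OF t] V(2)[OF t] by linarith
      qed
    qed simp
  qed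
  then show ?thesis by simp
qed

text \<open>The expectation of the logarithm of the factor in the Harnack inequality.\<close>

definition harnack_gap :: "real \<Rightarrow> real" where
  "harnack_gap l = ln (harnack_const L) + 3 * \<bar>l\<bar> * (\<integral>\<omega>. field.max_field 2 \<omega> \<partial>Q)"

text \<open>The maximum of the field over the time window \<open>[k - 1, k + 1]\<close> has the same mean as over \<open>[0, 2]\<close>.\<close>

lemma mean_sup_le_mean_inf:
  assumes k: "1 \<le> k"
  shows "mean_sup l k \<le> mean_inf l (k + 1) + harnack_gap l"
proof -
  have k0: "0 \<le> k" "0 \<le> k + 1" "0 \<le> k - 1" using k by auto
  let ?K = "\<lambda>\<omega>. field.max_field 2 (\<tau> (k - 1) \<omega>)"
  have iK: "integrable Q (field.max_field 2)" by (rule field.max_field_integrable) simp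
  note mpi = field.measure_preserving_integral[OF field.A2_preserving[OF k0(3)] iK]
  have "mean_sup l k \<le> (\<integral>\<omega>. inf_ln_fk l (env \<omega>) (k + 1) + (ln (harnack_const L) + 3 * \<bar>l\<bar> * ?K \<omega>) \<partial>Q)"
    unfolding mean_sup_def
  proof (rule integral_mono[OF sup_inf_ln_fk_integrable(1)[OF k0(1)]])
    show "integrable Q (\<lambda>\<omega>. inf_ln_fk l (env \<omega>) (k + 1) + (ln (harnack_const L) + 3 * \<bar>l\<bar> * ?K \<omega>))"
      by (intro Bochner_Integration.integrable_add sup_inf_ln_fk_integrable k0 field.integrable_const integrable_mult_right mpi)
    fix \<omega> assume w: "\<omega> \<in> space Q"
    have "\<bar>b y (s + (k - 1)) \<omega>\<bar> \<le> ?K \<omega>" if "0 \<le> s" "s \<le> 2" for y s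
      using field.abs_field_le_max(2)[OF tau_space[OF k0(3) w] that, of y] field.A2_shift[OF k0(3) that(1) w, of y] by simp
    from sup_le_inf_ln_fk[OF field.L_pos field.environment_env[OF w] k0(3), of "?K \<omega>" l, OF this]
    show "sup_ln_fk l (env \<omega>) k \<le> inf_ln_fk l (env \<omega>) (k + 1) + (ln (harnack_const L) + 3 * \<bar>l\<bar> * ?K \<omega>)"
      by (simp add: algebra_simps)
  qed
  also have "\<dots> = mean_inf l (k + 1) + harnack_gap l"
    unfolding mean_inf_def harnack_gap_def
    using sup_inf_ln_fk_integrable(2)[OF k0(2), of l] mpi
    by (subst Bochner_Integration.integral_add; simp add: field.prob_space)
  finally show ?thesis .
qed

lemma mean_sup_ge:
  assumes "0 \<le> k"
  shows "l\<^sup>2 * k / 2 \<le> mean_sup l k"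
    "mean_inf l k \<le> (\<integral>\<omega>. ln (fk l (env \<omega>) k 0) \<partial>Q)" "(\<integral>\<omega>. ln (fk l (env \<omega>) k 0) \<partial>Q) \<le> mean_sup l k"
proof -
  note bt = ln_fk_between[OF field.L_pos field.environment_env assms]
  show "mean_inf l k \<le> (\<integral>\<omega>. ln (fk l (env \<omega>) k 0) \<partial>Q)"
    unfolding mean_inf_def using bt(3) by (intro integral_mono sup_inf_ln_fk_integrable assms)
  show "(\<integral>\<omega>. ln (fk l (env \<omega>) k 0) \<partial>Q) \<le> mean_sup l k"
    unfolding mean_sup_def using bt(4) by (intro integral_mono sup_inf_ln_fk_integrable assms)
  with expectation_ln_fk_ge[OF assms, of l 0] show "l\<^sup>2 * k / 2 \<le> mean_sup l k" by linarith
qed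

definition lyapunov :: "real \<Rightarrow> real" where
  "lyapunov l = (INF k. mean_sup l (real (Suc k)) / real (Suc k))"

lemma lyapunov_le:
  assumes "0 < k"
  shows "lyapunov l \<le> mean_sup l (real k) / real k" "l\<^sup>2 / 2 \<le> lyapunov l"
proof -
  have lb: "l\<^sup>2 / 2 \<le> mean_sup l (real (Suc k)) / real (Suc k)" for k
    using mean_sup_ge(1)[of "real (Suc k)" l] by (simp add: field_simps)
  show "l\<^sup>2 / 2 \<le> lyapunov l" unfolding lyapunov_def using lb by (intro cINF_greatest) auto
  have "bdd_below (range (\<lambda>k. mean_sup l (real (Suc k)) / real (Suc k)))" using lb by (intro bdd_belowI2)
  then have "lyapunov l \<le> mean_sup l (real (Suc (k - 1))) / real (Suc (k - 1))"
    unfolding lyapunov_def by (rule cINF_lower) simp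
  then show "lyapunov l \<le> mean_sup l (real k) / real k" using assms by simp
qed

lemma mean_inf_le_lyapunov:
  assumes "0 < k"
  shows "mean_inf l k / k \<le> lyapunov l"
  unfolding lyapunov_def using mean_inf_le_mean_sup[OF assms] by (intro cINF_greatest) auto

text \<open>With \<open>a\<close> the exponent and \<open>c\<close> the gap, \<open>k * a \<le> mean_sup l k \<le> mean_inf l (k + 1) + c \<le> (k + 1) * a + c\<close>.\<close>

lemma mean_over_time_tendsto:
  shows "(\<lambda>k. mean_sup l (real k) / real k) \<longlonglongrightarrow> lyapunov l" "(\<lambda>k. mean_inf l (real k) / real k) \<longlonglongrightarrow> lyapunov l"
proof -
  let ?a = "lyapunov l" and ?c = "harnack_gap l"
  have "(\<lambda>k. ?a + (?a + ?c) / real k) \<longlonglongrightarrow> ?a + 0" "(\<lambda>k. ?a + (- ?a - ?c) / real k) \<longlonglongrightarrow> ?a + 0"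
    by (intro tendsto_add tendsto_const lim_const_over_n)+
  then have lims: "(\<lambda>k. ?a + (?a + ?c) / real k) \<longlonglongrightarrow> ?a" "(\<lambda>k. ?a + (- ?a - ?c) / real k) \<longlonglongrightarrow> ?a" by simp_all
  have up: "\<forall>\<^sub>F k in sequentially. mean_sup l (real k) / real k \<le> ?a + (?a + ?c) / real k"
    using eventually_gt_at_top[of 0]
  proof eventually_elim
    case (elim k)
    have "mean_sup l (real k) \<le> mean_inf l (real k + 1) + ?c" using elim by (intro mean_sup_le_mean_inf) simp
    also have "mean_inf l (real k + 1) \<le> (real k + 1) * ?a" using mean_inf_le_lyapunov[of "real k + 1" l] by (simp add: field_simps)
    finally have "mean_sup l (real k) / real k \<le> (real k * ?a + (?a + ?c)) / real k"
      by (intro divide_right_mono) (simp_all add: algebra_simps)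
    then show ?case using elim by (simp add: add_divide_distrib)
  qed
  have low: "\<forall>\<^sub>F k in sequentially. ?a + (- ?a - ?c) / real k \<le> mean_inf l (real k) / real k"
    using eventually_gt_at_top[of 1]
  proof eventually_elim
    case (elim k)
    have "mean_sup l (real (k - 1)) \<le> mean_inf l (real (k - 1) + 1) + ?c" using elim by (intro mean_sup_le_mean_inf) simp
    moreover have "real (k - 1) * ?a \<le> mean_sup l (real (k - 1))"
      using lyapunov_le(1)[of "k - 1" l] elim by (simp add: field_simps)
    moreover have "real (k - 1) + 1 = real k" "real (k - 1) = real k - 1" using elim by auto
    ultimately have "(real k * ?a + (- ?a - ?c)) / real k \<le> mean_inf l (real k) / real k"
      by (intro divide_right_mono) (simp_all add: algebra_simps)
    then show ?case using elim by (simp add: add_divide_distrib diff_divide_distrib)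
  qed
  have up': "\<forall>\<^sub>F k in sequentially. mean_inf l (real k) / real k \<le> ?a"
    using eventually_gt_at_top[of 0] by eventually_elim (simp add: mean_inf_le_lyapunov)
  have low': "\<forall>\<^sub>F k in sequentially. ?a \<le> mean_sup l (real k) / real k"
    using eventually_gt_at_top[of 0] by eventually_elim (simp add: lyapunov_le)
  show "(\<lambda>k. mean_sup l (real k) / real k) \<longlonglongrightarrow> ?a" by (rule tendsto_sandwich[OF low' up tendsto_const lims(1)])
  show "(\<lambda>k. mean_inf l (real k) / real k) \<longlonglongrightarrow> ?a" by (rule tendsto_sandwich[OF low up' lims(2) tendsto_const])
qed

lemma lyapunov_even: "lyapunov (- l) = lyapunov l"
proof -
  have "(\<lambda>k. (\<integral>\<omega>. ln (fk l (env \<omega>) (real k) 0) \<partial>Q) / real k) \<longlonglongrightarrow> lyapunov l" for l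
    by (rule tendsto_sandwich[OF _ _ mean_over_time_tendsto(2) mean_over_time_tendsto(1)])
       (auto intro!: always_eventually divide_right_mono mean_sup_ge)
  from this[of l] this[of "- l"] show ?thesis
    unfolding expectation_ln_fk_even[OF of_nat_0_le_iff, of l] by (rule LIMSEQ_unique[rotated])
qed

theorem ln_fk_over_time_tendsto:
  "AE \<omega> in Q. \<forall>y. ((\<lambda>t. ln (fk l (env \<omega>) t y) / t) \<longlongrightarrow> lyapunov l) at_top"
proof -
  have "AE \<omega> in Q. \<forall>k. \<exists>U V. (U \<longlongrightarrow> mean_sup l (real (Suc k)) / real (Suc k)) at_top \<and> (V \<longlongrightarrow> mean_inf l (real (Suc k)) / real (Suc k)) at_top \<and>
    (\<forall>t>0. sup_ln_fk l (env \<omega>) t / t \<le> U t \<and> V t \<le> inf_ln_fk l (env \<omega>) t / t)"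
    unfolding AE_all_countable by (intro allI ergodic_bounds) simp
  with AE_space show ?thesis
  proof eventually_elim
    case (elim \<omega>)
    note bt = ln_fk_between(3,4)[OF field.L_pos field.environment_env[OF elim(1)]]
    show ?case
    proof (intro allI order_tendstoI)
      fix y a assume a: "lyapunov l < a"
      have "\<forall>\<^sub>F k in sequentially. mean_sup l (real (Suc k)) / real (Suc k) < a"
        using LIMSEQ_Suc[OF mean_over_time_tendsto(1)] a by (rule order_tendstoD)
      then obtain k where k: "mean_sup l (real (Suc k)) / real (Suc k) < a"
        by (auto simp: eventually_at_top_linorder)
      obtain U where U: "(U \<longlongrightarrow> mean_sup l (real (Suc k)) / real (Suc k)) at_top" "\<And>t. t > 0 \<Longrightarrow> sup_ln_fk l (env \<omega>) t / t \<le> U t"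
        using elim(2) by blast
      from order_tendstoD(2)[OF U(1) k] eventually_gt_at_top[of 0]
      show "\<forall>\<^sub>F t in at_top. ln (fk l (env \<omega>) t y) / t < a"
      proof eventually_elim
        case (elim t)
        have "ln (fk l (env \<omega>) t y) / t \<le> sup_ln_fk l (env \<omega>) t / t"
          using elim bt(2) by (intro divide_right_mono) auto
        then show ?case using U(2)[OF elim(2)] elim(1) by linarith
      qed
    next
      fix y a assume a: "a < lyapunov l"
      have "\<forall>\<^sub>F k in sequentially. a < mean_inf l (real (Suc k)) / real (Suc k)"
        using LIMSEQ_Suc[OF mean_over_time_tendsto(2)] a by (rule order_tendstoD)
      then obtain k where k: "a < mean_inf l (real (Suc k)) / real (Suc k)"
        by (auto simp: eventually_at_top_linorder)
      obtain V where V: "(V \<longlongrightarrow> mean_inf l (real (Suc k)) / real (Suc k)) at_top" "\<And>t. t > 0 \<Longrightarrow> V t \<le> inf_ln_fk l (env \<omega>) t / t"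
        using elim(2) by blast
      from order_tendstoD(1)[OF V(1) k] eventually_gt_at_top[of 0]
      show "\<forall>\<^sub>F t in at_top. a < ln (fk l (env \<omega>) t y) / t"
      proof eventually_elim
        case (elim t)
        have "inf_ln_fk l (env \<omega>) t / t \<le> ln (fk l (env \<omega>) t y) / t"
          using elim bt(1) by (intro divide_right_mono) auto
        then show ?case using V(2)[OF elim(2)] elim(1) by linarith
      qed
    qed
  qed
qed

lemma lyapunov_convex: "convex_on UNIV lyapunov"
proof (rule convex_onI)
  fix u l l' :: real assume u: "0 < u" "u < 1"
  let ?m = "(1 - u) * l + u * l'"
  have "AE \<omega> in Q. lyapunov ?m \<le> (1 - u) * lyapunov l + u * lyapunov l'"
    using ln_fk_over_time_tendsto[of l] ln_fk_over_time_tendsto[of l'] ln_fk_over_time_tendsto[of ?m] AE_space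
  proof eventually_elim
    case (elim \<omega>)
    let ?F = "\<lambda>l t. ln (fk l (env \<omega>) t 0) / t"
    have "((\<lambda>t. (1 - u) * ?F l t + u * ?F l' t) \<longlongrightarrow> (1 - u) * lyapunov l + u * lyapunov l') at_top"
      using elim by (intro tendsto_intros) auto
    moreover have "(?F ?m \<longlongrightarrow> lyapunov ?m) at_top" using elim by blast
    moreover have "\<forall>\<^sub>F t in at_top. ?F ?m t \<le> (1 - u) * ?F l t + u * ?F l' t"
      using eventually_gt_at_top[of 0]
    proof eventually_elim
      case t: (elim t)
      have "ln (fk ?m (env \<omega>) t 0) \<le> (1 - u) * ln (fk l (env \<omega>) t 0) + u * ln (fk l' (env \<omega>) t 0)"
        using t u by (intro ln_fk_convex[OF field.L_pos field.environment_env[OF elim(4)]]) auto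
      then have "?F ?m t \<le> ((1 - u) * ln (fk l (env \<omega>) t 0) + u * ln (fk l' (env \<omega>) t 0)) / t"
        using t by (intro divide_right_mono) auto
      then show ?case by (simp add: add_divide_distrib)
    qed
    ultimately show ?case by (intro tendsto_le[OF trivial_limit_at_top_linorder])
  qed
  then show "lyapunov ((1 - u) *\<^sub>R l + u *\<^sub>R l') \<le> (1 - u) * lyapunov l + u * lyapunov l'" by simp
qed simp

lemma expectation_exp_X_process:
  "(\<integral>v. exp (- l * X_process b W \<omega> z t t v) \<partial>P) = exp (- l * fst z) * fk l (env \<omega>) t (snd z)"
proof -
  have "exp (- l * X_process b W \<omega> z t t v) = exp (- l * fst z) * exp (- l * (fst (W t v) + drift (env \<omega>) t (snd z) v))" for v
    unfolding exp_add[symmetric] by (simp add: X_process_def Y_process_def drift_def algebra_simps)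
  then show ?thesis by (simp add: fk_def)
qed

lemma ln_expectation_over_time_tendsto:
  "AE \<omega> in Q. \<forall>z. ((\<lambda>t. c + 1 / t * ln (\<integral>v. exp (- l * X_process b W \<omega> z t t v) \<partial>P)) \<longlongrightarrow> c + lyapunov l) at_top"
  using ln_fk_over_time_tendsto[of l] AE_space
proof eventually_elim
  case (elim \<omega>)
  show ?case
  proof (intro allI tendsto_add tendsto_const)
    fix z :: "real \<times> (real ^ 'm)"
    have "((\<lambda>t. (- l * fst z) / t + ln (fk l (env \<omega>) t (snd z)) / t) \<longlongrightarrow> 0 + lyapunov l) at_top"
      using elim(1) by (intro tendsto_add tendsto_divide_0[OF tendsto_const] filterlim_at_top_imp_at_infinity filterlim_ident) auto
    moreover have "\<forall>\<^sub>F t in at_top. (- l * fst z) / t + ln (fk l (env \<omega>) t (snd z)) / t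
        = 1 / t * ln (\<integral>v. exp (- l * X_process b W \<omega> z t t v) \<partial>P)"
      using eventually_gt_at_top[of 0]
    proof eventually_elim
      case t: (elim t)
      have "0 < fk l (env \<omega>) t (snd z)" using t by (intro fk_pos[OF field.L_pos field.environment_env[OF elim(2)]]) simp
      then show ?case unfolding expectation_exp_X_process by (simp add: ln_mult diff_divide_distrib)
    qed
    ultimately show "((\<lambda>t. 1 / t * ln (\<integral>v. exp (- l * X_process b W \<omega> z t t v) \<partial>P)) \<longlongrightarrow> lyapunov l) at_top"
      by (simp add: tendsto_cong)
  qed
qed

end

text \<open>The supremum of \<open>f u / u\<close> is taken over a bounded set, by the mean value theorem, and is at least the
  value at \<open>1 / 2\<close>.\<close>

lemma kpp_derivative_pos:
  assumes "kpp_nonlinearity f f'"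
  shows "0 < f' 0"
proof -
  have d: "\<And>u. u \<in> {0..1} \<Longrightarrow> (f has_real_derivative f' u) (at u within {0..1})"
    and c: "continuous_on {0..1} f'" and f0: "f 0 = 0" and fp: "\<And>u. u \<in> {0<..<1} \<Longrightarrow> f u > 0"
    and s: "f' 0 = (SUP u\<in>{0<..<1}. f u / u)"
    using assms by (auto simp: kpp_nonlinearity_def)
  have "compact (f' ` {0..1})" by (intro compact_continuous_image c compact_Icc)
  then obtain M where "\<forall>x\<in>f' ` {0..1}. norm x \<le> M" using compact_imp_bounded bounded_iff by metis
  then have M: "\<And>x. x \<in> {0..1} \<Longrightarrow> norm (f' x) \<le> M" by simp
  have "f u / u \<le> M" if "u \<in> {0<..<1}" for u
  proof -
    have "norm (f u - f 0) \<le> M * norm (u - 0)"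
      using d M that by (intro field_differentiable_bound[OF convex_real_interval(5)]) auto
    then have "\<bar>f u\<bar> \<le> M * u" using that f0 by simp
    then show ?thesis using that by (simp add: divide_le_eq)
  qed
  then have "bdd_above ((\<lambda>u. f u / u) ` {0<..<1})" by (intro bdd_aboveI2)
  then have "f (1 / 2) / (1 / 2) \<le> f' 0" unfolding s by (rule cSUP_upper[rotated]) simp
  moreover have "0 < f (1 / 2) / (1 / 2)" using fp[of "1 / 2"] by simp
  ultimately show ?thesis by linarith
qed

theorem lemma1p1:
  fixes f f' :: "real \<Rightarrow> real"
    and Q :: "'w measure"
    and L :: real
    and b :: "real ^ 'm \<Rightarrow> real \<Rightarrow> 'w \<Rightarrow> real"
    and \<tau> :: "real \<Rightarrow> 'w \<Rightarrow> 'w"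
    and P :: "'v measure"
    and W :: "real \<Rightarrow> 'v \<Rightarrow> real \<times> (real ^ 'm)"
  assumes "kpp_nonlinearity f f'"
    and "random_shear_field Q L b \<tau>"
    and "standard_wiener_process P W"
  shows "\<exists>\<mu> :: real \<Rightarrow> real.
      (\<forall>l. AE \<omega> in Q. \<forall>z.
         ((\<lambda>t. f' 0 + 1 / t * ln (\<integral>v. exp (- l * X_process b W \<omega> z t t v) \<partial>P)) \<longlongrightarrow> \<mu> l) at_top) \<and>
      convex_on UNIV \<mu> \<and>
      (\<forall>l. \<mu> l > 0) \<and>
      (\<forall>l. \<mu> (- l) = \<mu> l) \<and>
      filterlim (\<lambda>l. \<mu> l / \<bar>l\<bar>) at_top at_infinity"
proof -
  interpret random_shear_wiener Q L b \<tau> P W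
    using assms(2,3) by (intro random_shear_wiener.intro shear_wiener.intro)
  define \<mu> where "\<mu> l = f' 0 + lyapunov l" for l
  have f0: "0 < f' 0" by (rule kpp_derivative_pos[OF assms(1)])
  have quad: "l\<^sup>2 / 2 \<le> \<mu> l" for l
    using lyapunov_le(2)[of 1 l] f0 by (simp add: \<mu>_def)
  show ?thesis
  proof (intro exI[of _ \<mu>] conjI allI)
    show "AE \<omega> in Q. \<forall>z. ((\<lambda>t. f' 0 + 1 / t * ln (\<integral>v. exp (- l * X_process b W \<omega> z t t v) \<partial>P)) \<longlongrightarrow> \<mu> l) at_top" for l
      unfolding \<mu>_def by (rule ln_expectation_over_time_tendsto)
    show "convex_on UNIV \<mu>"
    proof -
      have "convex_on UNIV (\<lambda>_::real. f' 0)" by (simp add: convex_on_def distrib_right[symmetric])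
      then show ?thesis unfolding \<mu>_def[abs_def] by (intro convex_on_add lyapunov_convex)
    qed
    show "\<mu> l > 0" for l
      using lyapunov_le(2)[of 1 l] f0 by (simp add: \<mu>_def) (smt (verit) zero_le_power2 divide_nonneg_nonneg)
    show "\<mu> (- l) = \<mu> l" for l by (simp add: \<mu>_def lyapunov_even)
    show "filterlim (\<lambda>l. \<mu> l / \<bar>l\<bar>) at_top at_infinity"
    proof (rule filterlim_at_top_mono)
      have "filterlim (\<lambda>l::real. (1 / 2) * norm l) at_top at_infinity"
        by (intro filterlim_tendsto_pos_mult_at_top[OF tendsto_const] filterlim_norm_at_top) simp
      then show "filterlim (\<lambda>l::real. \<bar>l\<bar> / 2) at_top at_infinity" by simp
      show "\<forall>\<^sub>F l in at_infinity. \<bar>l\<bar> / 2 \<le> \<mu> l / \<bar>l\<bar>"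
        unfolding eventually_at_infinity
      proof (intro exI[of _ 1] allI impI)
        fix l :: real assume "1 \<le> norm l"
        then have "\<bar>l\<bar> > 0" by simp
        moreover have "\<bar>l\<bar> * \<bar>l\<bar> / 2 \<le> \<mu> l" using quad[of l] by (simp add: power2_eq_square)
        ultimately show "\<bar>l\<bar> / 2 \<le> \<mu> l / \<bar>l\<bar>" by (simp add: field_simps)
      qed
    qed
  qed
qed

end
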